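(* Let $s=1$, $I=[0,1]$, $\lambda_n>0$. Let $t_{(1)}<\dots<t_{(n)}$ be the order statistics of the design points, $\Delta_i=t_{(i+1)}-t_{(i)}$ ($i=1,\dots,n-1$), and let $Y_{(i)}$ be the response paired with $t_{(i)}$. Define on $M^n$ $$\Phi_{\mathrm{disc}}(f_1,\dots,f_n)=\frac1n\sum_{i=1}^nd_M^2(Y_{(i)},f_i)+\lambda_n\sum_{i=1}^{n-1}\frac{d_M^2(f_i,f_{i+1})}{\Delta_i}.$$ Then: (a) For any $(f_1,\dots,f_n)\in M^n$, the infimum of $R_n(F)+\lambda_nJ_1(F)$ over all $F\in\mathcal H^1([0,1],M)$ with $F(t_{(i)})=f_i$ for all $i$ equals $\Phi_{\mathrm{disc}}(f_1,\dots,f_n)$, and is attained by any piecewise constant-speed minimizing-geodesic interpolant with $F'=0$ on the boundary intervals $[0,t_{(1)}]$ and $[t_{(n)},1]$. When $d_M(f_i,f_{i+1})<\mathrm{inj}(M)$ for all $i$, the interpolant is unique. (b) If $\hat F_n$ minimizes $R_n(F)+\lambda_nJ_1(F)$ over $\mathcal H^1([0,1],M)$, then $\hat F_n$ is a piecewise-geodesic interpolant and its nodal values $f_i^*=\hat F_n(t_{(i)})$ minimize $\Phi_{\mathrm{disc}}$ over $M^n$. (c) In particular, $\min_F\big(R_n(F)+\lambda_nJ_1(F)\big)=\min_{(f_i)\in M^n}\Phi_{\mathrm{disc}}(f_1,\dots,f_n)$.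
   Context: $(M,g)$ is a smooth compact connected Riemannian manifold without boundary, isometrically and smoothly embedded in $\mathbb R^D$, with geodesic distance $d_M$ and injectivity radius $\mathrm{inj}(M)$. $\mathcal H^1([0,1],M)=\{F\in H^1([0,1],\mathbb R^D):F(t)\in M\ \forall t\}$, $J_1(F)=\int_0^1|F'(t)|^2dt$. Observations are $(t_i,Y_i)_{i=1}^n$ with $t_i\in[0,1]$ distinct and $Y_i\in M$; $R_n(F)=n^{-1}\sum_{i=1}^nd_M^2(Y_i,F(t_i))$. *)

theory Defs
  imports "HOL-Analysis.Analysis" "HOL-Library.Extended_Real"
begin

section \<open>Smooth maps and embedded submanifolds of a Euclidean space\<close>

text \<open>\<open>Ck_on\<close> and \<open>smooth_on\<close> are meant for open \<open>U\<close>.\<close>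

primrec Ck_on :: "nat \<Rightarrow> 'a::euclidean_space set \<Rightarrow> ('a \<Rightarrow> 'b::euclidean_space) \<Rightarrow> bool" where
  "Ck_on 0 U f \<longleftrightarrow> continuous_on U f"
| "Ck_on (Suc k) U f \<longleftrightarrow>
     f differentiable_on U \<and> (\<forall>v. Ck_on k U (\<lambda>x. frechet_derivative f (at x) v))"

definition smooth_on :: "'a::euclidean_space set \<Rightarrow> ('a \<Rightarrow> 'b::euclidean_space) \<Rightarrow> bool" where
  "smooth_on U f \<longleftrightarrow> (\<forall>k. Ck_on k U f)"

text \<open>A map on an arbitrary subset \<open>A\<close> of a Euclidean space is smooth if it has local smooth
  extensions to open sets (Milnor, Guillemin--Pollack).  On a submanifold this is smoothness in
  charts; on a compact interval it is smoothness up to the end points.\<close>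

definition smooth_map_on :: "'a::euclidean_space set \<Rightarrow> ('a \<Rightarrow> 'b::euclidean_space) \<Rightarrow> bool" where
  "smooth_map_on A f \<longleftrightarrow>
     (\<forall>x\<in>A. \<exists>U g. open U \<and> x \<in> U \<and> smooth_on U g \<and> (\<forall>y\<in>A \<inter> U. g y = f y))"

definition diffeo_betw ::
  "'a::euclidean_space set \<Rightarrow> 'b::euclidean_space set \<Rightarrow> ('a \<Rightarrow> 'b) \<Rightarrow> bool" where
  "diffeo_betw A B f \<longleftrightarrow>
     bij_betw f A B \<and> smooth_map_on A f \<and> smooth_map_on B (the_inv_into A f)"

text \<open>An embedded \<open>m\<close>-dimensional submanifold without boundary: locally diffeomorphic to an open
  subset of an \<open>m\<close>-dimensional vector space, realised as a linear subspace \<open>S\<close> of the ambient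
  space.\<close>

definition smooth_submanifold :: "nat \<Rightarrow> 'a::euclidean_space set \<Rightarrow> bool" where
  "smooth_submanifold m M \<longleftrightarrow>
     (\<forall>p\<in>M. \<exists>W S B f. openin (top_of_set M) W \<and> p \<in> W \<and> subspace (S :: 'a set) \<and> dim S = m
        \<and> openin (top_of_set S) B \<and> diffeo_betw B W f)"

definition tangent_space :: "'a::euclidean_space set \<Rightarrow> 'a \<Rightarrow> 'a set" where
  "tangent_space M p =
     {v. \<exists>\<gamma> \<epsilon>. \<epsilon> > 0 \<and> smooth_on {-\<epsilon><..<\<epsilon>} \<gamma> \<and> \<gamma> ` {-\<epsilon><..<\<epsilon>} \<subseteq> M \<and> \<gamma> 0 = p
           \<and> (\<gamma> has_vector_derivative v) (at (0::real))}"


section \<open>The induced Riemannian structure\<close>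

text \<open>The metric of \<open>M\<close> is the restriction of the ambient inner product, so the Riemannian length
  of a curve in \<open>M\<close> is its Euclidean length.\<close>

definition curve_length :: "real \<Rightarrow> real \<Rightarrow> (real \<Rightarrow> 'a::euclidean_space) \<Rightarrow> real" where
  "curve_length a b \<gamma> = integral {a..b} (\<lambda>t. norm (vector_derivative \<gamma> (at t within {a..b})))"

text \<open>Piecewise smooth with each piece smooth up to its end points. The library's
  \<open>piecewise_C1_differentiable_on\<close> allows unbounded speed, hence infinite length, near a knot, for
  which the integral in \<open>curve_length\<close> would be meaningless.\<close>

definition piecewise_smooth_path :: "(real \<Rightarrow> 'a::euclidean_space) \<Rightarrow> bool" where
  "piecewise_smooth_path \<gamma> \<longleftrightarrow> path \<gamma> \<and>
     (\<exists>P. finite P \<and>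
        (\<forall>a b. 0 \<le> a \<and> a < b \<and> b \<le> 1 \<and> {a<..<b} \<inter> P = {} \<longrightarrow> smooth_map_on {a..b} \<gamma>))"

definition geodesic_dist :: "'a::euclidean_space set \<Rightarrow> 'a \<Rightarrow> 'a \<Rightarrow> real" where
  "geodesic_dist M p q =
     Inf {curve_length 0 1 \<gamma> |\<gamma>. piecewise_smooth_path \<gamma> \<and> path_image \<gamma> \<subseteq> M
            \<and> pathstart \<gamma> = p \<and> pathfinish \<gamma> = q}"

text \<open>Geodesics on \<open>[a, b]\<close> with \<open>a < b\<close>. The Levi-Civita connection of the induced metric is the
  tangential part of the ambient derivative, so the geodesic equation says that the acceleration is
  normal to \<open>M\<close>.  In particular, the speed is constant.\<close>

definition geodesic_on :: "'a::euclidean_space set \<Rightarrow> real \<Rightarrow> real \<Rightarrow> (real \<Rightarrow> 'a) \<Rightarrow> bool" where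
  "geodesic_on M a b \<gamma> \<longleftrightarrow> smooth_map_on {a..b} \<gamma> \<and> \<gamma> ` {a..b} \<subseteq> M \<and>
     (\<forall>t\<in>{a..b}. \<forall>w\<in>tangent_space M (\<gamma> t).
        vector_derivative (\<lambda>s. vector_derivative \<gamma> (at s within {a..b})) (at t within {a..b}) \<bullet> w
          = 0)"

definition minimizing_geodesic_on ::
  "'a::euclidean_space set \<Rightarrow> real \<Rightarrow> real \<Rightarrow> (real \<Rightarrow> 'a) \<Rightarrow> bool" where
  "minimizing_geodesic_on M a b \<gamma> \<longleftrightarrow>
     geodesic_on M a b \<gamma> \<and> curve_length a b \<gamma> = geodesic_dist M (\<gamma> a) (\<gamma> b)"

text \<open>On a compact manifold the geodesic with given initial data exists on all of \<open>[0, 1]\<close>, and it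
  is unique, so \<open>riem_exp M p\<close> is the exponential map on the whole tangent space at \<open>p\<close>.\<close>

definition riem_exp :: "'a::euclidean_space set \<Rightarrow> 'a \<Rightarrow> 'a \<Rightarrow> 'a" where
  "riem_exp M p v =
     (THE q. \<exists>\<gamma>. geodesic_on M 0 1 \<gamma> \<and> \<gamma> 0 = p
                \<and> (\<gamma> has_vector_derivative v) (at 0 within {0..1}) \<and> \<gamma> 1 = q)"

text \<open>Extended real valued: the injectivity radius of a one-point manifold is infinite.\<close>

definition inj_radius_at :: "'a::euclidean_space set \<Rightarrow> 'a \<Rightarrow> ereal" where
  "inj_radius_at M p =
     (SUP r\<in>{r::real. r > 0 \<and>
        (let B = ball 0 r \<inter> tangent_space M p; W = riem_exp M p ` B
         in openin (top_of_set M) W \<and> diffeo_betw B W (riem_exp M p))}. ereal r)"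

definition inj_radius :: "'a::euclidean_space set \<Rightarrow> ereal" where
  "inj_radius M = (INF p\<in>M. inj_radius_at M p)"


section \<open>The Sobolev space of first order on the unit interval\<close>

definition L2_unit :: "(real \<Rightarrow> 'a::euclidean_space) \<Rightarrow> bool" where
  "L2_unit F \<longleftrightarrow> F \<in> borel_measurable (lebesgue_on {0..1})
     \<and> integrable (lebesgue_on {0..1}) (\<lambda>t. (norm (F t))\<^sup>2)"

text \<open>Weak derivative on \<open>(0, 1)\<close>, with test functions of class \<open>C\<^sup>1\<close> with compact support in
  \<open>(0, 1)\<close>.\<close>

definition is_weak_deriv ::
  "(real \<Rightarrow> 'a::euclidean_space) \<Rightarrow> (real \<Rightarrow> 'a) \<Rightarrow> bool" where
  "is_weak_deriv F G \<longleftrightarrow>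
     (\<forall>\<phi> :: real \<Rightarrow> real. \<phi> C1_differentiable_on UNIV \<and>
        (\<exists>a b. 0 < a \<and> b < 1 \<and> (\<forall>t. t \<notin> {a..b} \<longrightarrow> \<phi> t = 0)) \<longrightarrow>
        (LINT t|lebesgue_on {0..1}. deriv \<phi> t *\<^sub>R F t)
          = - (LINT t|lebesgue_on {0..1}. \<phi> t *\<^sub>R G t))"

text \<open>An element of \<open>H\<^sup>1\<close> is taken as its continuous representative, so that point values make
  sense. Functions are total; only their values on \<open>[0, 1]\<close> matter.\<close>

definition H1_unit :: "(real \<Rightarrow> 'a::euclidean_space) set" where
  "H1_unit = {F. continuous_on {0..1} F \<and> L2_unit F \<and> (\<exists>G. L2_unit G \<and> is_weak_deriv F G)}"

definition H1_maps :: "'a::euclidean_space set \<Rightarrow> (real \<Rightarrow> 'a) set" where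
  "H1_maps M = {F \<in> H1_unit. \<forall>t\<in>{0..1}. F t \<in> M}"

definition weak_deriv :: "(real \<Rightarrow> 'a::euclidean_space) \<Rightarrow> real \<Rightarrow> 'a" where
  "weak_deriv F = (SOME G. L2_unit G \<and> is_weak_deriv F G)"

definition J1 :: "(real \<Rightarrow> 'a::euclidean_space) \<Rightarrow> real" where
  "J1 F = (LINT t|lebesgue_on {0..1}. (norm (weak_deriv F t))\<^sup>2)"


section \<open>Empirical risk, order statistics and the discrete functional\<close>

definition emp_risk ::
  "'a::euclidean_space set \<Rightarrow> nat \<Rightarrow> (nat \<Rightarrow> real) \<Rightarrow> (nat \<Rightarrow> 'a) \<Rightarrow> (real \<Rightarrow> 'a) \<Rightarrow> real" where
  "emp_risk M n t Y F = (\<Sum>i=1..n. (geodesic_dist M (Y i) (F (t i)))\<^sup>2) / real n"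

definition penalized_risk ::
  "'a::euclidean_space set \<Rightarrow> nat \<Rightarrow> (nat \<Rightarrow> real) \<Rightarrow> (nat \<Rightarrow> 'a) \<Rightarrow> real \<Rightarrow> (real \<Rightarrow> 'a) \<Rightarrow> real"
  where "penalized_risk M n t Y lam F = emp_risk M n t Y F + lam * J1 F"

text \<open>For \<open>1 \<le> i \<le> n\<close>, the \<open>i\<close>-th smallest of \<open>t 1, \<dots>, t n\<close>, and the response paired with it
  (for distinct design points).\<close>

definition ord_stat :: "nat \<Rightarrow> (nat \<Rightarrow> real) \<Rightarrow> nat \<Rightarrow> real" where
  "ord_stat n t i = sort (map t [1..<Suc n]) ! (i - 1)"

definition paired_response :: "nat \<Rightarrow> (nat \<Rightarrow> real) \<Rightarrow> (nat \<Rightarrow> 'a) \<Rightarrow> nat \<Rightarrow> 'a" where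
  "paired_response n t Y i = Y (the_inv_into {1..n} t (ord_stat n t i))"

definition phi_disc ::
  "'a::euclidean_space set \<Rightarrow> nat \<Rightarrow> (nat \<Rightarrow> real) \<Rightarrow> (nat \<Rightarrow> 'a) \<Rightarrow> real \<Rightarrow> (nat \<Rightarrow> 'a) \<Rightarrow> real"
  where "phi_disc M n t Y lam f =
     (\<Sum>i=1..n. (geodesic_dist M (paired_response n t Y i) (f i))\<^sup>2) / real n
     + lam * (\<Sum>i=1..<n. (geodesic_dist M (f i) (f (i + 1)))\<^sup>2
                         / (ord_stat n t (i + 1) - ord_stat n t i))"

text \<open>Piecewise minimizing-geodesic interpolants of the nodal values \<open>f 1, \<dots>, f n\<close>. Constancy of
  the speed of each piece is part of \<open>geodesic_on\<close>.\<close>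

definition geodesic_interpolant ::
  "'a::euclidean_space set \<Rightarrow> nat \<Rightarrow> (nat \<Rightarrow> real) \<Rightarrow> (nat \<Rightarrow> 'a) \<Rightarrow> (real \<Rightarrow> 'a) \<Rightarrow> bool" where
  "geodesic_interpolant M n t f F \<longleftrightarrow>
     (\<forall>i\<in>{1..n}. F (ord_stat n t i) = f i)
   \<and> (\<forall>i\<in>{1..<n}. minimizing_geodesic_on M (ord_stat n t i) (ord_stat n t (i + 1)) F)
   \<and> (\<forall>s\<in>{0..ord_stat n t 1}. (F has_vector_derivative 0) (at s within {0..ord_stat n t 1}))
   \<and> (\<forall>s\<in>{ord_stat n t n..1}. (F has_vector_derivative 0) (at s within {ord_stat n t n..1}))"

end

theory Submission
  imports Defs
begin

text \<open>
  The local smooth retraction \<open>r\<close> onto \<open>M\<close> gives \<open>\<bar>d(x, y)\<^sup>2 - |x - y|\<^sup>2\<bar> \<le> C |x - y|\<^sup>4\<close>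
  locally, so \<open>d\<close> induces the Euclidean topology; compactness yields midpoints and hence metric
  minimizing geodesics. Comparing second differences through the parallelogram law shows that these
  are of class \<open>C\<^sup>1\<close>. The first variation along retracted perturbations and the du Bois-Reymond lemma
  turn minimality into a second-order ODE with smooth right-hand side, which gives smoothness and,
  by uniqueness for ODEs together with injectivity of the exponential map, uniqueness of short
  minimizers.

  For the regression problem, each design interval of length \<open>\<Delta>\<close> satisfies
  \<open>\<integral> |F'|\<^sup>2 \<ge> 2c \<integral> |F'| - c\<^sup>2 \<Delta> \<ge> d\<^sup>2 / \<Delta>\<close> with \<open>c = d / \<Delta>\<close>, and equality forces
  \<open>|F'| = c\<close> almost everywhere with length \<open>d\<close>, that is, a constant-speed minimizing geodesic.
\<close>

section \<open>Calculus of Ck functions\<close>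

text \<open>\<open>geodesic_dist\<close> is an infimum over piecewise smooth curves, while the maps
  compared in the theorem are only H1 and the variations of a minimizer only C1. Bounding the
  distance by the integral of the speed is thus not a matter of definition; for these classes a
  curve is cut into short chords, each of intrinsic length at most 1 + \<epsilon> times the
  Euclidean one. The fourth power in the local comparison is what makes regularity possible: a
  metric geodesic loses only O(h^4) in the square of a chord over a parameter step 2h, so the second
  difference is O(h^2), the scale of a Lipschitz derivative. A retraction r also replaces charts and
  tangential fields: r (\<sigma> + \<tau> \<eta>) is an admissible variation for every ambient field
  \<eta>. Its derivative P is in general an oblique projection, so the weak equation controls only
  P^T v; recovering v from P^T v and solving for the acceleration both rest on the same invertible
  operator I - P + P^T.\<close>

lemma Ck_on_subset: "Ck_on k U f \<Longrightarrow> V \<subseteq> U \<Longrightarrow> Ck_on k V f"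
  by (induction k arbitrary: f) (auto intro: continuous_on_subset differentiable_on_subset)

lemma Ck_on_has_derivative:
  assumes "Ck_on (Suc k) U f" "open U" "x \<in> U"
  shows "(f has_derivative frechet_derivative f (at x)) (at x)"
  using assms by (auto simp: differentiable_on_def frechet_derivative_works at_within_open[of x U])

lemma Ck_on_cong:
  assumes "open U" "\<And>x. x \<in> U \<Longrightarrow> f x = g x" "Ck_on k U f"
  shows "Ck_on k U g"
  using assms
proof (induction k arbitrary: f g)
  case 0
  then show ?case using continuous_on_cong[of U U f g] by simp
next
  case (Suc k)
  have d: "f differentiable at x" if "x \<in> U" for x
    using Suc.prems that by (auto simp: differentiable_on_def at_within_open[of x U])
  have fe: "frechet_derivative f (at x) = frechet_derivative g (at x)" if "x \<in> U" for x
    by (rule frechet_derivative_transform_within_open[OF d[OF that] Suc.prems(1) that])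
       (use Suc.prems in auto)
  have "g differentiable_on U"
    unfolding differentiable_on_def
  proof
    fix x assume x: "x \<in> U"
    have "(g has_derivative frechet_derivative f (at x)) (at x)"
      by (rule has_derivative_transform_within_open[OF _ Suc.prems(1) x Suc.prems(2)])
         (use d[OF x] in \<open>simp add: frechet_derivative_works\<close>)
    then show "g differentiable at x within U"
      using differentiable_def has_derivative_at_withinI by blast
  qed
  moreover have "Ck_on k U (\<lambda>x. frechet_derivative g (at x) v)" for v
    by (rule Suc.IH[OF Suc.prems(1), of "\<lambda>x. frechet_derivative f (at x) v"])
       (use Suc.prems fe in auto)
  ultimately show ?case by simp
qed

text \<open>An explicit derivative \<open>f'\<close> stands in for
  \<open>frechet_derivative\<close>, with which it agrees at each point of the open set
  \<open>U\<close>. The inductions on the order below then need only the formula of the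
  derivative.\<close>

lemma Ck_on_SucI:
  assumes "open U" "\<And>x. x \<in> U \<Longrightarrow> (f has_derivative f' x) (at x)"
    "\<And>v. Ck_on k U (\<lambda>x. f' x v)"
  shows "Ck_on (Suc k) U f"
proof -
  have "f differentiable_on U"
    using assms(2) by (auto simp: differentiable_on_def differentiable_def intro: has_derivative_at_withinI)
  moreover have "Ck_on k U (\<lambda>x. frechet_derivative f (at x) v)" for v
    by (rule Ck_on_cong[OF assms(1) _ assms(3)[of v]]) (use frechet_derivative_at[OF assms(2)] in auto)
  ultimately show ?thesis by simp
qed

lemma Ck_on_pred: "Ck_on (Suc k) U f \<Longrightarrow> Ck_on k U f"
proof (induction k arbitrary: f)
  case 0
  then show ?case by (simp add: differentiable_imp_continuous_on)
next
  case (Suc k)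
  then show ?case by (auto simp del: Ck_on.simps(1))
qed

lemma Ck_on_imp_continuous_on: "Ck_on k U f \<Longrightarrow> continuous_on U f"
  by (cases k) (auto simp: differentiable_imp_continuous_on)

lemma Ck_on_const: "open U \<Longrightarrow> Ck_on k U (\<lambda>x. c)"
  by (induction k arbitrary: c) (auto simp: continuous_on_const)

lemma Ck_on_bounded_linear:
  assumes "bounded_linear h" "open U" "Ck_on k U f"
  shows "Ck_on k U (\<lambda>x. h (f x))"
  using assms(3)
proof (induction k arbitrary: f)
  case 0
  then show ?case using bounded_linear.continuous_on[OF assms(1)] by simp
next
  case (Suc k)
  show ?case
  proof (rule Ck_on_SucI[OF assms(2)])
    fix x assume "x \<in> U"
    show "((\<lambda>x. h (f x)) has_derivative (\<lambda>v. h (frechet_derivative f (at x) v))) (at x)"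
      by (rule bounded_linear.has_derivative[OF assms(1) Ck_on_has_derivative[OF Suc.prems assms(2) \<open>x \<in> U\<close>]])
  next
    fix v show "Ck_on k U (\<lambda>x. h (frechet_derivative f (at x) v))"
      using Suc by simp
  qed
qed

lemma Ck_on_id: "open U \<Longrightarrow> Ck_on k U (\<lambda>x. x)"
proof (cases k)
  case (Suc j)
  assume "open U"
  then show ?thesis unfolding Suc
    by (intro Ck_on_SucI[where f' = "\<lambda>x v. v"]) (auto intro: Ck_on_const)
qed (simp add: continuous_on_id)

lemma Ck_on_add:
  assumes "open U" "Ck_on k U f" "Ck_on k U g"
  shows "Ck_on k U (\<lambda>x. f x + g x)"
  using assms(2,3)
proof (induction k arbitrary: f g)
  case 0
  then show ?case by (simp add: continuous_on_add)
next
  case (Suc k)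
  show ?case
  proof (rule Ck_on_SucI[OF assms(1)])
    fix x assume "x \<in> U"
    show "((\<lambda>x. f x + g x) has_derivative
        (\<lambda>v. frechet_derivative f (at x) v + frechet_derivative g (at x) v)) (at x)"
      by (intro has_derivative_add Ck_on_has_derivative[OF Suc.prems(1) assms(1) \<open>x \<in> U\<close>]
          Ck_on_has_derivative[OF Suc.prems(2) assms(1) \<open>x \<in> U\<close>])
  next
    fix v show "Ck_on k U (\<lambda>x. frechet_derivative f (at x) v + frechet_derivative g (at x) v)"
      using Suc by simp
  qed
qed

lemma Ck_on_sum:
  assumes "open U" "finite I" "\<And>i. i \<in> I \<Longrightarrow> Ck_on k U (f i)"
  shows "Ck_on k U (\<lambda>x. \<Sum>i\<in>I. f i x)"
  using assms(2,3)
  by (induction I rule: finite_induct) (auto intro!: Ck_on_const Ck_on_add assms(1) simp del: Ck_on.simps)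

text \<open>The product rule keeps one factor undifferentiated; \<open>Ck_on_pred\<close> lowers it
  by one order so that the induction hypothesis applies to both terms.\<close>

lemma Ck_on_bilinear:
  assumes "bounded_bilinear pr" "open U" "Ck_on k U f" "Ck_on k U g"
  shows "Ck_on k U (\<lambda>x. pr (f x) (g x))"
  using assms(3,4)
proof (induction k arbitrary: f g)
  case 0
  then show ?case using bounded_bilinear.continuous_on[OF assms(1)] by simp
next
  case (Suc k)
  show ?case
  proof (rule Ck_on_SucI[OF assms(2)])
    fix x assume "x \<in> U"
    show "((\<lambda>x. pr (f x) (g x)) has_derivative
        (\<lambda>v. pr (f x) (frechet_derivative g (at x) v) + pr (frechet_derivative f (at x) v) (g x))) (at x)"
      by (intro bounded_bilinear.FDERIV[OF assms(1)] Ck_on_has_derivative[OF Suc.prems(1) assms(2) \<open>x \<in> U\<close>]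
          Ck_on_has_derivative[OF Suc.prems(2) assms(2) \<open>x \<in> U\<close>])
  next
    fix v show "Ck_on k U (\<lambda>x. pr (f x) (frechet_derivative g (at x) v) + pr (frechet_derivative f (at x) v) (g x))"
      using Suc.prems Ck_on_pred[OF Suc.prems(1)] Ck_on_pred[OF Suc.prems(2)]
      by (intro Ck_on_add assms(2) Suc.IH) (simp_all only: Ck_on.simps(2))
  qed
qed

lemmas Ck_on_scaleR = Ck_on_bilinear[OF bounded_bilinear_scaleR]
lemmas Ck_on_inner = Ck_on_bilinear[OF bounded_bilinear_inner]

lemma Ck_on_Pair:
  assumes "open U" "Ck_on k U f" "Ck_on k U g"
  shows "Ck_on k U (\<lambda>x. (f x, g x))"
proof -
  have "Ck_on k U (\<lambda>x. (\<lambda>y. (y, 0)) (f x) + (\<lambda>y. (0, y)) (g x))"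
    by (intro Ck_on_add Ck_on_bounded_linear[of "\<lambda>y. (y, 0)"] Ck_on_bounded_linear[of "\<lambda>y. (0, y)"]
        bounded_linear_Pair bounded_linear_ident bounded_linear_zero assms)
  then show ?thesis by simp
qed

lemma linear_eq_sum_Basis:
  fixes h :: "'a::euclidean_space \<Rightarrow> 'b::real_vector"
  assumes "linear h"
  shows "h v = (\<Sum>b\<in>Basis. (v \<bullet> b) *\<^sub>R h b)"
proof -
  have "h v = h (\<Sum>b\<in>Basis. (v \<bullet> b) *\<^sub>R b)" by (simp add: euclidean_representation)
  also have "\<dots> = (\<Sum>b\<in>Basis. (v \<bullet> b) *\<^sub>R h b)"
    using assms by (simp add: linear_sum linear_cmul o_def)
  finally show ?thesis .
qed

text \<open>The derivative of the outer map is expanded in the basis, which turns the chain rule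
  into a sum of scalars times partial derivatives of \<open>f\<close> composed with
  \<open>g\<close>. These have the form of the claim at a lower order, so \<open>f\<close> has to be
  generalised in the induction.\<close>

lemma Ck_on_compose:
  assumes "open U" "open V" "g ` U \<subseteq> V" "Ck_on k U g" "Ck_on k V f"
  shows "Ck_on k U (\<lambda>x. f (g x))"
  using assms(4,5)
proof (induction k arbitrary: f)
  case 0
  then show ?case using continuous_on_compose2[of V f U g] assms(3) by simp
next
  case (Suc k)
  have gk: "Ck_on k U g" using Ck_on_pred Suc.prems by blast
  show ?case
  proof (rule Ck_on_SucI[OF assms(1)])
    fix x assume "x \<in> U"
    then have gx: "g x \<in> V" using assms(3) by auto
    have Df: "(f has_derivative frechet_derivative f (at (g x))) (at (g x))"
      by (rule Ck_on_has_derivative[OF Suc.prems(2) assms(2) gx])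
    have lin: "linear (frechet_derivative f (at (g x)))"
      using Df has_derivative_linear by blast
    have "((\<lambda>x. f (g x)) has_derivative
        (\<lambda>v. frechet_derivative f (at (g x)) (frechet_derivative g (at x) v))) (at x)"
      by (rule has_derivative_compose[OF Ck_on_has_derivative[OF Suc.prems(1) assms(1) \<open>x \<in> U\<close>] Df])
    then show "((\<lambda>x. f (g x)) has_derivative
        (\<lambda>v. \<Sum>b\<in>Basis. (frechet_derivative g (at x) v \<bullet> b) *\<^sub>R frechet_derivative f (at (g x)) b)) (at x)"
      by (subst (asm) linear_eq_sum_Basis[OF lin])
  next
    fix v
    show "Ck_on k U (\<lambda>x. \<Sum>b\<in>Basis. (frechet_derivative g (at x) v \<bullet> b) *\<^sub>R frechet_derivative f (at (g x)) b)"
    proof (intro Ck_on_sum Ck_on_scaleR Ck_on_inner Ck_on_const assms(1) finite_Basis)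
      fix b :: 'b
      show "Ck_on k U (\<lambda>x. frechet_derivative g (at x) v)" using Suc.prems(1) by simp
      have "Ck_on k V (\<lambda>y. frechet_derivative f (at y) b)" using Suc.prems(2) by simp
      then show "Ck_on k U (\<lambda>x. frechet_derivative f (at (g x)) b)" by (rule Suc.IH[OF gk])
    qed
  qed
qed

section \<open>Smooth maps on open sets\<close>

lemma smooth_on_Suc:
  assumes "smooth_on U f" shows "smooth_on U (\<lambda>x. frechet_derivative f (at x) v)"
  using assms unfolding smooth_on_def by (metis Ck_on.simps(2))

lemma smooth_on_subset: "smooth_on U f \<Longrightarrow> V \<subseteq> U \<Longrightarrow> smooth_on V f"
  unfolding smooth_on_def using Ck_on_subset by blast

lemma smooth_on_has_derivative:
  "smooth_on U f \<Longrightarrow> open U \<Longrightarrow> x \<in> U \<Longrightarrow> (f has_derivative frechet_derivative f (at x)) (at x)"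
  unfolding smooth_on_def using Ck_on_has_derivative by blast

lemma smooth_on_continuous_on: "smooth_on U f \<Longrightarrow> continuous_on U f"
  unfolding smooth_on_def using Ck_on_imp_continuous_on by blast

lemma smooth_on_linear: "smooth_on U f \<Longrightarrow> open U \<Longrightarrow> x \<in> U \<Longrightarrow> linear (frechet_derivative f (at x))"
  using smooth_on_has_derivative has_derivative_linear by blast

lemma smooth_on_cong:
  "open U \<Longrightarrow> (\<And>x. x \<in> U \<Longrightarrow> f x = g x) \<Longrightarrow> smooth_on U f \<Longrightarrow> smooth_on U g"
  unfolding smooth_on_def using Ck_on_cong by blast

lemma smooth_on_const: "open U \<Longrightarrow> smooth_on U (\<lambda>x. c)"
  by (simp only: smooth_on_def Ck_on_const simp_thms)

lemma smooth_on_id: "open U \<Longrightarrow> smooth_on U (\<lambda>x. x)"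
  by (simp only: smooth_on_def Ck_on_id simp_thms)

lemma smooth_on_add: "open U \<Longrightarrow> smooth_on U f \<Longrightarrow> smooth_on U g \<Longrightarrow> smooth_on U (\<lambda>x. f x + g x)"
  by (simp only: smooth_on_def Ck_on_add simp_thms)

lemma smooth_on_bilinear:
  "bounded_bilinear pr \<Longrightarrow> open U \<Longrightarrow> smooth_on U f \<Longrightarrow> smooth_on U g \<Longrightarrow> smooth_on U (\<lambda>x. pr (f x) (g x))"
  by (simp only: smooth_on_def Ck_on_bilinear simp_thms)

lemmas smooth_on_scaleR = smooth_on_bilinear[OF bounded_bilinear_scaleR]
lemmas smooth_on_inner = smooth_on_bilinear[OF bounded_bilinear_inner]

lemma smooth_on_sum:
  "open U \<Longrightarrow> finite I \<Longrightarrow> (\<And>i. i \<in> I \<Longrightarrow> smooth_on U (F i)) \<Longrightarrow> smooth_on U (\<lambda>x. \<Sum>i\<in>I. F i x)"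
  unfolding smooth_on_def by (intro allI Ck_on_sum) simp_all

lemma smooth_on_Pair:
  "open U \<Longrightarrow> smooth_on U f \<Longrightarrow> smooth_on U g \<Longrightarrow> smooth_on U (\<lambda>x. (f x, g x))"
  by (simp only: smooth_on_def Ck_on_Pair simp_thms)

lemma smooth_on_compose:
  "open U \<Longrightarrow> open V \<Longrightarrow> g ` U \<subseteq> V \<Longrightarrow> smooth_on U g \<Longrightarrow> smooth_on V f \<Longrightarrow> smooth_on U (\<lambda>x. f (g x))"
  unfolding smooth_on_def using Ck_on_compose[of U V g _ f] by blast

lemma smooth_on_bounded_linear:
  "bounded_linear h \<Longrightarrow> open U \<Longrightarrow> smooth_on U f \<Longrightarrow> smooth_on U (\<lambda>x. h (f x))"
  by (simp only: smooth_on_def Ck_on_bounded_linear simp_thms)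

text \<open>Linearity in the direction reduces joint smoothness to that of the finitely many partial
  derivatives. It makes the differential a smooth map on phase space, where the geodesic equation
  lives.\<close>

lemma smooth_on_derivative_eval:
  assumes "open V" "smooth_on V r"
  shows "smooth_on (V \<times> UNIV) (\<lambda>(x, v). frechet_derivative r (at x) v)"
proof -
  have op: "open (V \<times> (UNIV :: 'a set))" using assms by (simp add: open_Times)
  have "smooth_on (V \<times> UNIV) (\<lambda>z. \<Sum>b\<in>Basis. (snd z \<bullet> b) *\<^sub>R frechet_derivative r (at (fst z)) b)"
  proof (intro smooth_on_sum smooth_on_scaleR op finite_Basis)
    fix b :: 'a
    have "bounded_linear (\<lambda>z :: 'a \<times> 'a. snd z \<bullet> b)"
      using bounded_linear_compose[OF bounded_linear_inner_left bounded_linear_snd] .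
    from smooth_on_bounded_linear[OF this op smooth_on_id[OF op]]
    show "smooth_on (V \<times> UNIV) (\<lambda>z :: 'a \<times> 'a. snd z \<bullet> b)" .
    show "smooth_on (V \<times> UNIV) (\<lambda>z :: 'a \<times> 'a. frechet_derivative r (at (fst z)) b)"
      by (rule smooth_on_compose[OF op assms(1) _ smooth_on_bounded_linear[OF bounded_linear_fst op smooth_on_id[OF op]]
          smooth_on_Suc[OF assms(2)]]) auto
  qed
  then show ?thesis
  proof (rule smooth_on_cong[OF op, rotated])
    fix z assume "z \<in> V \<times> (UNIV :: 'a set)"
    then have "linear (frechet_derivative r (at (fst z)))"
      by (intro smooth_on_linear[OF assms(2,1)]) auto
    from linear_eq_sum_Basis[OF this, of "snd z"]
    show "(\<Sum>b\<in>Basis. (snd z \<bullet> b) *\<^sub>R frechet_derivative r (at (fst z)) b)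
      = (case z of (x, v) \<Rightarrow> frechet_derivative r (at x) v)"
      by (simp add: case_prod_beta)
  qed
qed

text \<open>Partial derivatives are bounded on the compact ball, and convexity of the ball gives the
  mean value inequality. This supplies the Lipschitz constants for the ODE arguments and for the
  comparison of chords with curves in a submanifold.\<close>

lemma smooth_on_lipschitz_cball:
  assumes "open V" "smooth_on V f" "cball p \<rho> \<subseteq> V"
  obtains L where "L \<ge> 0" "\<And>x y. x \<in> cball p \<rho> \<Longrightarrow> y \<in> cball p \<rho> \<Longrightarrow> norm (f x - f y) \<le> L * norm (x - y)"
proof -
  have "\<exists>B. \<forall>x\<in>cball p \<rho>. norm (frechet_derivative f (at x) b) \<le> B" for b
  proof -
    have "continuous_on (cball p \<rho>) (\<lambda>x. frechet_derivative f (at x) b)"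
      using smooth_on_continuous_on[OF smooth_on_Suc[OF assms(2)]] assms(3) continuous_on_subset by blast
    then have "bounded ((\<lambda>x. frechet_derivative f (at x) b) ` cball p \<rho>)"
      by (intro compact_imp_bounded compact_continuous_image compact_cball)
    then show ?thesis unfolding bounded_iff by auto
  qed
  then obtain B where B: "\<And>b x. x \<in> cball p \<rho> \<Longrightarrow> norm (frechet_derivative f (at x) b) \<le> B b" by metis
  define L where "L = (\<Sum>b\<in>Basis. \<bar>B b\<bar>)"
  have on: "onorm (frechet_derivative f (at x)) \<le> L" if x: "x \<in> cball p \<rho>" for x
  proof (rule onorm_le)
    fix v
    have lin: "linear (frechet_derivative f (at x))"
      using smooth_on_linear[OF assms(2,1)] x assms(3) by auto
    have "norm (frechet_derivative f (at x) v) \<le> (\<Sum>b\<in>Basis. norm ((v \<bullet> b) *\<^sub>R frechet_derivative f (at x) b))"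
      by (subst linear_eq_sum_Basis[OF lin]) (rule norm_sum)
    also have "\<dots> \<le> (\<Sum>b\<in>Basis. norm v * \<bar>B b\<bar>)"
    proof (rule sum_mono)
      fix b :: 'a assume "b \<in> Basis"
      have "norm (frechet_derivative f (at x) b) \<le> \<bar>B b\<bar>" using B[OF x, of b] by simp
      then show "norm ((v \<bullet> b) *\<^sub>R frechet_derivative f (at x) b) \<le> norm v * \<bar>B b\<bar>"
        using Basis_le_norm[OF \<open>b \<in> Basis\<close>, of v] by (simp add: mult_mono)
    qed
    finally show "norm (frechet_derivative f (at x) v) \<le> L * norm v"
      by (simp add: L_def sum_distrib_left mult.commute)
  qed
  have der: "(f has_derivative frechet_derivative f (at x)) (at x within cball p \<rho>)" if "x \<in> cball p \<rho>" for x
    by (rule has_derivative_at_withinI, rule smooth_on_has_derivative[OF assms(2,1) subsetD[OF assms(3) that]])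
  have "norm (f x - f y) \<le> L * norm (x - y)" if "x \<in> cball p \<rho>" "y \<in> cball p \<rho>" for x y
    by (rule differentiable_bound[OF convex_cball der on that])
  moreover have "L \<ge> 0" by (simp add: L_def sum_nonneg)
  ultimately show ?thesis using that by blast
qed

section \<open>Smooth dependence of an inverse linear map on its parameter\<close>

locale smooth_expanding_family =
  fixes V :: "'a::euclidean_space set" and Op :: "'a \<Rightarrow> 'b::euclidean_space \<Rightarrow> 'b"
  assumes openV: "open V"
    and smooth_Op: "\<And>v. smooth_on V (\<lambda>x. Op x v)"
    and linear_Op: "\<And>x. x \<in> V \<Longrightarrow> linear (Op x)"
    and expand_Op: "\<And>x v. x \<in> V \<Longrightarrow> norm v \<le> norm (Op x v)"
begin

definition Op_inv :: "'a \<Rightarrow> 'b \<Rightarrow> 'b" where "Op_inv x = inv (Op x)"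

text \<open>The expansion bound yields injectivity, hence bijectivity because domain and codomain
  have the same finite dimension; it also bounds the inverse by one uniformly in \<open>x\<close>,
  which drives the limits below.\<close>

lemma inj_Op: "x \<in> V \<Longrightarrow> inj (Op x)"
  by (subst linear_injective_0[OF linear_Op]) (use expand_Op[of x] in \<open>metis norm_le_zero_iff norm_zero\<close>)+

lemma bij_Op: "x \<in> V \<Longrightarrow> bij (Op x)"
  using inj_Op linear_injective_imp_surjective[OF linear_Op] by (auto simp: bij_def)

lemma Op_Op_inv: "x \<in> V \<Longrightarrow> Op x (Op_inv x w) = w"
  unfolding Op_inv_def using bij_Op by (simp add: bij_is_surj surj_f_inv_f)

lemma Op_inv_Op: "x \<in> V \<Longrightarrow> Op_inv x (Op x w) = w"
  unfolding Op_inv_def by (simp add: inj_Op)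

lemma norm_Op_inv: "x \<in> V \<Longrightarrow> norm (Op_inv x w) \<le> norm w"
  using expand_Op[of x "Op_inv x w"] by (simp add: Op_Op_inv)

lemma linear_Op_inv: "x \<in> V \<Longrightarrow> linear (Op_inv x)"
proof (rule linearI)
  assume x: "x \<in> V"
  fix c v w
  have "Op x (Op_inv x v + Op_inv x w) = v + w"
    by (simp add: linear_add[OF linear_Op[OF x]] Op_Op_inv[OF x])
  then show "Op_inv x (v + w) = Op_inv x v + Op_inv x w" using Op_inv_Op[OF x] by metis
  have "Op x (c *\<^sub>R Op_inv x v) = c *\<^sub>R v"
    by (simp add: linear_cmul[OF linear_Op[OF x]] Op_Op_inv[OF x])
  then show "Op_inv x (c *\<^sub>R v) = c *\<^sub>R Op_inv x v" using Op_inv_Op[OF x] by metis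
qed

lemma Op_inv_diff: "x \<in> V \<Longrightarrow> Op_inv x (v - w) = Op_inv x v - Op_inv x w"
  using linear_Op_inv linear_diff by blast

lemma continuous_on_Op_inv: "continuous_on V (\<lambda>x. Op_inv x w)"
proof (rule continuous_at_imp_continuous_on, rule ballI)
  fix x assume x: "x \<in> V"
  let ?u = "Op_inv x w"
  have c: "((\<lambda>y. Op y ?u) \<longlongrightarrow> Op x ?u) (at x)"
    using smooth_on_continuous_on[OF smooth_Op[of ?u]] x openV by (simp add: continuous_on_eq_continuous_at isCont_def)
  have "((\<lambda>y. norm (Op y ?u - w)) \<longlongrightarrow> 0) (at x)"
    using tendsto_norm_zero[OF LIM_zero[OF c]] by (simp add: Op_Op_inv x)
  moreover have "\<forall>\<^sub>F y in at x. norm (Op_inv y w - ?u) \<le> norm (Op y ?u - w)"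
    using eventually_at_in_open'[OF openV x]
  proof eventually_elim
    case (elim y)
    \<comment> \<open>The difference of inverses is written as one inverse applied to a residual of
      \<open>Op\<close>, so that the uniform bound on \<open>Op_inv y\<close> is enough.\<close>
    have "Op_inv y w - ?u = Op_inv y (w - Op y ?u)"
      using elim by (simp add: Op_inv_diff Op_inv_Op)
    then show ?case using norm_Op_inv[OF elim] by (metis norm_minus_commute)
  qed
  ultimately have "((\<lambda>y. Op_inv y w - ?u) \<longlongrightarrow> 0) (at x)"
    by (rule Lim_null_comparison[rotated])
  then show "isCont (\<lambda>y. Op_inv y w) x" by (simp add: isCont_def LIM_zero_iff)
qed

lemma has_derivative_Op_inv:
  assumes x: "x \<in> V"
  shows "((\<lambda>y. Op_inv y w) has_derivative
    (\<lambda>h. - Op_inv x (frechet_derivative (\<lambda>y. Op y (Op_inv x w)) (at x) h))) (at x)"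
proof -
  let ?u = "Op_inv x w"
  define D where "D = frechet_derivative (\<lambda>y. Op y ?u) (at x)"
  have D: "((\<lambda>y. Op y ?u) has_derivative D) (at x)"
    unfolding D_def by (rule smooth_on_has_derivative[OF smooth_Op openV x])
  have linD: "linear D" using D has_derivative_linear by blast
  have lin: "bounded_linear (\<lambda>h. - Op_inv x (D h))"
    using linear_compose[OF linD linear_Op_inv[OF x]]
    by (intro bounded_linear_minus) (simp add: linear_conv_bounded_linear o_def)
  define e where "e y = norm (Op y ?u - Op x ?u - D (y - x)) / norm (y - x)
      + (\<Sum>b\<in>Basis. norm (Op_inv y (D b) - Op_inv x (D b)))" for y
  have "((\<lambda>y. norm (Op y ?u - Op x ?u - D (y - x)) / norm (y - x)) \<longlongrightarrow> 0) (at x)"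
    using D by (simp add: has_derivative_iff_norm)
  moreover have "((\<lambda>y. \<Sum>b\<in>Basis. norm (Op_inv y (D b) - Op_inv x (D b))) \<longlongrightarrow> 0) (at x)"
  proof (rule tendsto_null_sum)
    fix b
    have "isCont (\<lambda>y. Op_inv y (D b)) x"
      using continuous_on_Op_inv x openV by (simp add: continuous_on_eq_continuous_at)
    then show "((\<lambda>y. norm (Op_inv y (D b) - Op_inv x (D b))) \<longlongrightarrow> 0) (at x)"
      unfolding isCont_def by (intro tendsto_norm_zero LIM_zero)
  qed
  ultimately have e0: "(e \<longlongrightarrow> 0) (at x)"
    unfolding e_def using tendsto_add_zero by blast
  have "\<forall>\<^sub>F y in at x. norm (norm (Op_inv y w - ?u - - Op_inv x (D (y - x))) / norm (y - x)) \<le> e y"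
    using eventually_at_in_open'[OF openV x] eventually_neq_at_within[of x x UNIV]
  proof eventually_elim
    case (elim y)
    let ?d = "y - x"
    have "Op_inv y w - ?u - - Op_inv x (D ?d)
        = - Op_inv y (Op y ?u - Op x ?u - D ?d) - (Op_inv y (D ?d) - Op_inv x (D ?d))"
      using elim(1) x by (simp add: Op_inv_diff Op_inv_Op Op_Op_inv)
    also have "norm \<dots> \<le> norm (Op y ?u - Op x ?u - D ?d) + norm (Op_inv y (D ?d) - Op_inv x (D ?d))"
      by (rule order_trans[OF norm_triangle_ineq4]) (simp add: norm_Op_inv elim)
    also have "Op_inv y (D ?d) - Op_inv x (D ?d) = (\<Sum>b\<in>Basis. (?d \<bullet> b) *\<^sub>R (Op_inv y (D b) - Op_inv x (D b)))"
      using linear_eq_sum_Basis[OF linear_compose_sub[OF linear_compose[OF linD linear_Op_inv[OF elim(1)]]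
            linear_compose[OF linD linear_Op_inv[OF x]]], of ?d]
      by simp
    also have "norm \<dots> \<le> (\<Sum>b\<in>Basis. norm ?d * norm (Op_inv y (D b) - Op_inv x (D b)))"
      by (intro sum_norm_le) (auto intro!: mult_right_mono Basis_le_norm)
    finally have "norm (Op_inv y w - ?u - - Op_inv x (D ?d)) / norm ?d \<le>
      (norm (Op y ?u - Op x ?u - D ?d) + (\<Sum>b\<in>Basis. norm ?d * norm (Op_inv y (D b) - Op_inv x (D b)))) / norm ?d"
      by (intro divide_right_mono) auto
    also have "\<dots> = e y"
      using elim(2) by (simp add: e_def add_divide_distrib flip: sum_distrib_left)
    finally show ?case by simp
  qed
  then have "((\<lambda>y. norm (Op_inv y w - ?u - - Op_inv x (D (y - x))) / norm (y - x)) \<longlongrightarrow> 0) (at x)"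
    by (rule Lim_null_comparison) (rule e0)
  then show ?thesis unfolding D_def[symmetric] using lin by (simp add: has_derivative_iff_norm)
qed

text \<open>A bootstrap: the derivative of the inverse is a polynomial in coordinates of the inverse
  and in derivatives of \<open>Op\<close>, so order k for all \<open>w\<close> gives order k + 1.
  The double basis expansion is made because both the locale assumption and the induction hypothesis
  speak of fixed vectors.\<close>

lemma smooth_on_Op_inv: "smooth_on V (\<lambda>x. Op_inv x w)"
proof -
  have "Ck_on k V (\<lambda>x. Op_inv x w)" for k
  proof (induction k arbitrary: w)
    case 0
    then show ?case by (simp add: continuous_on_Op_inv)
  next
    case (Suc k)
    have ex: "- Op_inv x (frechet_derivative (\<lambda>y. Op y (Op_inv x w)) (at x) h) =
      (\<Sum>c\<in>Basis. \<Sum>b\<in>Basis. - ((Op_inv x w \<bullet> c) * (frechet_derivative (\<lambda>y. Op y c) (at x) h \<bullet> b)) *\<^sub>R Op_inv x b)"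
      if x: "x \<in> V" for x h
    proof -
      let ?D = "\<lambda>c. frechet_derivative (\<lambda>y. Op y c) (at x)"
      let ?u = "Op_inv x w"
      have "((\<lambda>y. \<Sum>c\<in>Basis. (?u \<bullet> c) *\<^sub>R Op y c) has_derivative (\<lambda>h. \<Sum>c\<in>Basis. (?u \<bullet> c) *\<^sub>R ?D c h)) (at x)"
        by (intro has_derivative_sum has_derivative_scaleR_right smooth_on_has_derivative[OF smooth_Op openV x])
      then have "((\<lambda>y. Op y ?u) has_derivative (\<lambda>h. \<Sum>c\<in>Basis. (?u \<bullet> c) *\<^sub>R ?D c h)) (at x)"
        by (rule has_derivative_transform_within_open[OF _ openV x])
           (rule linear_eq_sum_Basis[OF linear_Op, symmetric])
      then have "?D ?u h = (\<Sum>c\<in>Basis. (?u \<bullet> c) *\<^sub>R ?D c h)"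
        by (simp add: frechet_derivative_at[symmetric])
      then have "Op_inv x (?D ?u h) = (\<Sum>c\<in>Basis. (?u \<bullet> c) *\<^sub>R Op_inv x (?D c h))"
        by (simp add: linear_sum[OF linear_Op_inv[OF x]] linear_cmul[OF linear_Op_inv[OF x]])
      also have "\<dots> = (\<Sum>c\<in>Basis. \<Sum>b\<in>Basis. ((?u \<bullet> c) * (?D c h \<bullet> b)) *\<^sub>R Op_inv x b)"
        by (subst linear_eq_sum_Basis[OF linear_Op_inv[OF x]]) (simp add: scaleR_sum_right)
      finally show ?thesis by (simp add: sum_negf)
    qed
    have op: "Ck_on k V (\<lambda>x. frechet_derivative (\<lambda>y. Op y c) (at x) h)" for c h
      using smooth_on_Suc[OF smooth_Op] unfolding smooth_on_def by blast
    show ?case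
    proof (rule Ck_on_SucI[OF openV has_derivative_Op_inv])
      fix h
      have "Ck_on k V (\<lambda>x. \<Sum>c\<in>Basis. \<Sum>b\<in>Basis. (- 1) *\<^sub>R (((Op_inv x w \<bullet> c) *\<^sub>R (frechet_derivative (\<lambda>y. Op y c) (at x) h \<bullet> b)) *\<^sub>R Op_inv x b))"
        by (intro Ck_on_sum[OF openV finite_Basis] Ck_on_scaleR[OF openV Ck_on_const[OF openV]]
            Ck_on_scaleR[OF openV Ck_on_scaleR[OF openV Ck_on_inner[OF openV Suc Ck_on_const[OF openV]]
              Ck_on_inner[OF openV op Ck_on_const[OF openV]]] Suc])
      then show "Ck_on k V (\<lambda>x. - Op_inv x (frechet_derivative (\<lambda>y. Op y (Op_inv x w)) (at x) h))"
        by (rule Ck_on_cong[OF openV, rotated]) (simp add: ex)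
    qed
  qed
  then show ?thesis by (simp add: smooth_on_def)
qed

end

text \<open>The increment r (x + s b + t c) - r (x + t c) is an integral over [0, s] of the
  derivative along b. Differentiating it in t under the integral sign, and then in s at 0, gives one
  mixed derivative; differentiating the increment directly gives the other.\<close>

lemma second_derivative_symmetric:
  assumes V: "open V" and r: "smooth_on V r" and x: "x \<in> V"
  shows "frechet_derivative (\<lambda>y. frechet_derivative r (at y) b) (at x) c
       = frechet_derivative (\<lambda>y. frechet_derivative r (at y) c) (at x) b"
proof -
  define D where "D f w y = frechet_derivative f (at y) w" for f :: "'a \<Rightarrow> 'b" and w y
  have sD: "smooth_on V (D f w)" if "smooth_on V f" for f w
    using smooth_on_Suc[OF that] by (simp add: D_def[abs_def])
  have line: "((\<lambda>t. f (p + t *\<^sub>R w)) has_vector_derivative D f w (p + s *\<^sub>R w)) (at s within T)"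
    if "smooth_on V f" "p + s *\<^sub>R w \<in> V" for f p w s T
  proof -
    have "((\<lambda>t. p + t *\<^sub>R w) has_derivative (\<lambda>h. h *\<^sub>R w)) (at s within T)"
      by (auto intro!: derivative_eq_intros)
    from has_derivative_compose[OF this smooth_on_has_derivative[OF that(1) V that(2)]]
    show ?thesis
      using linear_cmul[OF smooth_on_linear[OF that(1) V that(2)]]
      by (simp add: has_vector_derivative_def D_def)
  qed
  obtain \<epsilon> where e: "\<epsilon> > 0" "ball x \<epsilon> \<subseteq> V" using V x open_contains_ball by blast
  define N where "N = norm b + norm c + 1"
  \<comment> \<open>Parameters up to \<delta> keep the parallelogram spanned by b and c inside the
    ball; the 1 in \<open>N\<close> covers b = c = 0.\<close>
  define \<delta> where "\<delta> = \<epsilon> / (2 * N)"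
  have den: "N > 0" by (simp add: N_def add_nonneg_pos)
  have d0: "\<delta> > 0" using e den by (simp add: \<delta>_def)
  have inV: "x + s *\<^sub>R b + t *\<^sub>R c \<in> V" if "\<bar>s\<bar> \<le> \<delta>" "\<bar>t\<bar> \<le> \<delta>" for s t
  proof -
    have "norm (s *\<^sub>R b + t *\<^sub>R c) \<le> \<bar>s\<bar> * norm b + \<bar>t\<bar> * norm c"
      by (rule order_trans[OF norm_triangle_ineq]) simp
    also have "\<dots> \<le> \<delta> * norm b + \<delta> * norm c" by (intro add_mono mult_right_mono that) auto
    also have "\<dots> \<le> \<delta> * N" using d0 by (simp add: N_def algebra_simps)
    also have "\<dots> = \<epsilon> / 2" using den by (simp add: \<delta>_def)
    also have "\<dots> < \<epsilon>" using e by simp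
    finally have "x + (s *\<^sub>R b + t *\<^sub>R c) \<in> ball x \<epsilon>" by (simp only: mem_ball dist_commute[of x]) (simp add: dist_norm)
    then show ?thesis using e(2) by (metis add.assoc subsetD)
  qed
  have xs: "x + s *\<^sub>R b \<in> V" if "\<bar>s\<bar> \<le> \<delta>" for s using inV[of s 0] that d0 by simp
  let ?I = "{-\<delta><..<\<delta>}"
  have key: "D r c (x + s *\<^sub>R b) - D r c x = integral {0..s} (\<lambda>s'. D (D r b) c (x + s' *\<^sub>R b))"
    if s: "0 \<le> s" "s \<le> \<delta>" for s
  proof -
    have D1: "((\<lambda>t. integral (cbox 0 s) (\<lambda>s'. D r b (x + s' *\<^sub>R b + t *\<^sub>R c))) has_vector_derivative
        integral (cbox 0 s) (\<lambda>s'. D (D r b) c (x + s' *\<^sub>R b + 0 *\<^sub>R c))) (at 0 within ?I)"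
    proof (rule leibniz_rule_vector_derivative)
      fix t s' assume "t \<in> ?I" "s' \<in> cbox 0 s"
      then show "((\<lambda>t. D r b (x + s' *\<^sub>R b + t *\<^sub>R c)) has_vector_derivative
          D (D r b) c (x + s' *\<^sub>R b + t *\<^sub>R c)) (at t within ?I)"
        using s by (intro line sD r inV) auto
    next
      fix t assume "t \<in> ?I"
      then show "(\<lambda>s'. D r b (x + s' *\<^sub>R b + t *\<^sub>R c)) integrable_on cbox 0 s"
        using s by (intro integrable_continuous continuous_on_compose2[OF smooth_on_continuous_on[OF sD[OF r]]]
            continuous_intros) (auto intro!: inV)
    next
      show "continuous_on (?I \<times> cbox 0 s) (\<lambda>(t, s'). D (D r b) c (x + s' *\<^sub>R b + t *\<^sub>R c))"
        using s unfolding case_prod_beta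
        by (intro continuous_on_compose2[OF smooth_on_continuous_on[OF sD[OF sD[OF r]]]]
            continuous_intros) (auto intro!: inV)
    qed (use d0 in auto)
    have D2: "((\<lambda>t. r (x + s *\<^sub>R b + t *\<^sub>R c) - r (x + t *\<^sub>R c)) has_vector_derivative
        D r c (x + s *\<^sub>R b + 0 *\<^sub>R c) - D r c (x + 0 *\<^sub>R c)) (at 0 within ?I)"
      using s d0 x by (intro has_vector_derivative_diff line r) (auto intro!: xs)
    have eq: "r (x + s *\<^sub>R b + t *\<^sub>R c) - r (x + t *\<^sub>R c)
        = integral (cbox 0 s) (\<lambda>s'. D r b (x + s' *\<^sub>R b + t *\<^sub>R c))" if "t \<in> ?I" for t
    proof -
      have "((\<lambda>s'. D r b ((x + t *\<^sub>R c) + s' *\<^sub>R b)) has_integral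
          (r ((x + t *\<^sub>R c) + s *\<^sub>R b) - r ((x + t *\<^sub>R c) + 0 *\<^sub>R b))) {0..s}"
        using s that inV
        by (intro fundamental_theorem_of_calculus line r) (auto simp: algebra_simps)
      from integral_unique[OF this] show ?thesis by (simp add: add.assoc add.commute add.left_commute)
    qed
    have D3: "((\<lambda>t. r (x + s *\<^sub>R b + t *\<^sub>R c) - r (x + t *\<^sub>R c)) has_vector_derivative
        integral (cbox 0 s) (\<lambda>s'. D (D r b) c (x + s' *\<^sub>R b + 0 *\<^sub>R c))) (at 0 within ?I)"
      by (rule has_vector_derivative_transform[OF _ eq D1]) (use d0 in auto)
    have "at (0::real) within ?I = at 0" using d0 by (intro at_within_open) auto
    from vector_derivative_unique_at[OF D2[unfolded this] D3[unfolded this]]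
    show ?thesis by simp
  qed
  \<comment> \<open>The identity \<open>key\<close> is available for s \<ge> 0, so the two mixed
    derivatives are compared as one-sided derivatives on [0, \<delta>].\<close>
  have "((\<lambda>s. integral {0..s} (\<lambda>s'. D (D r b) c (x + s' *\<^sub>R b))) has_vector_derivative
      D (D r b) c (x + 0 *\<^sub>R b)) (at 0 within {0..\<delta>})"
    using d0 by (intro integral_has_vector_derivative continuous_on_compose2[OF smooth_on_continuous_on[OF sD[OF sD[OF r]]]]
            continuous_intros) (auto intro!: xs)
  then have "((\<lambda>s. D r c (x + s *\<^sub>R b) - D r c x) has_vector_derivative
      D (D r b) c (x + 0 *\<^sub>R b)) (at 0 within {0..\<delta>})"
    by (rule has_vector_derivative_transform[rotated 2]) (use d0 key in auto)
  moreover have "((\<lambda>s. D r c (x + s *\<^sub>R b) - D r c x) has_vector_derivative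
      D (D r c) b (x + 0 *\<^sub>R b) - 0) (at 0 within {0..\<delta>})"
    using x by (intro has_vector_derivative_diff line sD r has_vector_derivative_const) auto
  ultimately have "D (D r b) c x = D (D r c) b x"
    using vector_derivative_unique_within_closed_interval[of 0 \<delta> 0] d0 by auto
  then show ?thesis by (simp add: D_def[abs_def])
qed

section \<open>Ordinary differential equations\<close>

text \<open>Both integrals start at \<open>a\<close>, so that \<open>c\<close> and \<open>t\<close>
  may come in either order; an integral over {c..t} would vanish for t < c.\<close>

lemma norm_integral_diff_le:
  fixes f :: "real \<Rightarrow> 'a::euclidean_space"
  assumes f: "continuous_on {a..b} f" and c: "c \<in> {a..b}" and t: "t \<in> {a..b}"
    and B: "\<And>s. s \<in> {a..b} \<Longrightarrow> norm (f s) \<le> B"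
  shows "norm (integral {a..t} f - integral {a..c} f) \<le> B * \<bar>t - c\<bar>"
proof -
  have *: "norm (integral {a..v} f - integral {a..u} f) \<le> B * (v - u)"
    if "u \<in> {a..b}" "v \<in> {a..b}" "u \<le> v" for u v
  proof -
    have "f integrable_on {a..v}"
      by (rule integrable_continuous_real, rule continuous_on_subset[OF f]) (use that in auto)
    then have "integral {a..u} f + integral {u..v} f = integral {a..v} f"
      using that by (intro Henstock_Kurzweil_Integration.integral_combine) auto
    moreover have "norm (integral {u..v} f) \<le> B * (v - u)"
      by (rule integral_bound[OF that(3) continuous_on_subset[OF f]]) (use that B in auto)
    ultimately show ?thesis by (metis add_diff_cancel_left')
  qed
  show ?thesis
  proof (cases "c \<le> t")
    case True then show ?thesis using *[OF c t] by simp
  next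
    case False then show ?thesis using *[OF t c] by (simp add: norm_minus_commute)
  qed
qed

text \<open>Picard iteration. To have a contraction on functions on the whole line, the field is
  precomposed with the nearest-point projection onto the ball and time is clamped to a compact
  interval. Near \<open>t0\<close> the fixed point sees neither modification, since it stays in the
  ball.\<close>

lemma ode_local_existence:
  fixes X :: "'a::euclidean_space \<Rightarrow> 'a"
  assumes R: "R > 0" and L: "L \<ge> 0"
    and lip: "\<And>x y. x \<in> cball z0 R \<Longrightarrow> y \<in> cball z0 R \<Longrightarrow> norm (X x - X y) \<le> L * norm (x - y)"
  obtains \<epsilon> g where "\<epsilon> > 0" "g t0 = z0"
    "\<And>t. \<bar>t - t0\<bar> < \<epsilon> \<Longrightarrow> g t \<in> cball z0 R"
    "\<And>t. \<bar>t - t0\<bar> < \<epsilon> \<Longrightarrow> (g has_vector_derivative X (g t)) (at t)"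
proof -
  define P where "P = closest_point (cball z0 R)"
  define Y where "Y x = X (P x)" for x
  have ne: "cball z0 R \<noteq> {}" using R by simp
  have Pin: "P x \<in> cball z0 R" for x
    unfolding P_def by (rule closest_point_in_set[OF closed_cball ne])
  have Pid: "P x = x" if "x \<in> cball z0 R" for x
    unfolding P_def by (rule closest_point_self[OF that])
  have Plip: "norm (P x - P y) \<le> norm (x - y)" for x y
    using closest_point_lipschitz[OF convex_cball closed_cball ne] unfolding P_def dist_norm by blast
  have Ylip: "norm (Y x - Y y) \<le> L * norm (x - y)" for x y
    unfolding Y_def by (rule order_trans[OF lip[OF Pin Pin] mult_left_mono[OF Plip L]])
  define K where "K = norm (X z0) + L * R + 1"
  have K0: "K > 0" unfolding K_def using L R by (simp add: add_nonneg_pos)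
  have YK: "norm (Y x) \<le> K" for x
  proof -
    have "norm (X (P x) - X z0) \<le> L * norm (P x - z0)" using R by (intro lip Pin) auto
    also have "\<dots> \<le> L * R" using Pin[of x] L by (intro mult_left_mono) (auto simp: dist_norm norm_minus_commute)
    finally show ?thesis
      unfolding Y_def K_def using norm_triangle_ineq2[of "X (P x)" "X z0"] by linarith
  qed
  have Ycont: "continuous_on UNIV Y"
  proof (rule lipschitz_on_continuous_on)
    show "L-lipschitz_on UNIV Y" using Ylip L by (intro lipschitz_onI) (auto simp: dist_norm)
  qed
  \<comment> \<open>The first bound makes the integral operator a contraction with factor 1/2, the
    second keeps its values within distance \<open>R\<close> of \<open>z0\<close>.\<close>
  define \<epsilon> where "\<epsilon> = min (1 / (2 * (L + 1))) (R / K)"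
  have e0: "\<epsilon> > 0" unfolding \<epsilon>_def using L R K0 by simp
  have eL: "L * \<epsilon> \<le> 1 / 2"
  proof -
    have "L * \<epsilon> \<le> L * (1 / (2 * (L + 1)))" using L by (intro mult_left_mono) (auto simp: \<epsilon>_def)
    also have "\<dots> \<le> 1 / 2" using L by (simp add: divide_simps)
    finally show ?thesis .
  qed
  have eK: "K * \<epsilon> \<le> R"
  proof -
    have "K * \<epsilon> \<le> K * (R / K)" using K0 by (intro mult_left_mono) (auto simp: \<epsilon>_def)
    then show ?thesis using K0 by simp
  qed
  define a b where "a = t0 - \<epsilon>" and "b = t0 + \<epsilon>"
  define cl where "cl t = max a (min b t)" for t
  have cl: "cl t \<in> {a..b}" "\<bar>cl t - t0\<bar> \<le> \<epsilon>" for t using e0 by (auto simp: cl_def a_def b_def)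
  have cl_id: "cl t = t" if "t \<in> {a..b}" for t using that by (auto simp: cl_def)
  have t0: "t0 \<in> {a..b}" using e0 by (auto simp: a_def b_def)
  define T where "T g t = z0 + (integral {a..cl t} (\<lambda>s. Y (g s)) - integral {a..t0} (\<lambda>s. Y (g s)))"
    for g :: "real \<Rightarrow> 'a" and t
  have Yg: "continuous_on S (\<lambda>s. Y (apply_bcontfun g s))" for S and g :: "real \<Rightarrow>\<^sub>C 'a"
    by (rule continuous_on_compose2[OF Ycont]) (auto intro: continuous_on_subset[OF continuous_on_apply_bcontfun])
  have Tz0: "norm (T (apply_bcontfun g) t - z0) \<le> R" for g t
  proof -
    have "norm (T (apply_bcontfun g) t - z0) \<le> K * \<bar>cl t - t0\<bar>"
      unfolding T_def by (simp, rule norm_integral_diff_le[OF Yg t0 cl(1)]) (rule YK)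
    also have "\<dots> \<le> K * \<epsilon>" using cl(2) K0 by (intro mult_left_mono) auto
    finally show ?thesis using eK by simp
  qed
  have "T (apply_bcontfun g) \<in> bcontfun" for g
  proof (rule bcontfun_normI)
    have "continuous_on {a..b} (\<lambda>t. integral {a..t} (\<lambda>s. Y (apply_bcontfun g s)))"
      by (rule indefinite_integral_continuous_1, rule integrable_continuous_real, rule Yg)
    then have "continuous_on UNIV (\<lambda>t. integral {a..cl t} (\<lambda>s. Y (apply_bcontfun g s)))"
      by (rule continuous_on_compose2) (use cl in \<open>auto simp: cl_def[abs_def] intro!: continuous_intros\<close>)
    then show "continuous_on UNIV (T (apply_bcontfun g))"
      unfolding T_def[abs_def] by (intro continuous_intros)
    show "norm (T (apply_bcontfun g) t) \<le> norm z0 + R" for t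
      using Tz0[of g t] norm_triangle_ineq2[of "T (apply_bcontfun g) t" z0] by linarith
  qed
  then have TT: "apply_bcontfun (Bcontfun (T (apply_bcontfun g))) = T (apply_bcontfun g)" for g
    by (simp add: Bcontfun_inverse)
  have "dist (Bcontfun (T (apply_bcontfun g))) (Bcontfun (T (apply_bcontfun h))) \<le> 1 / 2 * dist g h" for g h
  proof (rule dist_bound)
    fix t
    let ?f = "\<lambda>s. Y (apply_bcontfun g s) - Y (apply_bcontfun h s)"
    have int: "(\<lambda>s. Y (apply_bcontfun g s)) integrable_on {a..u}" for g u
      by (rule integrable_continuous_real, rule Yg)
    have "T (apply_bcontfun g) t - T (apply_bcontfun h) t = integral {a..cl t} ?f - integral {a..t0} ?f"
      unfolding T_def by (simp add: integral_diff int)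
    also have "norm \<dots> \<le> (L * dist g h) * \<bar>cl t - t0\<bar>"
    proof (rule norm_integral_diff_le[OF _ t0 cl(1)])
      show "continuous_on {a..b} ?f" by (intro continuous_on_diff Yg)
      fix s
      have "norm (?f s) \<le> L * norm (apply_bcontfun g s - apply_bcontfun h s)" by (rule Ylip)
      also have "\<dots> \<le> L * dist g h"
        using dist_bounded[of g s h] L by (intro mult_left_mono) (auto simp: dist_norm)
      finally show "norm (?f s) \<le> L * dist g h" .
    qed
    also have "\<dots> \<le> (L * dist g h) * \<epsilon>" using cl(2) L by (intro mult_left_mono) auto
    also have "\<dots> \<le> 1 / 2 * dist g h" using mult_right_mono[OF eL zero_le_dist[of g h]] by (simp add: mult_ac)
    finally show "dist (apply_bcontfun (Bcontfun (T (apply_bcontfun g))) t) (apply_bcontfun (Bcontfun (T (apply_bcontfun h))) t)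
        \<le> 1 / 2 * dist g h"
      by (simp add: TT dist_norm)
  qed
  then have "\<exists>!g. Bcontfun (T (apply_bcontfun g)) = g"
    by (intro banach_fix_type[of "1 / 2"]) auto
  then obtain g where "Bcontfun (T (apply_bcontfun g)) = g" by blast
  then have g: "apply_bcontfun g = T (apply_bcontfun g)" using TT by metis
  let ?g = "apply_bcontfun g"
  have gR: "?g t \<in> cball z0 R" for t
    using Tz0[of g t] g by (metis dist_commute dist_norm mem_cball)
  have YX: "Y (?g s) = X (?g s)" for s unfolding Y_def by (subst Pid[OF gR]) (rule refl)
  show ?thesis
  proof (rule that[OF e0, of ?g])
    have "T ?g t0 = z0" unfolding T_def by (simp add: cl_id[OF t0])
    then show "?g t0 = z0" using g by metis
    show "?g t \<in> cball z0 R" for t by (rule gR)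
    fix t assume t: "\<bar>t - t0\<bar> < \<epsilon>"
    then have tab: "t \<in> {a<..<b}" by (auto simp: a_def b_def)
    have "((\<lambda>u. integral {a..u} (\<lambda>s. Y (?g s))) has_vector_derivative Y (?g t)) (at t within {a..b})"
      using tab by (intro integral_has_vector_derivative Yg) auto
    then have "((\<lambda>u. integral {a..u} (\<lambda>s. Y (?g s))) has_vector_derivative X (?g t)) (at t)"
      using tab by (simp add: at_within_Icc_at YX)
    then have "((\<lambda>u. z0 + (integral {a..u} (\<lambda>s. Y (?g s)) - integral {a..t0} (\<lambda>s. Y (?g s))))
        has_vector_derivative X (?g t)) (at t)"
      by (auto intro!: derivative_eq_intros)
    then show "(?g has_vector_derivative X (?g t)) (at t)"
    proof (rule has_vector_derivative_transform_within_open[where S = "{a<..<b}", OF _ _ tab])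
      fix u assume "u \<in> {a<..<b}"
      then have "T ?g u = z0 + (integral {a..u} (\<lambda>s. Y (?g s)) - integral {a..t0} (\<lambda>s. Y (?g s)))"
        unfolding T_def by (simp add: cl_id)
      then show "z0 + (integral {a..u} (\<lambda>s. Y (?g s)) - integral {a..t0} (\<lambda>s. Y (?g s))) = ?g u"
        using g by metis
    qed auto
  qed
qed

text \<open>On an interval shorter than 1 / L the maximum of |y - z| is bounded by (b - a) L times
  itself, hence vanishes. The common value may sit at any \<open>u\<close> of the interval, which
  later allows propagation to both sides.\<close>

lemma ode_local_unique:
  fixes y z :: "real \<Rightarrow> 'a::euclidean_space"
  assumes y: "\<And>t. t \<in> {a..b} \<Longrightarrow> (y has_vector_derivative X (y t)) (at t within {a..b})"
    and z: "\<And>t. t \<in> {a..b} \<Longrightarrow> (z has_vector_derivative X (z t)) (at t within {a..b})"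
    and S: "\<And>t. t \<in> {a..b} \<Longrightarrow> y t \<in> S" "\<And>t. t \<in> {a..b} \<Longrightarrow> z t \<in> S"
    and lip: "\<And>x y. x \<in> S \<Longrightarrow> y \<in> S \<Longrightarrow> norm (X x - X y) \<le> L * norm (x - y)"
    and small: "(b - a) * L < 1" and L: "L \<ge> 0"
    and u: "u \<in> {a..b}" "y u = z u" and t: "t \<in> {a..b}"
  shows "y t = z t"
proof -
  define w where "w t = y t - z t" for t
  have w: "(w has_vector_derivative (X (y t) - X (z t))) (at t within {a..b})" if "t \<in> {a..b}" for t
    unfolding w_def[abs_def] by (rule has_vector_derivative_diff[OF y[OF that] z[OF that]])
  then have "continuous_on {a..b} w"
    using has_vector_derivative_continuous continuous_on_eq_continuous_within by blast
  then have "continuous_on {a..b} (\<lambda>t. norm (w t))" by (rule continuous_on_norm)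
  then obtain tm where tm: "tm \<in> {a..b}" "\<And>s. s \<in> {a..b} \<Longrightarrow> norm (w s) \<le> norm (w tm)"
    using continuous_attains_sup[of "{a..b}" "\<lambda>t. norm (w t)"] u by auto
  have "norm (w tm - w u) \<le> (L * norm (w tm)) * norm (tm - u)"
  proof (rule differentiable_bound[of "{a..b}" w])
    fix s assume s: "s \<in> {a..b}"
    show "(w has_derivative (\<lambda>h. h *\<^sub>R (X (y s) - X (z s)))) (at s within {a..b})"
      using w[OF s] by (simp add: has_vector_derivative_def)
    have le: "norm (X (y s) - X (z s)) \<le> L * norm (w tm)"
      unfolding w_def[symmetric]
      by (rule order_trans[OF lip[OF S(1)[OF s] S(2)[OF s]]])
         (use tm(2)[OF s] L in \<open>simp add: w_def mult_left_mono\<close>)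
    show "onorm (\<lambda>h. h *\<^sub>R (X (y s) - X (z s))) \<le> L * norm (w tm)"
    proof (rule onorm_le)
      fix h :: real
      show "norm (h *\<^sub>R (X (y s) - X (z s))) \<le> L * norm (w tm) * norm h"
        using mult_right_mono[OF le, of "\<bar>h\<bar>"] by (simp add: mult.commute)
    qed
  qed (use tm u in auto)
  also have "\<dots> \<le> (L * norm (w tm)) * (b - a)"
    using tm(1) u L by (intro mult_left_mono) auto
  finally have "norm (w tm) * (1 - (b - a) * L) \<le> 0"
    using u by (simp add: w_def algebra_simps)
  then have "norm (w tm) \<le> 0"
    using small by (simp add: mult_le_0_iff)
  then have "norm (w t) \<le> 0" using tm(2)[OF t] by linarith
  then show ?thesis by (simp add: w_def)
qed

text \<open>A bootstrap through g' = X (g t): composition with the smooth field preserves the order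
  of differentiability of g, and g gains one order over g'.\<close>

lemma ode_solution_smooth:
  assumes "open I" "open \<Omega>" "smooth_on \<Omega> X" "g ` I \<subseteq> \<Omega>"
    and g: "\<And>t. t \<in> I \<Longrightarrow> (g has_vector_derivative X (g t)) (at t)"
  shows "smooth_on I g"
proof -
  have "Ck_on k I g" for k
  proof (induction k)
    case 0
    have "continuous_on I g"
      using has_vector_derivative_continuous[OF g] by (intro continuous_at_imp_continuous_on) blast
    then show ?case by simp
  next
    case (Suc k)
    show ?case
    proof (rule Ck_on_SucI[OF assms(1)])
      show "t \<in> I \<Longrightarrow> (g has_derivative (\<lambda>h. h *\<^sub>R X (g t))) (at t)" for t
        using g by (simp add: has_vector_derivative_def)
      have "Ck_on k \<Omega> X" using assms(3) by (simp add: smooth_on_def)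
      then have "Ck_on k I (\<lambda>t. X (g t))" by (rule Ck_on_compose[OF assms(1,2,4) Suc])
      then show "Ck_on k I (\<lambda>t. h *\<^sub>R X (g t))" for h
        by (rule Ck_on_scaleR[OF assms(1) Ck_on_const[OF assms(1)]])
    qed
  qed
  then show ?thesis by (simp add: smooth_on_def)
qed

text \<open>Smoothness up to the end points requires an extension beyond them. The local solution
  through \<open>z t0\<close> supplies it, and uniqueness identifies it with \<open>z\<close> on the
  common interval.\<close>

lemma ode_smooth_map_on:
  fixes z :: "real \<Rightarrow> 'a::euclidean_space"
  assumes "open \<Omega>" "smooth_on \<Omega> X"
    and zin: "\<And>t. t \<in> {a..b} \<Longrightarrow> z t \<in> \<Omega>"
    and z: "\<And>t. t \<in> {a..b} \<Longrightarrow> (z has_vector_derivative X (z t)) (at t within {a..b})"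
  shows "smooth_map_on {a..b} z"
  unfolding smooth_map_on_def
proof
  fix t0 assume t0: "t0 \<in> {a..b}"
  obtain R where R: "R > 0" "cball (z t0) R \<subseteq> \<Omega>"
    using assms(1) zin[OF t0] open_contains_cball by blast
  obtain L where L: "L \<ge> 0" and lip: "\<And>x y. x \<in> cball (z t0) R \<Longrightarrow> y \<in> cball (z t0) R \<Longrightarrow> norm (X x - X y) \<le> L * norm (x - y)"
    using smooth_on_lipschitz_cball[OF assms(1,2) R(2)] by blast
  obtain \<epsilon> g where e: "\<epsilon> > 0" and g: "g t0 = z t0"
    "\<And>t. \<bar>t - t0\<bar> < \<epsilon> \<Longrightarrow> g t \<in> cball (z t0) R"
    "\<And>t. \<bar>t - t0\<bar> < \<epsilon> \<Longrightarrow> (g has_vector_derivative X (g t)) (at t)"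
    using ode_local_existence[OF R(1) L lip] by metis
  have "continuous (at t0 within {a..b}) z" by (rule has_vector_derivative_continuous[OF z[OF t0]])
  then obtain \<delta> where d: "\<delta> > 0" "\<And>t. t \<in> {a..b} \<Longrightarrow> dist t t0 < \<delta> \<Longrightarrow> dist (z t) (z t0) < R"
    unfolding continuous_within_eps_delta using R(1) by blast
  \<comment> \<open>Three demands: inside the life time of the local solution, inside the range
    where \<open>z\<close> stays in the ball, and 2 \<eta> L < 1 for local uniqueness.\<close>
  define \<eta> where "\<eta> = min (min (\<epsilon> / 2) (\<delta> / 2)) (1 / (4 * (L + 1)))"
  have eta: "\<eta> > 0" "\<eta> < \<epsilon>" "\<eta> < \<delta>" "\<eta> \<le> 1 / (4 * (L + 1))"
    using e d L by (auto simp: \<eta>_def)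
  define a' b' where "a' = max a (t0 - \<eta>)" and "b' = min b (t0 + \<eta>)"
  have sub: "{a'..b'} \<subseteq> {a..b}" by (auto simp: a'_def b'_def)
  have near: "\<bar>t - t0\<bar> \<le> \<eta>" if "t \<in> {a'..b'}" for t using that by (auto simp: a'_def b'_def)
  have eq: "g t = z t" if "t \<in> {a'..b'}" for t
  proof (rule ode_local_unique[where X = X and S = "cball (z t0) R" and L = L and u = t0 and y = g and z = z, OF _ _ _ _ lip _ L _ g(1) that])
    fix s assume s: "s \<in> {a'..b'}"
    have "\<bar>s - t0\<bar> < \<epsilon>" "dist s t0 < \<delta>" using near[OF s] eta by (auto simp: dist_real_def)
    then show "(g has_vector_derivative X (g s)) (at s within {a'..b'})" "g s \<in> cball (z t0) R"
      "z s \<in> cball (z t0) R"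
      using g s sub d(2)[of s] by (auto intro: has_vector_derivative_at_within simp: dist_commute)
    show "(z has_vector_derivative X (z s)) (at s within {a'..b'})"
      by (rule has_vector_derivative_within_subset[OF z sub]) (use s sub in auto)
  next
    have "(b' - a') * L \<le> 2 * \<eta> * L" using L by (intro mult_right_mono) (auto simp: a'_def b'_def)
    also have "\<dots> \<le> 2 * (1 / (4 * (L + 1))) * L" using L eta(4) by (intro mult_right_mono mult_left_mono) auto
    also have "\<dots> < 1" using L by (simp add: divide_simps)
    finally show "(b' - a') * L < 1" .
    show "t0 \<in> {a'..b'}" using t0 eta by (auto simp: a'_def b'_def)
  qed auto
  have "smooth_on {t0 - \<eta><..<t0 + \<eta>} g"
  proof (rule ode_solution_smooth[OF _ assms(1,2)])
    show "g ` {t0 - \<eta><..<t0 + \<eta>} \<subseteq> \<Omega>" using g(2) R(2) eta by (force simp: abs_less_iff)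
    show "(g has_vector_derivative X (g t)) (at t)" if "t \<in> {t0 - \<eta><..<t0 + \<eta>}" for t
      using that eta by (intro g(3)) (auto simp: abs_less_iff)
  qed auto
  moreover have "\<forall>y\<in>{a..b} \<inter> {t0 - \<eta><..<t0 + \<eta>}. g y = z y"
    using eq by (auto simp: a'_def b'_def)
  ultimately show "\<exists>U g. open U \<and> t0 \<in> U \<and> smooth_on U g \<and> (\<forall>y\<in>{a..b} \<inter> U. g y = z y)"
    using eta(1) by (intro exI[of _ "{t0 - \<eta><..<t0 + \<eta>}"] exI[of _ g]) auto
qed

section \<open>Smooth curves and local retractions\<close>

lemma smooth_map_on_subset: "smooth_map_on A f \<Longrightarrow> B \<subseteq> A \<Longrightarrow> smooth_map_on B f"
  unfolding smooth_map_on_def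
proof
  fix x
  assume sm: "\<forall>x\<in>A. \<exists>U g. open U \<and> x \<in> U \<and> smooth_on U g \<and> (\<forall>y\<in>A \<inter> U. g y = f y)"
    and sub: "B \<subseteq> A" and "x \<in> B"
  then obtain U g where "open U" "x \<in> U" "smooth_on U g" "\<forall>y\<in>A \<inter> U. g y = f y" by blast
  then show "\<exists>U g. open U \<and> x \<in> U \<and> smooth_on U g \<and> (\<forall>y\<in>B \<inter> U. g y = f y)"
    using sub by (intro exI[of _ U] exI[of _ g]) auto
qed

lemma smooth_map_on_cong:
  assumes "smooth_map_on A f" "\<And>x. x \<in> A \<Longrightarrow> f x = g x" shows "smooth_map_on A g"
  unfolding smooth_map_on_def
proof
  fix x assume "x \<in> A"
  then obtain U h where "open U" "x \<in> U" "smooth_on U h" "\<forall>y\<in>A \<inter> U. h y = f y"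
    using assms(1) unfolding smooth_map_on_def by blast
  then show "\<exists>U h. open U \<and> x \<in> U \<and> smooth_on U h \<and> (\<forall>y\<in>A \<inter> U. h y = g y)"
    using assms(2) by (intro exI[of _ U] exI[of _ h]) auto
qed

lemma smooth_on_imp_smooth_map_on: "open U \<Longrightarrow> smooth_on U f \<Longrightarrow> A \<subseteq> U \<Longrightarrow> smooth_map_on A f"
  unfolding smooth_map_on_def by blast

lemma smooth_map_on_compose_smooth_on:
  assumes "smooth_map_on A f" "\<And>x. x \<in> B \<Longrightarrow> h x \<in> A" "open V" "B \<subseteq> V" "smooth_on V h"
  shows "smooth_map_on B (\<lambda>x. f (h x))"
  unfolding smooth_map_on_def
proof
  fix x assume x: "x \<in> B"
  then obtain U g where U: "open U" "h x \<in> U" "smooth_on U g" "\<forall>y\<in>A \<inter> U. g y = f y"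
    using assms(1,2) unfolding smooth_map_on_def by metis
  define W where "W = V \<inter> h -` U"
  have "open W"
    unfolding W_def by (rule continuous_open_preimage[OF smooth_on_continuous_on[OF assms(5)] assms(3) U(1)])
  moreover have "smooth_on W (\<lambda>x. g (h x))"
    by (rule smooth_on_compose[OF \<open>open W\<close> U(1) _ smooth_on_subset[OF assms(5)] U(3)]) (auto simp: W_def)
  moreover have "x \<in> W" using x U assms(4) by (auto simp: W_def)
  moreover have "\<forall>y\<in>B \<inter> W. g (h y) = f (h y)" using U(4) assms(2) by (auto simp: W_def)
  ultimately show "\<exists>U g. open U \<and> x \<in> U \<and> smooth_on U g \<and> (\<forall>y\<in>B \<inter> U. g y = f (h y))"
    by blast
qed

lemma smooth_on_affine: "open U \<Longrightarrow> smooth_on U (\<lambda>s::real. p + s *\<^sub>R w)"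
  by (intro smooth_on_add smooth_on_const smooth_on_scaleR smooth_on_id)

lemma smooth_map_on_imp_continuous_on: "smooth_map_on A f \<Longrightarrow> continuous_on A f"
  unfolding continuous_on_eq_continuous_within
proof
  fix x assume "smooth_map_on A f" and x: "x \<in> A"
  then obtain U g where U: "open U" "x \<in> U" "smooth_on U g" "\<forall>y\<in>A \<inter> U. g y = f y"
    unfolding smooth_map_on_def by blast
  have "continuous (at x within A) g"
    using smooth_on_continuous_on[OF U(3)] U(1,2)
    by (auto intro: continuous_at_imp_continuous_at_within simp: continuous_on_eq_continuous_at)
  moreover obtain d where d: "d > 0" "ball x d \<subseteq> U" using U(1,2) open_contains_ball by blast
  ultimately show "continuous (at x within A) f"
    by (intro continuous_transform_within[OF _ _ x, of g d f]) (use U(4) in \<open>auto simp: dist_commute subset_iff\<close>)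
qed

text \<open>A single extension represents the curve and, one-sided at the end points, its velocity;
  this is how velocities on closed intervals are seen to be smooth again.\<close>

lemma smooth_curve_extension:
  fixes \<gamma> :: "real \<Rightarrow> 'a::euclidean_space"
  assumes "smooth_map_on {a..b} \<gamma>" "t \<in> {a..b}"
  shows "\<exists>U g. open U \<and> t \<in> U \<and> smooth_on U g \<and> (\<forall>s\<in>{a..b} \<inter> U. g s = \<gamma> s
    \<and> (\<gamma> has_vector_derivative frechet_derivative g (at s) 1) (at s within {a..b}))"
proof -
  obtain U g where U: "open U" "t \<in> U" "smooth_on U g" "\<forall>y\<in>{a..b} \<inter> U. g y = \<gamma> y"
    using assms unfolding smooth_map_on_def by blast
  have "(\<gamma> has_vector_derivative frechet_derivative g (at s) 1) (at s within {a..b})"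
    if s: "s \<in> {a..b}" "s \<in> U" for s
  proof -
    have D: "(g has_derivative frechet_derivative g (at s)) (at s)"
      by (rule smooth_on_has_derivative[OF U(3,1) s(2)])
    have "frechet_derivative g (at s) = (\<lambda>h. h *\<^sub>R frechet_derivative g (at s) 1)"
    proof
      fix h
      show "frechet_derivative g (at s) h = h *\<^sub>R frechet_derivative g (at s) 1"
        using linear_cmul[OF has_derivative_linear[OF D], of h 1] by simp
    qed
    from has_derivative_at_withinI[OF has_derivative_eq_rhs[OF D this]]
    have dg: "(g has_vector_derivative frechet_derivative g (at s) 1) (at s within {a..b})"
      unfolding has_vector_derivative_def .
    obtain d where d: "d > 0" "ball s d \<subseteq> U" using U(1) s(2) open_contains_ball by blast
    show ?thesis
      by (rule has_vector_derivative_transform_within[OF dg d(1) s(1)]) (use U(4) d(2) in \<open>auto simp: dist_commute subset_iff\<close>)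
  qed
  then show ?thesis using U by (intro exI[of _ U] exI[of _ g]) auto
qed

abbreviation velocity :: "real \<Rightarrow> real \<Rightarrow> (real \<Rightarrow> 'a::real_normed_vector) \<Rightarrow> real \<Rightarrow> 'a" where
  "velocity a b \<gamma> t \<equiv> vector_derivative \<gamma> (at t within {a..b})"

lemma velocity_eq:
  fixes \<gamma> :: "real \<Rightarrow> 'a::euclidean_space"
  shows "(\<gamma> has_vector_derivative v) (at t within {a..b}) \<Longrightarrow> a < b \<Longrightarrow> t \<in> {a..b} \<Longrightarrow> velocity a b \<gamma> t = v"
  using vector_derivative_within_closed_interval by blast

lemma smooth_curve_velocity:
  fixes \<gamma> :: "real \<Rightarrow> 'a::euclidean_space"
  assumes "smooth_map_on {a..b} \<gamma>" "a < b" "t \<in> {a..b}"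
  shows "(\<gamma> has_vector_derivative velocity a b \<gamma> t) (at t within {a..b})"
proof -
  obtain U g where U: "open U" "t \<in> U" "smooth_on U g"
      "\<forall>s\<in>{a..b} \<inter> U. g s = \<gamma> s
        \<and> (\<gamma> has_vector_derivative frechet_derivative g (at s) 1) (at s within {a..b})"
    using smooth_curve_extension[OF assms(1,3)] by blast
  have "(\<gamma> has_vector_derivative frechet_derivative g (at t) 1) (at t within {a..b})"
    using U(2,4) assms(3) by blast
  then show ?thesis by (simp add: velocity_eq[OF _ assms(2,3)])
qed

lemma smooth_map_on_velocity:
  fixes \<gamma> :: "real \<Rightarrow> 'a::euclidean_space"
  assumes "smooth_map_on {a..b} \<gamma>" "a < b"
  shows "smooth_map_on {a..b} (velocity a b \<gamma>)"
  unfolding smooth_map_on_def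
proof
  fix t assume t: "t \<in> {a..b}"
  obtain U g where U: "open U" "t \<in> U" "smooth_on U g"
      "\<forall>s\<in>{a..b} \<inter> U. g s = \<gamma> s
        \<and> (\<gamma> has_vector_derivative frechet_derivative g (at s) 1) (at s within {a..b})"
    using smooth_curve_extension[OF assms(1) t] by blast
  show "\<exists>U g. open U \<and> t \<in> U \<and> smooth_on U g \<and> (\<forall>s\<in>{a..b} \<inter> U. g s = velocity a b \<gamma> s)"
    by (intro exI[of _ U] exI[of _ "\<lambda>s. frechet_derivative g (at s) 1"] conjI U smooth_on_Suc)
       (use U(4) velocity_eq[OF _ assms(2)] in force)
qed

lemma velocity_cong:
  assumes "\<And>s. s \<in> {a..b} \<Longrightarrow> f s = g s" "t \<in> {a..b}"
  shows "velocity a b f t = velocity a b g t"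
proof -
  have "(f has_vector_derivative v) (at t within {a..b}) \<longleftrightarrow> (g has_vector_derivative v) (at t within {a..b})" for v
    using assms has_vector_derivative_transform by metis
  then show ?thesis unfolding vector_derivative_def by simp
qed

section \<open>Smooth local retractions onto a submanifold\<close>

definition local_retraction :: "'a::euclidean_space set \<Rightarrow> 'a set \<Rightarrow> ('a \<Rightarrow> 'a) \<Rightarrow> bool" where
  "local_retraction M U r \<longleftrightarrow> open U \<and> smooth_on U r \<and> r ` U \<subseteq> M \<and> (\<forall>x\<in>M \<inter> U. r x = x)"

text \<open>The retraction is the chart after a linear projection \<pi> after the inverse chart,
  with both chart maps replaced by smooth extensions. The projection brings values of the extended
  inverse, which off \<open>M\<close> may leave the model subspace, back into it.\<close>

lemma smooth_submanifold_local_retraction: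
  assumes "smooth_submanifold m M" "p \<in> M"
  obtains U r where "local_retraction M U r" "p \<in> U"
proof -
  obtain W S B f where W: "openin (top_of_set M) W" "p \<in> W" and S: "subspace (S :: 'a set)"
      and B: "openin (top_of_set S) B" and f: "bij_betw f B W" "smooth_map_on B f"
      "smooth_map_on W (the_inv_into B f)"
    using assms unfolding smooth_submanifold_def diffeo_betw_def by metis
  let ?f' = "the_inv_into B f"
  obtain T where T: "open T" "B = S \<inter> T" using B by (auto simp: openin_open)
  obtain O' where O': "open O'" "W = M \<inter> O'" using W by (auto simp: openin_open)
  have f'B: "?f' x \<in> B" and ff': "f (?f' x) = x" if "x \<in> W" for x
    using that f(1) by (auto simp: bij_betw_def intro!: the_inv_into_into f_the_inv_into_f)
  obtain U1 F where F: "open U1" "?f' p \<in> U1" "smooth_on U1 F" "\<forall>y\<in>B \<inter> U1. F y = f y"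
    using f(2) f'B[OF W(2)] unfolding smooth_map_on_def by blast
  obtain V g where g: "open V" "p \<in> V" "smooth_on V g" "\<forall>y\<in>W \<inter> V. g y = ?f' y"
    using f(3) W(2) unfolding smooth_map_on_def by blast
  \<comment> \<open>A linear left inverse of the identity on \<open>S\<close> with range in
    \<open>S\<close> is a projection onto \<open>S\<close>.\<close>
  obtain \<pi> where pi: "range \<pi> \<subseteq> S" "linear \<pi>" "\<forall>v\<in>S. \<pi> v = v"
    using linear_exists_left_inverse_on[OF linear_ident S] by (auto simp: inj_on_def)
  have spi: "smooth_on V (\<lambda>x. \<pi> (g x))"
    using pi(2) by (intro smooth_on_bounded_linear[OF _ g(1,3), of \<pi>]) (simp add: linear_conv_bounded_linear)
  \<comment> \<open>\<open>O'\<close> guarantees that points of \<open>M\<close> in \<open>U\<close>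
    lie in the chart domain \<open>W\<close>; \<open>T\<close> and \<open>U1\<close> guarantee that
    \<pi> (g x) is a chart parameter at which \<open>F\<close> is \<open>f\<close>.\<close>
  define U where "U = (V \<inter> (\<lambda>x. \<pi> (g x)) -` (U1 \<inter> T)) \<inter> O'"
  have "open U"
    unfolding U_def using O'(1) F(1) T(1)
    by (intro open_Int continuous_open_preimage[OF smooth_on_continuous_on[OF spi] g(1)])
  moreover have "smooth_on U (\<lambda>x. F (\<pi> (g x)))"
    by (rule smooth_on_compose[OF \<open>open U\<close> F(1) _ smooth_on_subset[OF spi] F(3)]) (auto simp: U_def)
  moreover have "(\<lambda>x. F (\<pi> (g x))) ` U \<subseteq> M"
  proof clarify
    fix x assume "x \<in> U"
    then have "\<pi> (g x) \<in> B \<inter> U1" using pi(1) T(2) by (auto simp: U_def)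
    then show "F (\<pi> (g x)) \<in> M" using F(4) f(1) O'(2) by (auto simp: bij_betw_def)
  qed
  moreover have inv: "\<pi> (g x) = ?f' x" if "x \<in> W \<inter> V" for x
    using g(4) pi(3) f'B that T(2) by auto
  then have "F (\<pi> (g x)) = x" if "x \<in> M \<inter> U" for x
    using that F(4) f'B ff' O'(2) by (auto simp: U_def)
  moreover have "p \<in> U"
    using inv[of p] W(2) g(2) F(2) f'B[OF W(2)] T(2) O'(2) by (auto simp: U_def)
  ultimately show ?thesis
    using that[of U "\<lambda>x. F (\<pi> (g x))"] unfolding local_retraction_def by blast
qed

context
  fixes M U :: "'a::euclidean_space set" and r :: "'a \<Rightarrow> 'a"
  assumes ret: "local_retraction M U r"
begin

lemma open_U: "open U" and smooth_r: "smooth_on U r" and r_in: "x \<in> U \<Longrightarrow> r x \<in> M"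
  and r_id: "x \<in> M \<Longrightarrow> x \<in> U \<Longrightarrow> r x = x"
  using ret unfolding local_retraction_def by auto

lemma r_has_derivative: "x \<in> U \<Longrightarrow> (r has_derivative frechet_derivative r (at x)) (at x)"
  by (rule smooth_on_has_derivative[OF smooth_r open_U])

lemma retraction_curve_derivative:
  assumes c: "(c has_vector_derivative v) (at t within S)" and "c t \<in> U"
  shows "((\<lambda>s. r (c s)) has_vector_derivative frechet_derivative r (at (c t)) v) (at t within S)"
proof -
  have "((\<lambda>s. r (c s)) has_derivative (\<lambda>h. frechet_derivative r (at (c t)) (h *\<^sub>R v))) (at t within S)"
    using has_derivative_compose[OF c[unfolded has_vector_derivative_def] r_has_derivative[OF assms(2)]] .
  then show ?thesis
    using linear_cmul[OF smooth_on_linear[OF smooth_r open_U assms(2)]] by (simp add: has_vector_derivative_def)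
qed

text \<open>Differentiate the identity r (\<gamma> s) = \<gamma> s; on a nondegenerate interval the
  derivative is unique even at an end point.\<close>

lemma retraction_fixes_velocity:
  assumes \<gamma>: "(\<gamma> has_vector_derivative v) (at t within {a..b})" and "a < b" "t \<in> {a..b}" "\<gamma> t \<in> U"
    and M: "\<gamma> ` {a..b} \<subseteq> M"
  shows "frechet_derivative r (at (\<gamma> t)) v = v"
proof -
  have c: "continuous (at t within {a..b}) \<gamma>" by (rule has_vector_derivative_continuous[OF \<gamma>])
  obtain e where e: "e > 0" "ball (\<gamma> t) e \<subseteq> U" using open_U assms(4) open_contains_ball by blast
  obtain d where d: "d > 0" "\<And>s. s \<in> {a..b} \<Longrightarrow> dist s t < d \<Longrightarrow> dist (\<gamma> s) (\<gamma> t) < e"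
    using c e(1) unfolding continuous_within_eps_delta by blast
  have dU: "\<gamma> s \<in> U" if "s \<in> {a..b}" "dist s t < d" for s
    using d(2)[OF that] e(2) by (auto simp: dist_commute)
  have "((\<lambda>s. r (\<gamma> s)) has_vector_derivative frechet_derivative r (at (\<gamma> t)) v) (at t within {a..b})"
    by (rule retraction_curve_derivative[OF \<gamma> assms(4)])
  then have "(\<gamma> has_vector_derivative frechet_derivative r (at (\<gamma> t)) v) (at t within {a..b})"
  proof (rule has_vector_derivative_transform_within[OF _ d(1) assms(3)])
    fix s assume s: "s \<in> {a..b}" "dist s t < d"
    then have "\<gamma> s \<in> M" using M by auto
    then show "r (\<gamma> s) = \<gamma> s" by (rule r_id[OF _ dU[OF s]])
  qed
  from velocity_eq[OF this assms(2,3)] velocity_eq[OF \<gamma> assms(2,3)] show ?thesis by simp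
qed

lemma retraction_fixes_tangent:
  assumes "p \<in> U" "w \<in> tangent_space M p"
  shows "frechet_derivative r (at p) w = w"
proof -
  obtain \<gamma> \<epsilon> where g: "\<epsilon> > 0" "\<gamma> ` {-\<epsilon><..<\<epsilon>} \<subseteq> M" "\<gamma> 0 = p" "(\<gamma> has_vector_derivative w) (at 0)"
    using assms(2) unfolding tangent_space_def by blast
  have "frechet_derivative r (at (\<gamma> 0)) w = w"
    by (rule retraction_fixes_velocity[where a = "-\<epsilon>/2" and b = "\<epsilon>/2"])
       (use g assms in \<open>auto intro: has_vector_derivative_at_within\<close>)
  then show ?thesis using g by simp
qed

text \<open>The tangent vector is realised by the curve r (p + s e). With
  \<open>retraction_fixes_tangent\<close> this identifies the tangent space with the range of the
  derivative of r, for every choice of retraction.\<close>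

lemma retraction_range_tangent:
  assumes "p \<in> M" "p \<in> U"
  shows "frechet_derivative r (at p) e \<in> tangent_space M p"
proof -
  let ?c = "\<lambda>s. p + s *\<^sub>R e"
  have "open (?c -` U)" using open_U by (intro open_vimage) (auto intro!: continuous_intros)
  moreover have "0 \<in> ?c -` U" using assms by simp
  ultimately obtain d where d: "d > 0" "ball 0 d \<subseteq> ?c -` U" by (metis open_contains_ball)
  have sub: "?c ` {-d<..<d} \<subseteq> U" using d(2) by (auto simp: subset_iff dist_real_def abs_less_iff)
  have "smooth_on {-d<..<d} (\<lambda>s. r (?c s))"
    by (rule smooth_on_compose[OF _ open_U sub smooth_on_affine smooth_r]) auto
  moreover have "(?c has_vector_derivative e) (at 0)" by (auto intro!: derivative_eq_intros)
  from retraction_curve_derivative[OF this] assms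
  have "((\<lambda>s. r (?c s)) has_vector_derivative frechet_derivative r (at p) e) (at 0)" by simp
  ultimately show ?thesis
    unfolding tangent_space_def using d(1) sub r_in r_id[OF assms]
    by (intro CollectI exI[of _ "\<lambda>s. r (?c s)"] exI[of _ d]) auto
qed

end

text \<open>Reduces a statement about an interval with finitely many break points to intervals free
  of interior ones, provided that it is stable under concatenation; the induction splits at one
  break point at a time.\<close>

lemma piecewise_interval_induct:
  fixes a b :: real
  assumes "finite P" "a \<le> b"
    and "\<And>c d. a \<le> c \<Longrightarrow> c \<le> d \<Longrightarrow> d \<le> b \<Longrightarrow> {c<..<d} \<inter> P = {} \<Longrightarrow> Q c d"
    and join: "\<And>c d e. a \<le> c \<Longrightarrow> c \<le> d \<Longrightarrow> d \<le> e \<Longrightarrow> e \<le> b \<Longrightarrow> Q c d \<Longrightarrow> Q d e \<Longrightarrow> Q c e"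
  shows "Q a b"
  using assms
proof (induction P arbitrary: a b rule: finite_induct)
  case empty
  show ?case by (rule empty(2)) (use empty(1) in auto)
next
  case (insert p P)
  show ?case
  proof (cases "p \<in> {a<..<b}")
    case True
    have "Q a p"
    proof (rule insert.IH)
      fix c d assume "a \<le> c" "c \<le> d" "d \<le> p" "{c<..<d} \<inter> P = {}"
      with True have "c \<ge> a" "d \<le> b" "{c<..<d} \<inter> insert p P = {}" by auto
      with \<open>c \<le> d\<close> show "Q c d" using insert.prems(2)[of c d] by simp
    next
      fix c d e assume "a \<le> c" "c \<le> d" "d \<le> e" "e \<le> p" "Q c d" "Q d e"
      then show "Q c e" using True insert.prems(3)[of c d e] by simp
    qed (use True in auto)
    moreover have "Q p b"
    proof (rule insert.IH)
      fix c d assume "p \<le> c" "c \<le> d" "d \<le> b" "{c<..<d} \<inter> P = {}"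
      with True have "c \<ge> a" "d \<le> b" "{c<..<d} \<inter> insert p P = {}" by auto
      with \<open>c \<le> d\<close> show "Q c d" using insert.prems(2)[of c d] by simp
    next
      fix c d e assume "p \<le> c" "c \<le> d" "d \<le> e" "e \<le> b" "Q c d" "Q d e"
      then show "Q c e" using True insert.prems(3)[of c d e] by simp
    qed (use True in auto)
    ultimately show ?thesis using True insert.prems(3)[of a p b] by simp
  next
    case False
    show ?thesis
    proof (rule insert.IH[OF insert.prems(1)])
      fix c d assume "a \<le> c" "c \<le> d" "d \<le> b" "{c<..<d} \<inter> P = {}"
      moreover from this have "p \<notin> {c<..<d}" using False by auto
      ultimately show "Q c d" using insert.prems(2)[of c d] by simp
    qed (rule insert.prems(3))
  qed
qed

section \<open>Geodesic distance\<close>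

text \<open>Cauchy-Schwarz, from the nonnegative integral of ((b - a) f - I)^2, where I is the
  integral of f.\<close>

lemma integral_square_le:
  fixes f :: "real \<Rightarrow> real"
  assumes "continuous_on {a..b} f" "a \<le> b"
  shows "(integral {a..b} f)\<^sup>2 \<le> (b - a) * integral {a..b} (\<lambda>t. (f t)\<^sup>2)"
proof (cases "a = b")
  case False
  define I where "I = integral {a..b} f"
  have int: "f integrable_on {a..b}" "(\<lambda>t. (f t)\<^sup>2) integrable_on {a..b}"
    using assms(1) by (auto intro!: integrable_continuous_real continuous_intros)
  have hi: "((\<lambda>t. (b - a)\<^sup>2 * (f t)\<^sup>2 - 2 * (b - a) * I * f t + I\<^sup>2) has_integral
      ((b - a)\<^sup>2 * integral {a..b} (\<lambda>t. (f t)\<^sup>2) - 2 * (b - a) * I * I + (b - a) * I\<^sup>2)) {a..b}"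
    unfolding I_def using assms(2) int has_integral_const_real[of "I\<^sup>2" a b]
    by (intro has_integral_add has_integral_diff has_integral_mult_right integrable_integral)
       (auto simp: I_def)
  have sq: "(b - a)\<^sup>2 * (f t)\<^sup>2 - 2 * (b - a) * I * f t + I\<^sup>2 = ((b - a) * f t - I)\<^sup>2" for t
    by (simp add: power2_eq_square algebra_simps)
  have "0 \<le> (b - a)\<^sup>2 * integral {a..b} (\<lambda>t. (f t)\<^sup>2) - 2 * (b - a) * I * I + (b - a) * I\<^sup>2"
    by (rule has_integral_nonneg[OF hi[unfolded sq]]) simp
  also have "\<dots> = (b - a) * ((b - a) * integral {a..b} (\<lambda>t. (f t)\<^sup>2) - I\<^sup>2)"
    by (simp add: power2_eq_square algebra_simps)
  finally show ?thesis using False assms(2) by (simp add: zero_le_mult_iff I_def)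
qed simp

section \<open>Length of piecewise smooth curves\<close>

context
  fixes \<gamma> :: "real \<Rightarrow> 'a::euclidean_space" and P :: "real set"
  assumes fin: "finite P" and \<gamma>: "path \<gamma>"
    and sm0: "\<forall>a b. 0 \<le> a \<and> a < b \<and> b \<le> 1 \<and> {a<..<b} \<inter> P = {} \<longrightarrow> smooth_map_on {a..b} \<gamma>"
begin

private lemma sm: "0 \<le> a \<Longrightarrow> a < b \<Longrightarrow> b \<le> 1 \<Longrightarrow> {a<..<b} \<inter> P = {} \<Longrightarrow> smooth_map_on {a..b} \<gamma>"
  using sm0 by blast

lemma piecewise_smooth_velocity:
  assumes x: "x \<in> {0<..<1} - P"
  shows "(\<gamma> has_vector_derivative velocity 0 1 \<gamma> x) (at x)"
proof -
  have "open ({0<..<1} - P)" using fin by (intro open_Diff finite_imp_closed) auto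
  then obtain e where e: "e > 0" "ball x e \<subseteq> {0<..<1} - P" using x open_contains_ball by blast
  define a b where "a = x - e / 2" and "b = x + e / 2"
  have "{a..b} \<subseteq> ball x e"
    using e(1) by (auto simp: a_def b_def dist_real_def abs_less_iff)
  then have ab: "a < x" "x < b" "{a..b} \<subseteq> {0<..<1} - P"
    using e by (auto simp: a_def b_def)
  then have "a \<in> {0<..<1}" "b \<in> {0<..<1}" by (auto simp: subset_iff)
  moreover have "{a<..<b} \<inter> P = {}" using ab(3) by (fastforce simp: subset_iff)
  ultimately have "smooth_map_on {a..b} \<gamma>" using ab(1,2) by (intro sm) auto
  then have "(\<gamma> has_vector_derivative velocity a b \<gamma> x) (at x within {a..b})"
    using ab by (intro smooth_curve_velocity) auto
  then have D: "(\<gamma> has_vector_derivative velocity a b \<gamma> x) (at x)"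
    using ab by (simp add: at_within_Icc_at)
  have "velocity 0 1 \<gamma> x = velocity a b \<gamma> x"
    using x by (intro velocity_eq[OF has_vector_derivative_at_within[OF D]]) auto
  with D show ?thesis by simp
qed

text \<open>On a piece without interior break points the speed agrees, off the two ends, with the
  continuous speed of the closed piece. Since \<open>integral\<close> is zero on a function that is
  not integrable, this is what gives \<open>curve_length\<close> its meaning.\<close>

lemma piecewise_smooth_speed_integrable: "(\<lambda>t. norm (velocity 0 1 \<gamma> t)) integrable_on {0..1}"
proof (rule piecewise_interval_induct[OF fin, where Q = "\<lambda>a b. (\<lambda>t. norm (velocity 0 1 \<gamma> t)) integrable_on {a..b}"])
  fix c d :: real assume cd: "0 \<le> c" "c \<le> d" "d \<le> 1" "{c<..<d} \<inter> P = {}"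
  show "(\<lambda>t. norm (velocity 0 1 \<gamma> t)) integrable_on {c..d}"
  proof (cases "c = d")
    case False
    then have s: "smooth_map_on {c..d} \<gamma>" and "c < d" using cd sm by auto
    have int: "(\<lambda>t. norm (velocity c d \<gamma> t)) integrable_on {c..d}"
      by (intro integrable_continuous_real continuous_on_norm smooth_map_on_imp_continuous_on
          smooth_map_on_velocity s \<open>c < d\<close>)
    have eq: "velocity 0 1 \<gamma> t = velocity c d \<gamma> t" if t: "t \<in> {c..d} - {c, d}" for t
    proof -
      have "t \<in> {c<..<d}" using t by auto
      then have "t \<in> {0<..<1} - P" using cd by (auto simp: disjoint_iff)
      then have "(\<gamma> has_vector_derivative velocity 0 1 \<gamma> t) (at t)"
        by (rule piecewise_smooth_velocity)
      then show ?thesis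
        using t \<open>c < d\<close> by (intro velocity_eq[OF has_vector_derivative_at_within, symmetric]) auto
    qed
    show ?thesis
      by (rule integrable_spike_finite[OF _ _ int, of "{c, d}"]) (use eq in auto)
  qed (metis integrable_on_refl box_real(2))
next
  fix c d e :: real
  assume "0 \<le> c" "c \<le> d" "d \<le> e" "e \<le> 1" "(\<lambda>t. norm (velocity 0 1 \<gamma> t)) integrable_on {c..d}"
    "(\<lambda>t. norm (velocity 0 1 \<gamma> t)) integrable_on {d..e}"
  then show "(\<lambda>t. norm (velocity 0 1 \<gamma> t)) integrable_on {c..e}"
    by (rule_tac Henstock_Kurzweil_Integration.integrable_combine[of c d e])
qed auto

lemma piecewise_smooth_displacement_le:
  assumes "0 \<le> r" "r \<le> s" "s \<le> 1"
  shows "norm (\<gamma> s - \<gamma> r) \<le> integral {r..s} (\<lambda>t. norm (velocity 0 1 \<gamma> t))"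
proof -
  have "(velocity 0 1 \<gamma> has_integral (\<gamma> s - \<gamma> r)) {r..s}"
    using \<gamma> assms
    by (intro fundamental_theorem_of_calculus_interior_strong[OF fin] piecewise_smooth_velocity)
       (auto simp: path_def intro: continuous_on_subset)
  moreover have "(\<lambda>t. norm (velocity 0 1 \<gamma> t)) integrable_on {r..s}"
    by (rule integrable_subinterval_real[OF piecewise_smooth_speed_integrable]) (use assms in auto)
  ultimately show ?thesis
    using integral_norm_bound_integral[of "velocity 0 1 \<gamma>" "{r..s}" "\<lambda>t. norm (velocity 0 1 \<gamma> t)"]
    by (auto simp: has_integral_iff)
qed

end

lemma has_integral_half:
  fixes N :: "real \<Rightarrow> real"
  assumes "(N has_integral L) {0..1}"
  shows "((\<lambda>t. 2 * N (2 * t)) has_integral L) {0..1/2}"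
    and "((\<lambda>t. 2 * N (2 * t - 1)) has_integral L) {1/2..1}"
  using has_integral_mult_right[OF has_integral_affinity'[of N L 0 1 2 0], of 2]
    has_integral_mult_right[OF has_integral_affinity'[of N L 0 1 2 "-1"], of 2] assms
  by simp_all

lemma piecewise_smooth_join:
  fixes g1 g2 :: "real \<Rightarrow> 'a::euclidean_space"
  assumes g1: "piecewise_smooth_path g1" and g2: "piecewise_smooth_path g2"
    and meet: "pathfinish g1 = pathstart g2"
  shows "piecewise_smooth_path (g1 +++ g2)"
    and "curve_length 0 1 (g1 +++ g2) = curve_length 0 1 g1 + curve_length 0 1 g2"
proof -
  obtain P1 where P1: "finite P1" "path g1"
    "\<forall>a b. 0 \<le> a \<and> a < b \<and> b \<le> 1 \<and> {a<..<b} \<inter> P1 = {} \<longrightarrow> smooth_map_on {a..b} g1"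
    using g1 unfolding piecewise_smooth_path_def by metis
  obtain P2 where P2: "finite P2" "path g2"
    "\<forall>a b. 0 \<le> a \<and> a < b \<and> b \<le> 1 \<and> {a<..<b} \<inter> P2 = {} \<longrightarrow> smooth_map_on {a..b} g2"
    using g2 unfolding piecewise_smooth_path_def by metis
  let ?g = "g1 +++ g2"
  \<comment> \<open>The junction, and the break points of both curves transported to the two halves
    of the parameter interval.\<close>
  define P where "P = insert (1/2) ((\<lambda>x. x / 2) ` P1 \<union> (\<lambda>x. (x + 1) / 2) ` P2)"
  have finP: "finite P" using P1(1) P2(1) by (simp add: P_def)
  have pg: "path ?g" using P1(2) P2(2) meet by simp
  have in1: "t \<in> P" if "2 * t \<in> P1" for t
    unfolding P_def using that by (intro insertI2 UnI1 image_eqI[of _ _ "2 * t"]) auto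
  have in2: "t \<in> P" if "2 * t - 1 \<in> P2" for t
    unfolding P_def using that by (intro insertI2 UnI2 image_eqI[of _ _ "2 * t - 1"]) auto
  have e1: "?g t = g1 (2 * t)" if "t \<le> 1/2" for t using that by (simp add: joinpaths_def)
  have e2: "?g t = g2 (2 * t - 1)" if "t \<ge> 1/2" for t
  proof (cases "t = 1/2")
    case True
    then have "2 * t = 1" by simp
    with True meet show ?thesis by (simp add: joinpaths_def pathfinish_def pathstart_def)
  qed (use that in \<open>auto simp: joinpaths_def\<close>)
  have sm: "smooth_map_on {a..b} ?g" if ab: "0 \<le> a" "a < b" "b \<le> 1" "{a<..<b} \<inter> P = {}" for a b
  proof -
    have half: "1/2 \<notin> {a<..<b}" using ab(4) by (auto simp: P_def)
    have aff: "smooth_on UNIV (\<lambda>s::real. c + 2 * s)" for c :: real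
      using smooth_on_affine[of UNIV c 2] by (simp add: mult.commute)
    show ?thesis
    proof (cases "b \<le> 1/2")
      case True
      have "smooth_map_on {2 * a..2 * b} g1"
      proof (rule P1(3)[rule_format], intro conjI)
        show "{2 * a<..<2 * b} \<inter> P1 = {}"
        proof (rule ccontr)
          assume "{2 * a<..<2 * b} \<inter> P1 \<noteq> {}"
          then obtain x where "x \<in> {2 * a<..<2 * b}" "x \<in> P1" by blast
          then have "x / 2 \<in> {a<..<b} \<inter> P" using in1[of "x / 2"] by auto
          then show False using ab(4) by blast
        qed
      qed (use ab True in auto)
      then have "smooth_map_on {a..b} (\<lambda>s. g1 (0 + 2 * s))"
        by (rule smooth_map_on_compose_smooth_on[OF _ _ open_UNIV _ aff]) auto
      then show ?thesis by (rule smooth_map_on_cong) (use True e1 in auto)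
    next
      case False
      then have a: "a \<ge> 1/2" using half by auto
      have "smooth_map_on {2 * a - 1..2 * b - 1} g2"
      proof (rule P2(3)[rule_format], intro conjI)
        show "{2 * a - 1<..<2 * b - 1} \<inter> P2 = {}"
        proof (rule ccontr)
          assume "{2 * a - 1<..<2 * b - 1} \<inter> P2 \<noteq> {}"
          then obtain x where x: "x \<in> {2 * a - 1<..<2 * b - 1}" "x \<in> P2" by blast
          moreover have "2 * ((x + 1) / 2) - 1 = x" by (simp add: field_simps)
          ultimately have "(x + 1) / 2 \<in> {a<..<b} \<inter> P" using in2[of "(x + 1) / 2"] by simp
          then show False using ab(4) by blast
        qed
      qed (use ab a in auto)
      then have "smooth_map_on {a..b} (\<lambda>s. g2 (- 1 + 2 * s))"
        by (rule smooth_map_on_compose_smooth_on[OF _ _ open_UNIV _ aff]) auto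
      then show ?thesis by (rule smooth_map_on_cong) (use a e2 in auto)
    qed
  qed
  show "piecewise_smooth_path ?g"
    unfolding piecewise_smooth_path_def using pg finP sm by (intro conjI exI[of _ P]) auto
  have aff: "((\<lambda>s::real. 2 * s + c) has_vector_derivative 2) (at t)" for t c
    by (auto intro!: derivative_eq_intros)
  have v1: "norm (velocity 0 1 ?g t) = 2 * norm (velocity 0 1 g1 (2 * t))" if t: "t \<in> {0..1/2} - insert 0 P" for t
  proof -
    have t': "t \<in> {0<..<1/2}" using t by (auto simp: P_def)
    have "(g1 has_vector_derivative velocity 0 1 g1 (2 * t + 0)) (at (2 * t + 0))"
      using t t' in1[of t] by (intro piecewise_smooth_velocity[OF P1]) auto
    from vector_diff_chain_at[OF aff this]
    have "((\<lambda>s. g1 (2 * s)) has_vector_derivative 2 *\<^sub>R velocity 0 1 g1 (2 * t)) (at t)" by (simp add: o_def)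
    then have D: "(?g has_vector_derivative 2 *\<^sub>R velocity 0 1 g1 (2 * t)) (at t)"
      by (rule has_vector_derivative_transform_within_open[OF _ _ t']) (use e1 in auto)
    have "velocity 0 1 ?g t = 2 *\<^sub>R velocity 0 1 g1 (2 * t)"
      using t' by (intro velocity_eq[OF has_vector_derivative_at_within[OF D]]) auto
    then show ?thesis by simp
  qed
  have v2: "norm (velocity 0 1 ?g t) = 2 * norm (velocity 0 1 g2 (2 * t - 1))" if t: "t \<in> {1/2..1} - insert 1 P" for t
  proof -
    have t': "t \<in> {1/2<..<1}" using t by (auto simp: P_def)
    have "(g2 has_vector_derivative velocity 0 1 g2 (2 * t + - 1)) (at (2 * t + - 1))"
      using t t' in2[of t] by (intro piecewise_smooth_velocity[OF P2]) auto
    from vector_diff_chain_at[OF aff this]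
    have "((\<lambda>s. g2 (2 * s - 1)) has_vector_derivative 2 *\<^sub>R velocity 0 1 g2 (2 * t - 1)) (at t)" by (simp add: o_def)
    then have D: "(?g has_vector_derivative 2 *\<^sub>R velocity 0 1 g2 (2 * t - 1)) (at t)"
      by (rule has_vector_derivative_transform_within_open[OF _ _ t']) (use e2 in auto)
    have "velocity 0 1 ?g t = 2 *\<^sub>R velocity 0 1 g2 (2 * t - 1)"
      using t' by (intro velocity_eq[OF has_vector_derivative_at_within[OF D]]) auto
    then show ?thesis by simp
  qed
  have L1: "((\<lambda>t. norm (velocity 0 1 g1 t)) has_integral curve_length 0 1 g1) {0..1}"
    unfolding curve_length_def by (rule integrable_integral[OF piecewise_smooth_speed_integrable[OF P1]])
  have i1: "((\<lambda>t. norm (velocity 0 1 ?g t)) has_integral curve_length 0 1 g1) {0..1/2}"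
    by (rule has_integral_spike_finite[OF _ v1 has_integral_half(1)[OF L1], of "insert 0 P"]) (use finP in auto)
  have L2: "((\<lambda>t. norm (velocity 0 1 g2 t)) has_integral curve_length 0 1 g2) {0..1}"
    unfolding curve_length_def by (rule integrable_integral[OF piecewise_smooth_speed_integrable[OF P2]])
  have i2: "((\<lambda>t. norm (velocity 0 1 ?g t)) has_integral curve_length 0 1 g2) {1/2..1}"
    by (rule has_integral_spike_finite[OF _ v2 has_integral_half(2)[OF L2], of "insert 1 P"]) (use finP in auto)
  have "((\<lambda>t. norm (velocity 0 1 ?g t)) has_integral curve_length 0 1 g1 + curve_length 0 1 g2) {0..1}"
    by (rule has_integral_combine[OF _ _ i1 i2]) auto
  then show "curve_length 0 1 ?g = curve_length 0 1 g1 + curve_length 0 1 g2"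
    unfolding curve_length_def by (rule integral_unique)
qed

section \<open>The infimum of lengths over admissible curves\<close>

definition joins :: "'a::euclidean_space set \<Rightarrow> 'a \<Rightarrow> 'a \<Rightarrow> (real \<Rightarrow> 'a) \<Rightarrow> bool" where
  "joins M p q \<gamma> \<longleftrightarrow> piecewise_smooth_path \<gamma> \<and> path_image \<gamma> \<subseteq> M \<and> pathstart \<gamma> = p \<and> pathfinish \<gamma> = q"

lemma geodesic_dist_joins: "geodesic_dist M p q = Inf (curve_length 0 1 ` {\<gamma>. joins M p q \<gamma>})"
  unfolding geodesic_dist_def joins_def by (rule arg_cong[where f = Inf]) auto

lemma norm_le_curve_length: assumes "joins M p q \<gamma>" shows "norm (q - p) \<le> curve_length 0 1 \<gamma>"
proof -
  have "piecewise_smooth_path \<gamma>" using assms by (simp add: joins_def)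
  then obtain P where P: "finite P" "path \<gamma>"
    "\<forall>a b. 0 \<le> a \<and> a < b \<and> b \<le> 1 \<and> {a<..<b} \<inter> P = {} \<longrightarrow> smooth_map_on {a..b} \<gamma>"
    unfolding piecewise_smooth_path_def by metis
  from piecewise_smooth_displacement_le[OF P, of 0 1] assms show ?thesis
    by (simp add: joins_def pathstart_def pathfinish_def curve_length_def)
qed

lemma geodesic_dist_le: assumes "joins M p q \<gamma>" shows "geodesic_dist M p q \<le> curve_length 0 1 \<gamma>"
  unfolding geodesic_dist_joins
  by (rule cInf_lower) (use assms norm_le_curve_length in \<open>auto intro!: bdd_belowI[of _ "norm (q - p)"]\<close>)

lemma norm_le_geodesic_dist:
  assumes "joins M p q \<gamma>" shows "norm (q - p) \<le> geodesic_dist M p q"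
  unfolding geodesic_dist_joins
  by (rule cInf_greatest) (use assms norm_le_curve_length in auto)

lemma geodesic_dist_approx:
  assumes "joins M p q \<gamma>" "e > 0"
  obtains c where "joins M p q c" "curve_length 0 1 c < geodesic_dist M p q + e"
proof -
  have "Inf (curve_length 0 1 ` {\<gamma>. joins M p q \<gamma>}) < geodesic_dist M p q + e"
    using assms(2) by (simp add: geodesic_dist_joins)
  then show ?thesis using cInf_lessD[of "curve_length 0 1 ` {\<gamma>. joins M p q \<gamma>}"] assms(1) that by blast
qed

lemma joins_join:
  assumes "joins M p q c1" "joins M q r c2" shows "joins M p r (c1 +++ c2)"
  using assms piecewise_smooth_join(1)[of c1 c2] path_image_join_subset[of c1 c2] unfolding joins_def
  by (auto simp: subset_iff)

lemma geodesic_dist_triangle_joins: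
  assumes "joins M p q c1" "joins M q r c2"
  shows "geodesic_dist M p r \<le> geodesic_dist M p q + geodesic_dist M q r"
proof (rule field_le_epsilon)
  fix e :: real assume "e > 0"
  obtain a where a: "joins M p q a" "curve_length 0 1 a < geodesic_dist M p q + e / 2"
    using geodesic_dist_approx[OF assms(1), of "e / 2"] \<open>e > 0\<close> by auto
  obtain b where b: "joins M q r b" "curve_length 0 1 b < geodesic_dist M q r + e / 2"
    using geodesic_dist_approx[OF assms(2), of "e / 2"] \<open>e > 0\<close> by auto
  have "geodesic_dist M p r \<le> curve_length 0 1 (a +++ b)"
    by (rule geodesic_dist_le[OF joins_join[OF a(1) b(1)]])
  also have "\<dots> = curve_length 0 1 a + curve_length 0 1 b"
    by (rule piecewise_smooth_join(2)) (use a b in \<open>auto simp: joins_def\<close>)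
  finally show "geodesic_dist M p r \<le> geodesic_dist M p q + geodesic_dist M q r + e" using a b by linarith
qed

text \<open>The competitor is the retracted chord r (x + s w) with w = y - x. Its velocity has mean
  exactly w, and differs from w by at most K |w|^2 because the derivative of r is K-Lipschitz. Hence
  its energy is |w|^2 plus the variance of the velocity, at most K^2 |w|^4, and no term of third
  order arises.\<close>

lemma local_distance_estimate:
  assumes ret: "local_retraction M U r" and p: "p \<in> U"
  shows "\<exists>\<rho> C. \<rho> > 0 \<and> C \<ge> 0 \<and> (\<forall>x\<in>M \<inter> ball p \<rho>. \<forall>y\<in>M \<inter> ball p \<rho>. (\<exists>c. joins M x y c)
      \<and> (geodesic_dist M x y)\<^sup>2 \<le> norm (y - x) ^ 2 + C * norm (y - x) ^ 4)"
proof -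
  note U = open_U[OF ret] and sr = smooth_r[OF ret]
  obtain \<rho> where rho: "\<rho> > 0" "cball p \<rho> \<subseteq> U" using U p open_contains_cball by blast
  have "\<exists>L\<ge>0. \<forall>x\<in>cball p \<rho>. \<forall>y\<in>cball p \<rho>.
      norm (frechet_derivative r (at x) b - frechet_derivative r (at y) b) \<le> L * norm (x - y)" for b
    using smooth_on_lipschitz_cball[OF U smooth_on_Suc[OF sr, of b] rho(2)] by metis
  then obtain L where L: "\<And>b. L b \<ge> 0" "\<And>b x y. x \<in> cball p \<rho> \<Longrightarrow> y \<in> cball p \<rho> \<Longrightarrow>
      norm (frechet_derivative r (at x) b - frechet_derivative r (at y) b) \<le> L b * norm (x - y)" by metis
  define K where "K = (\<Sum>b\<in>Basis. L b)"
  have K0: "K \<ge> 0" unfolding K_def by (rule sum_nonneg) (rule L)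
  have K: "norm (frechet_derivative r (at x) w - frechet_derivative r (at y) w) \<le> K * norm w * norm (x - y)"
    if x: "x \<in> cball p \<rho>" and y: "y \<in> cball p \<rho>" for x y w
  proof -
    have "frechet_derivative r (at x) w - frechet_derivative r (at y) w
        = (\<Sum>b\<in>Basis. (w \<bullet> b) *\<^sub>R (frechet_derivative r (at x) b - frechet_derivative r (at y) b))"
      by (rule linear_eq_sum_Basis[OF linear_compose_sub[OF smooth_on_linear[OF sr U] smooth_on_linear[OF sr U]]])
         (use x y rho(2) in auto)
    also have "norm \<dots> \<le> (\<Sum>b\<in>Basis. norm w * (L b * norm (x - y)))"
    proof (rule sum_norm_le)
      fix b :: 'a assume "b \<in> Basis"
      have "\<bar>w \<bullet> b\<bar> * norm (frechet_derivative r (at x) b - frechet_derivative r (at y) b) \<le> norm w * (L b * norm (x - y))"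
        by (intro mult_mono Basis_le_norm[OF \<open>b \<in> Basis\<close>] L(2)[OF x y]) auto
      then show "norm ((w \<bullet> b) *\<^sub>R (frechet_derivative r (at x) b - frechet_derivative r (at y) b))
          \<le> norm w * (L b * norm (x - y))" by simp
    qed
    also have "\<dots> = K * norm w * norm (x - y)"
      by (simp add: K_def sum_distrib_left sum_distrib_right mult_ac)
    finally show ?thesis .
  qed
  have main: "\<exists>c. joins M x y c \<and> (geodesic_dist M x y)\<^sup>2 \<le> norm (y - x) ^ 2 + K\<^sup>2 * norm (y - x) ^ 4"
    if x: "x \<in> M \<inter> ball p \<rho>" and y: "y \<in> M \<inter> ball p \<rho>" for x y
  proof -
    define w where "w = y - x"
    define h where "h = norm w"
    define seg where "seg s = x + s *\<^sub>R w" for s :: real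
    have seg: "seg s \<in> cball p \<rho>" if s: "s \<in> {0..1}" for s
    proof -
      have "seg s = (1 - s) *\<^sub>R x + s *\<^sub>R y" by (simp add: seg_def w_def algebra_simps)
      then show ?thesis using convexD[OF convex_cball[of p \<rho>], of x y "1 - s" s] x y s by simp
    qed
    have segU: "seg s \<in> U" if "s \<in> {0..1}" for s using seg[OF that] rho(2) by auto
    define c where "c s = r (seg s)" for s
    have "continuous_on UNIV seg" unfolding seg_def[abs_def] by (intro continuous_intros)
    then have oV: "open (seg -` U)" by (rule open_vimage[OF U])
    have "smooth_on (seg -` U) seg" unfolding seg_def[abs_def] by (rule smooth_on_affine[OF oV[unfolded seg_def[abs_def]]])
    then have "smooth_on (seg -` U) c"
      unfolding c_def[abs_def] by (intro smooth_on_compose[OF oV U _ _ sr, of seg]) auto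
    then have sc: "smooth_map_on {0..1} c"
      by (rule smooth_on_imp_smooth_map_on[OF oV]) (use segU in auto)
    have c01: "c 0 = x" "c 1 = y"
      using x y rho(2) r_id[OF ret] by (auto simp: c_def seg_def w_def subset_iff)
    have "piecewise_smooth_path c"
      unfolding piecewise_smooth_path_def path_def
      by (intro conjI exI[of _ "{}"] smooth_map_on_imp_continuous_on sc) (auto intro: smooth_map_on_subset[OF sc])
    then have j: "joins M x y c"
      unfolding joins_def path_image_def pathstart_def pathfinish_def
      using c01 segU r_in[OF ret] by (auto simp: c_def)
    have dseg: "(seg has_vector_derivative w) (at s within S)" for s S
      unfolding seg_def[abs_def] by (auto intro!: derivative_eq_intros)
    define v where "v = velocity 0 1 c"
    have dc: "(c has_vector_derivative frechet_derivative r (at (seg s)) w) (at s within {0..1})" if "s \<in> {0..1}" for s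
      unfolding c_def[abs_def] by (rule retraction_curve_derivative[OF ret dseg segU[OF that]])
    have v: "v s = frechet_derivative r (at (seg s)) w" if "s \<in> {0..1}" for s
      unfolding v_def by (rule velocity_eq[OF dc[OF that]]) (use that in auto)
    have cv: "continuous_on {0..1} v"
      unfolding v_def by (intro smooth_map_on_imp_continuous_on smooth_map_on_velocity sc) auto
    have iv: "(v has_integral w) {0..1}"
    proof -
      have "(v has_integral (c 1 - c 0)) {0..1}"
        by (rule fundamental_theorem_of_calculus) (use dc v in auto)
      then show ?thesis by (simp add: c01 w_def)
    qed
    have vw: "norm (v s - w) \<le> K * h\<^sup>2" if s: "s \<in> {0..1}" for s
    proof -
      have "((\<lambda>s'. v s - v s') has_integral (1 - 0) *\<^sub>R v s - w) {0..1}"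
        by (rule has_integral_diff[OF _ iv]) (use has_integral_const_real[of "v s" 0 1] in simp)
      then have "((\<lambda>s'. v s - v s') has_integral (v s - w)) {0..1}" by simp
      moreover have "norm (v s - v s') \<le> K * h\<^sup>2" if s': "s' \<in> {0..1}" for s'
      proof -
        have "norm (v s - v s') \<le> K * norm w * norm (seg s - seg s')"
          unfolding v[OF s] v[OF s'] by (rule K[OF seg[OF s] seg[OF s']])
        also have "norm (seg s - seg s') = \<bar>s - s'\<bar> * h"
          by (simp add: seg_def h_def flip: scaleR_left_diff_distrib)
        also have "K * norm w * (\<bar>s - s'\<bar> * h) \<le> K * norm w * (1 * h)"
          using s s' K0 by (intro mult_left_mono mult_right_mono) (auto simp: h_def)
        finally show ?thesis by (simp add: h_def power2_eq_square)
      qed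
      ultimately have "norm (v s - w) \<le> K * h\<^sup>2 * measure lborel {0..1::real}"
        using K0 by (intro has_integral_bound_real[of _ "{}"]) auto
      then show ?thesis by simp
    qed
    have i2: "((\<lambda>s. (norm (v s))\<^sup>2) has_integral integral {0..1} (\<lambda>s. (norm (v s))\<^sup>2)) {0..1}"
      by (intro integrable_integral integrable_continuous_real continuous_intros cv)
    have "((\<lambda>s. v s \<bullet> w) has_integral w \<bullet> w) {0..1}"
      using has_integral_linear[OF iv bounded_linear_inner_left[of w]] by (simp add: o_def)
    \<comment> \<open>The majorant comes from |v|^2 = |v - w|^2 + 2 v . w - |w|^2; its part linear
      in v integrates exactly.\<close>
    from has_integral_add[OF has_integral_mult_right[OF this, of 2] has_integral_const_real[of "K\<^sup>2 * h ^ 4 - h\<^sup>2" 0 1]]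
    have i3: "((\<lambda>s. 2 * (v s \<bullet> w) + (K\<^sup>2 * h ^ 4 - h\<^sup>2)) has_integral h\<^sup>2 + K\<^sup>2 * h ^ 4) {0..1}"
      by (simp add: h_def power2_norm_eq_inner)
    have "integral {0..1} (\<lambda>s. (norm (v s))\<^sup>2) \<le> h\<^sup>2 + K\<^sup>2 * h ^ 4"
    proof (rule has_integral_le[OF i2 i3])
      fix s :: real assume "s \<in> {0..1}"
      have "(norm (v s - w))\<^sup>2 \<le> (K * h\<^sup>2)\<^sup>2" by (rule power_mono[OF vw[OF \<open>s \<in> {0..1}\<close>]]) auto
      moreover have "(norm (v s - w))\<^sup>2 = (norm (v s))\<^sup>2 - 2 * (v s \<bullet> w) + h\<^sup>2"
        by (simp add: h_def power2_norm_eq_inner inner_diff_left inner_diff_right inner_commute)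
      moreover have "(K * h\<^sup>2)\<^sup>2 = K\<^sup>2 * h ^ 4" by (simp add: power_mult_distrib flip: power_mult)
      ultimately show "(norm (v s))\<^sup>2 \<le> 2 * (v s \<bullet> w) + (K\<^sup>2 * h ^ 4 - h\<^sup>2)" by linarith
    qed
    moreover have "(curve_length 0 1 c)\<^sup>2 \<le> integral {0..1} (\<lambda>s. (norm (v s))\<^sup>2)"
      using integral_square_le[OF continuous_on_norm[OF cv]] by (simp add: curve_length_def v_def)
    moreover have "(geodesic_dist M x y)\<^sup>2 \<le> (curve_length 0 1 c)\<^sup>2"
      using geodesic_dist_le[OF j] norm_le_geodesic_dist[OF j] norm_ge_zero[of "y - x"]
      by (intro power_mono) linarith+
    ultimately show ?thesis using j by (auto simp: h_def w_def)
  qed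
  show ?thesis
    using main rho(1) by (intro exI[of _ \<rho>] exI[of _ "K\<^sup>2"]) auto
qed

section \<open>The distance of a compact connected submanifold\<close>

locale closed_submanifold =
  fixes M :: "'a::euclidean_space set" and m :: nat
  assumes submanifold: "smooth_submanifold m M" and compact: "compact M" and connected: "connected M"
begin

abbreviation d :: "'a \<Rightarrow> 'a \<Rightarrow> real" where "d \<equiv> geodesic_dist M"

lemma local_estimate:
  assumes "p \<in> M"
  shows "\<exists>\<rho> C. \<rho> > 0 \<and> C \<ge> 0 \<and> (\<forall>x\<in>M \<inter> ball p \<rho>. \<forall>y\<in>M \<inter> ball p \<rho>. (\<exists>c. joins M x y c)
      \<and> (d x y)\<^sup>2 \<le> norm (y - x) ^ 2 + C * norm (y - x) ^ 4)"
proof -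
  obtain U r where "local_retraction M U r" "p \<in> U"
    using smooth_submanifold_local_retraction[OF submanifold assms] by metis
  then show ?thesis by (rule local_distance_estimate)
qed

text \<open>Nearby points can be joined and joinability is transitive, so connectedness makes it
  global; symmetry is built into \<open>?R\<close>.\<close>

lemma joined: 
  assumes "p \<in> M" "q \<in> M"
  shows "\<exists>c. joins M p q c"
proof -
  let ?R = "\<lambda>x y. (\<exists>c. joins M x y c) \<and> (\<exists>c. joins M y x c)"
  have "?R p q"
  proof (rule connected_equivalence_relation[OF connected assms, of ?R])
    fix x y z assume "?R x y" "?R y z"
    then show "?R x z" using joins_join by meson
  next
    fix x assume x: "x \<in> M"
    obtain \<rho> C where R: "\<rho> > 0" "\<forall>x'\<in>M \<inter> ball x \<rho>. \<forall>y\<in>M \<inter> ball x \<rho>. (\<exists>c. joins M x' y c)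
        \<and> (d x' y)\<^sup>2 \<le> norm (y - x') ^ 2 + C * norm (y - x') ^ 4"
      using local_estimate[OF x] by blast
    show "\<exists>T. openin (top_of_set M) T \<and> x \<in> T \<and> (\<forall>y\<in>T. ?R x y)"
      using R x by (intro exI[of _ "M \<inter> ball x \<rho>"]) (auto simp: openin_open_Int)
  qed auto
  then show ?thesis by blast
qed

lemma triangle: "p \<in> M \<Longrightarrow> q \<in> M \<Longrightarrow> r \<in> M \<Longrightarrow> d p r \<le> d p q + d q r"
  using geodesic_dist_triangle_joins joined by meson

lemma norm_le_d: "p \<in> M \<Longrightarrow> q \<in> M \<Longrightarrow> norm (q - p) \<le> d p q"
  using norm_le_geodesic_dist joined by meson

lemma d_nonneg: "p \<in> M \<Longrightarrow> q \<in> M \<Longrightarrow> 0 \<le> d p q"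
  using norm_le_d norm_ge_zero order_trans by blast

text \<open>A Lebesgue number of a finite subcover makes the radius uniform, and the sum of the
  finitely many constants dominates each of them.\<close>

lemma uniform_estimate:
  obtains \<delta> C where "\<delta> > 0" "C \<ge> 0"
    "\<And>x y. x \<in> M \<Longrightarrow> y \<in> M \<Longrightarrow> norm (y - x) < \<delta> \<Longrightarrow> (d x y)\<^sup>2 \<le> norm (y - x) ^ 2 + C * norm (y - x) ^ 4"
proof -
  obtain \<rho> C where R: "\<And>p. p \<in> M \<Longrightarrow> \<rho> p > 0" "\<And>p. p \<in> M \<Longrightarrow> C p \<ge> 0"
     "\<And>p x y. p \<in> M \<Longrightarrow> x \<in> M \<inter> ball p (\<rho> p) \<Longrightarrow> y \<in> M \<inter> ball p (\<rho> p) \<Longrightarrow>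
        (d x y)\<^sup>2 \<le> norm (y - x) ^ 2 + C p * norm (y - x) ^ 4"
    using local_estimate by metis
  have "M \<subseteq> (\<Union>p\<in>M. ball p (\<rho> p))" using R(1) by force
  then obtain S where S: "S \<subseteq> M" "finite S" "M \<subseteq> (\<Union>p\<in>S. ball p (\<rho> p))"
    using compactE_image[OF compact, of M "\<lambda>p. ball p (\<rho> p)"] by auto
  obtain e where e: "e > 0" "\<And>x. x \<in> M \<Longrightarrow> \<exists>G\<in>(\<lambda>p. ball p (\<rho> p)) ` S. ball x e \<subseteq> G"
    using Heine_Borel_lemma[OF compact S(3)] by auto
  show ?thesis
  proof (rule that[of e "\<Sum>p\<in>S. C p"])
    show "e > 0" by (rule e)
    show "(\<Sum>p\<in>S. C p) \<ge> 0" using S R(2) by (intro sum_nonneg) auto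
    fix x y assume xy: "x \<in> M" "y \<in> M" "norm (y - x) < e"
    then obtain p where p: "p \<in> S" "ball x e \<subseteq> ball p (\<rho> p)" using e(2) by blast
    have "x \<in> ball x e" "y \<in> ball x e" using xy e(1) by (auto simp: dist_norm norm_minus_commute)
    then have "(d x y)\<^sup>2 \<le> norm (y - x) ^ 2 + C p * norm (y - x) ^ 4"
      using R(3)[of p x y] p S xy by blast
    also have "C p \<le> (\<Sum>p\<in>S. C p)" using S R(2) p by (intro member_le_sum) auto
    then have "norm (y - x) ^ 2 + C p * norm (y - x) ^ 4 \<le> norm (y - x) ^ 2 + (\<Sum>p\<in>S. C p) * norm (y - x) ^ 4"
      by (intro add_left_mono mult_right_mono) auto
    finally show "(d x y)\<^sup>2 \<le> norm (y - x) ^ 2 + (\<Sum>p\<in>S. C p) * norm (y - x) ^ 4" .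
  qed
qed

lemma almost_isometric:
  assumes "\<epsilon> > 0"
  shows "\<exists>\<eta>>0. \<forall>x\<in>M. \<forall>y\<in>M. norm (y - x) < \<eta> \<longrightarrow> d x y \<le> (1 + \<epsilon>) * norm (y - x)"
proof -
  obtain \<delta> C where C: "\<delta> > 0" "C \<ge> 0"
    "\<And>x y. x \<in> M \<Longrightarrow> y \<in> M \<Longrightarrow> norm (y - x) < \<delta> \<Longrightarrow> (d x y)\<^sup>2 \<le> norm (y - x) ^ 2 + C * norm (y - x) ^ 4"
    by (rule uniform_estimate) blast
  \<comment> \<open>Chosen so that C |y - x|^2 \<le> \<epsilon>; the fourth-order term is then
    absorbed by the term 2 \<epsilon> |y - x|^2 of ((1 + \<epsilon>) |y - x|)^2.\<close>
  define \<eta> where "\<eta> = min \<delta> (sqrt (\<epsilon> / (C + 1)))"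
  have "\<eta> > 0" using C assms by (simp add: \<eta>_def)
  moreover have "d x y \<le> (1 + \<epsilon>) * norm (y - x)" if xy: "x \<in> M" "y \<in> M" "norm (y - x) < \<eta>" for x y
  proof (rule power2_le_imp_le)
    let ?n = "norm (y - x)"
    have "?n\<^sup>2 < (sqrt (\<epsilon> / (C + 1)))\<^sup>2" using xy(3) by (intro power_strict_mono) (auto simp: \<eta>_def)
    then have "?n\<^sup>2 * (C + 1) \<le> \<epsilon>" using assms C(2) by (simp add: pos_less_divide_eq)
    then have "C * ?n\<^sup>2 \<le> \<epsilon>" by (simp add: algebra_simps) (smt (verit) zero_le_power2)
    then have "?n\<^sup>2 * (C * ?n\<^sup>2) \<le> ?n\<^sup>2 * \<epsilon>" by (rule mult_left_mono) simp
    moreover have "C * ?n ^ 4 = ?n\<^sup>2 * (C * ?n\<^sup>2)" by (simp add: power4_eq_xxxx power2_eq_square)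
    moreover have "0 \<le> ?n\<^sup>2 * \<epsilon>" "0 \<le> \<epsilon>\<^sup>2 * ?n\<^sup>2" using assms by auto
    moreover have "((1 + \<epsilon>) * ?n)\<^sup>2 = ?n\<^sup>2 + 2 * (?n\<^sup>2 * \<epsilon>) + \<epsilon>\<^sup>2 * ?n\<^sup>2"
      by (simp add: power2_eq_square algebra_simps)
    moreover have "(d x y)\<^sup>2 \<le> ?n ^ 2 + C * ?n ^ 4" using xy by (intro C(3)) (auto simp: \<eta>_def)
    ultimately show "(d x y)\<^sup>2 \<le> ((1 + \<epsilon>) * ?n)\<^sup>2" by linarith
  qed (use assms in auto)
  ultimately show ?thesis by blast
qed

lemma d_refl: assumes "x \<in> M" shows "d x x = 0"
  using almost_isometric[of 1] d_nonneg[OF assms assms] assms by force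

text \<open>Over a fine partition consecutive points are at distance at most 1 + \<epsilon> times
  the chord, and the bounds on the chords telescope to the increment of \<Lambda>. In the
  applications \<Lambda> is the primitive of the speed of a piecewise smooth, C1 or H1
  curve.\<close>

lemma d_le_variation:
  fixes a b :: real and F :: "real \<Rightarrow> 'a"
  assumes "a \<le> b" and F: "continuous_on {a..b} F" and FM: "F ` {a..b} \<subseteq> M"
    and var: "\<And>r s. a \<le> r \<Longrightarrow> r \<le> s \<Longrightarrow> s \<le> b \<Longrightarrow> norm (F s - F r) \<le> \<Lambda> s - \<Lambda> r"
  shows "d (F a) (F b) \<le> \<Lambda> b - \<Lambda> a"
proof (rule field_le_epsilon)
  fix e :: real assume e: "e > 0"
  define X where "X = \<Lambda> b - \<Lambda> a"
  have X: "X \<ge> 0" unfolding X_def by (rule order_trans[OF norm_ge_zero var[of a b]]) (use assms(1) in auto)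
  \<comment> \<open>The summand 1 avoids a division by zero when \<Lambda> has no increment.\<close>
  define \<epsilon> where "\<epsilon> = e / (X + 1)"
  have eps: "\<epsilon> > 0" using e X by (simp add: \<epsilon>_def)
  obtain \<eta> where eta: "\<eta> > 0" "\<And>x y. x \<in> M \<Longrightarrow> y \<in> M \<Longrightarrow> norm (y - x) < \<eta> \<Longrightarrow> d x y \<le> (1 + \<epsilon>) * norm (y - x)"
    using almost_isometric[OF eps] by blast
  have "uniformly_continuous_on {a..b} F" using compact_uniformly_continuous[OF F] by simp
  then obtain \<kappa> where kap: "\<kappa> > 0" "\<And>s t. s \<in> {a..b} \<Longrightarrow> t \<in> {a..b} \<Longrightarrow> dist t s < \<kappa> \<Longrightarrow> dist (F t) (F s) < \<eta>"
    unfolding uniformly_continuous_on_def using eta(1) by metis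
  obtain N :: nat where N: "N > 0" "(b - a) / \<kappa> < real N"
    using reals_Archimedean2[of "(b - a) / \<kappa>"] assms(1) kap(1)
    by (metis divide_nonneg_pos diff_ge_0_iff_ge gr0I leD of_nat_0)
  define h where "h = (b - a) / N"
  have h: "0 \<le> h" "h < \<kappa>" "a + N * h = b"
    using N assms(1) kap(1) by (auto simp: h_def field_simps)
  have "d (F a) (F (a + j * h)) \<le> (1 + \<epsilon>) * (\<Lambda> (a + j * h) - \<Lambda> a)" if "j \<le> N" for j
    using that
  proof (induction j)
    case 0
    have "F a \<in> M" using FM assms(1) by auto
    then show ?case by (simp add: d_refl)
  next
    case (Suc j)
    let ?s = "a + j * h" and ?t = "a + Suc j * h"
    have jN: "j * h \<le> N * h" "Suc j * h \<le> N * h" using Suc.prems h(1) by (intro mult_right_mono; simp)+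
    have st: "?s \<in> {a..b}" "?t \<in> {a..b}" "?t - ?s = h" using jN h by (auto simp: algebra_simps)
    then have "norm (F ?t - F ?s) < \<eta>" using kap(2)[OF st(1,2)] h by (simp add: dist_norm)
    moreover have FsM: "F ?s \<in> M" "F ?t \<in> M" "F a \<in> M" using FM st assms(1) by (auto simp del: of_nat_Suc)
    ultimately have "d (F ?s) (F ?t) \<le> (1 + \<epsilon>) * norm (F ?t - F ?s)" by (intro eta(2))
    also have "\<dots> \<le> (1 + \<epsilon>) * (\<Lambda> ?t - \<Lambda> ?s)"
      using st h eps by (intro mult_left_mono var) auto
    finally have "d (F ?s) (F ?t) \<le> (1 + \<epsilon>) * (\<Lambda> ?t - \<Lambda> ?s)" .
    moreover have "d (F a) (F ?t) \<le> d (F a) (F ?s) + d (F ?s) (F ?t)"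
      by (intro triangle FsM)
    moreover have "d (F a) (F ?s) \<le> (1 + \<epsilon>) * (\<Lambda> ?s - \<Lambda> a)" using Suc by simp
    ultimately show ?case by (simp add: algebra_simps)
  qed
  from this[of N] have "d (F a) (F b) \<le> (1 + \<epsilon>) * X" using h(3) by (simp add: X_def)
  also have "\<epsilon> * X \<le> e" using X e by (simp add: \<epsilon>_def field_simps)
  then have "(1 + \<epsilon>) * X \<le> X + e" by (simp add: algebra_simps)
  finally show "d (F a) (F b) \<le> \<Lambda> b - \<Lambda> a + e" by (simp add: X_def)
qed

text \<open>Short chords are at most doubled by \<open>d\<close>, so Euclidean convergence passes
  through the triangle inequality. Each small distance is bounded in both orders of its arguments,
  as the two triangle inequalities use opposite ones.\<close>

lemma tendsto_d:
  assumes x: "(x \<longlongrightarrow> x0) Fl" and y: "(y \<longlongrightarrow> y0) Fl"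
    and "\<forall>\<^sub>F n in Fl. x n \<in> M" "\<forall>\<^sub>F n in Fl. y n \<in> M" "x0 \<in> M" "y0 \<in> M"
  shows "((\<lambda>n. d (x n) (y n)) \<longlongrightarrow> d x0 y0) Fl"
proof -
  obtain \<eta> where eta: "\<eta> > 0" "\<And>x y. x \<in> M \<Longrightarrow> y \<in> M \<Longrightarrow> norm (y - x) < \<eta> \<Longrightarrow> d x y \<le> 2 * norm (y - x)"
    using almost_isometric[of 1] by auto
  have ev: "\<forall>\<^sub>F n in Fl. norm (d (x n) (y n) - d x0 y0) \<le> 2 * norm (x n - x0) + 2 * norm (y n - y0)"
    using tendstoD[OF x eta(1)] tendstoD[OF y eta(1)] assms(3,4)
  proof eventually_elim
    case (elim n)
    have "d (x n) x0 \<le> 2 * norm (x n - x0)" "d x0 (x n) \<le> 2 * norm (x n - x0)"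
      "d (y n) y0 \<le> 2 * norm (y n - y0)" "d y0 (y n) \<le> 2 * norm (y n - y0)"
      using eta(2)[of "x n" x0] eta(2)[of x0 "x n"] eta(2)[of "y n" y0] eta(2)[of y0 "y n"] elim assms(5,6)
      by (auto simp: dist_norm norm_minus_commute)
    moreover have "d (x n) (y n) \<le> d (x n) x0 + (d x0 y0 + d y0 (y n))"
      using triangle[OF elim(3) assms(5) elim(4)] triangle[OF assms(5,6) elim(4)] by linarith
    moreover have "d x0 y0 \<le> d x0 (x n) + (d (x n) (y n) + d (y n) y0)"
      using triangle[OF assms(5) elim(3) assms(6)] triangle[OF elim(3,4) assms(6)] by linarith
    ultimately show ?case unfolding real_norm_def by linarith
  qed
  have "((\<lambda>n. 2 * norm (x n - x0) + 2 * norm (y n - y0)) \<longlongrightarrow> 2 * 0 + 2 * 0) Fl"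
    by (intro tendsto_add tendsto_mult_left tendsto_norm_zero LIM_zero x y)
  then have "((\<lambda>n. 2 * norm (x n - x0) + 2 * norm (y n - y0)) \<longlongrightarrow> 0) Fl" by simp
  from LIM_zero_cancel[OF Lim_null_comparison[OF ev this]] show ?thesis .
qed

end

section \<open>Metric geodesics and their regularity\<close>

text \<open>The point with parameter k / 2^n in the subdivision of p, q by repeated midpoints; only
  k \<le> 2^n is of interest.\<close>

primrec dyadic :: "('a \<Rightarrow> 'a \<Rightarrow> 'a) \<Rightarrow> 'a \<Rightarrow> 'a \<Rightarrow> nat \<Rightarrow> nat \<Rightarrow> 'a" where
  "dyadic mid p q 0 k = (if k = 0 then p else q)"
| "dyadic mid p q (Suc n) k =
     (if even k then dyadic mid p q n (k div 2)
      else mid (dyadic mid p q n (k div 2)) (dyadic mid p q n (k div 2 + 1)))"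

section \<open>Existence of metric geodesics by repeated midpoints\<close>

context closed_submanifold
begin

text \<open>On an almost shortest curve the intermediate value theorem yields a point at distance
  exactly d p q / 2 from p. The part of the curve before it already costs that much length, so at
  most d p q / 2 + e remains.\<close>

lemma approximate_midpoint:
  assumes p: "p \<in> M" and q: "q \<in> M" and e: "e > 0"
  shows "\<exists>x\<in>M. d p x = d p q / 2 \<and> d x q \<le> d p q / 2 + e"
proof -
  obtain c0 where "joins M p q c0" using joined[OF p q] by blast
  then obtain c where c: "joins M p q c" "curve_length 0 1 c < d p q + e"
    using geodesic_dist_approx[OF _ e] by blast
  then obtain P where P: "finite P" "path c"
    "\<forall>a b. 0 \<le> a \<and> a < b \<and> b \<le> 1 \<and> {a<..<b} \<inter> P = {} \<longrightarrow> smooth_map_on {a..b} c"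
    unfolding joins_def piecewise_smooth_path_def by metis
  define \<Lambda> where "\<Lambda> s = integral {0..s} (\<lambda>t. norm (velocity 0 1 c t))" for s
  have cM: "c t \<in> M" if "t \<in> {0..1}" for t
    using c(1) that unfolding joins_def path_image_def by blast
  have c01: "c 0 = p" "c 1 = q" using c(1) by (auto simp: joins_def pathstart_def pathfinish_def)
  have cont: "continuous_on {0..1} c" using P(2) by (simp add: path_def)
  have var: "norm (c s - c r) \<le> \<Lambda> s - \<Lambda> r" if "0 \<le> r" "r \<le> s" "s \<le> 1" for r s
  proof -
    have "(\<lambda>t. norm (velocity 0 1 c t)) integrable_on {0..s}"
      by (rule integrable_subinterval_real[OF piecewise_smooth_speed_integrable[OF P]]) (use that in auto)
    then have "\<Lambda> r + integral {r..s} (\<lambda>t. norm (velocity 0 1 c t)) = \<Lambda> s"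
      unfolding \<Lambda>_def using that by (intro Henstock_Kurzweil_Integration.integral_combine) auto
    then show ?thesis using piecewise_smooth_displacement_le[OF P that] by linarith
  qed
  have le: "d (c r) (c s) \<le> \<Lambda> s - \<Lambda> r" if "0 \<le> r" "r \<le> s" "s \<le> 1" for r s
    by (rule d_le_variation[OF that(2)])
       (use that cM var in \<open>auto intro: continuous_on_subset[OF cont]\<close>)
  have "continuous_on {0..1} (\<lambda>s. d p (c s))"
    unfolding continuous_on_def
  proof
    fix s :: real assume s: "s \<in> {0..1}"
    have "(c \<longlongrightarrow> c s) (at s within {0..1})" using cont s by (simp add: continuous_on_def)
    moreover have "\<forall>\<^sub>F t in at s within {0..1}. c t \<in> M"
      unfolding eventually_at using cM by (intro exI[of _ 1]) auto
    ultimately show "((\<lambda>s. d p (c s)) \<longlongrightarrow> d p (c s)) (at s within {0..1})"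
      using p cM[OF s] by (intro tendsto_d) auto
  qed
  moreover have "d p (c 0) \<le> d p q / 2" "d p q / 2 \<le> d p (c 1)"
    using d_nonneg[OF p q] by (simp_all add: c01 d_refl p)
  ultimately obtain s where s: "0 \<le> s" "s \<le> 1" "d p (c s) = d p q / 2"
    using IVT'[of "\<lambda>s. d p (c s)" 0 "d p q / 2" 1] by auto
  have "d p (c s) \<le> \<Lambda> s - \<Lambda> 0" "d (c s) q \<le> \<Lambda> 1 - \<Lambda> s"
    using le[of 0 s] le[of s 1] s c01 by auto
  moreover have "\<Lambda> 0 = 0" "\<Lambda> 1 = curve_length 0 1 c" by (simp_all add: \<Lambda>_def curve_length_def)
  ultimately show ?thesis using c(2) s cM[of s] by (intro bexI[of _ "c s"]) auto
qed

text \<open>Compactness gives a limit of approximate midpoints; the triangle inequality turns the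
  limiting upper bound into an equality.\<close>

lemma midpoint_exists:
  assumes p: "p \<in> M" and q: "q \<in> M"
  shows "\<exists>x\<in>M. d p x = d p q / 2 \<and> d x q = d p q / 2"
proof -
  have "\<exists>x\<in>M. d p x = d p q / 2 \<and> d x q \<le> d p q / 2 + 1 / real (Suc n)" for n
    by (rule approximate_midpoint[OF p q]) simp
  then obtain x where x: "\<And>n. x n \<in> M" "\<And>n. d p (x n) = d p q / 2"
    "\<And>n. d (x n) q \<le> d p q / 2 + 1 / real (Suc n)" by metis
  obtain l r where l: "l \<in> M" "strict_mono r" "(x \<circ> r) \<longlonglongrightarrow> l"
    using compact x(1) unfolding compact_def by blast
  have "(\<lambda>n. d p ((x \<circ> r) n)) \<longlonglongrightarrow> d p l"
    by (rule tendsto_d[OF tendsto_const l(3)]) (use p l(1) x(1) in auto)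
  then have pl: "d p l = d p q / 2" by (simp add: x(2) LIMSEQ_const_iff)
  have "(\<lambda>n. d ((x \<circ> r) n) q) \<longlonglongrightarrow> d l q"
    by (rule tendsto_d[OF l(3) tendsto_const]) (use q l(1) x(1) in auto)
  moreover have "(\<lambda>n. d p q / 2 + 1 / real (Suc (r n))) \<longlonglongrightarrow> d p q / 2 + 0"
    using LIMSEQ_subseq_LIMSEQ[OF LIMSEQ_inverse_real_of_nat l(2)]
    by (intro tendsto_add tendsto_const) (simp add: o_def inverse_eq_divide)
  ultimately have "d l q \<le> d p q / 2 + 0"
    by (rule LIMSEQ_le) (use x(3) in auto)
  moreover have "d p q \<le> d p l + d l q" by (rule triangle[OF p l(1) q])
  ultimately show ?thesis using pl l(1) by (intro bexI[of _ l]) auto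
qed

text \<open>Neighbouring dyadic points of level n are L / 2^n apart, and those with index floor (t
  2^n) converge geometrically to \<sigma> t. The limit satisfies d \<le> L (t - s); since the whole
  interval realises L, no subinterval can fall short.\<close>

lemma metric_geodesic_unit:
  assumes p: "p \<in> M" and q: "q \<in> M"
  shows "\<exists>\<sigma>. \<sigma> 0 = p \<and> \<sigma> 1 = q \<and> \<sigma> ` {0..1::real} \<subseteq> M
    \<and> (\<forall>s t. 0 \<le> s \<and> s \<le> t \<and> t \<le> 1 \<longrightarrow> d (\<sigma> s) (\<sigma> t) = d p q * (t - s))"
proof -
  define L where "L = d p q"
  have L0: "L \<ge> 0" unfolding L_def by (rule d_nonneg[OF p q])
  have "\<forall>x y. \<exists>z. x \<in> M \<and> y \<in> M \<longrightarrow> z \<in> M \<and> d x z = d x y / 2 \<and> d z y = d x y / 2"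
    using midpoint_exists by blast
  then obtain mid where mid: "\<And>x y. x \<in> M \<Longrightarrow> y \<in> M \<Longrightarrow> mid x y \<in> M"
    "\<And>x y. x \<in> M \<Longrightarrow> y \<in> M \<Longrightarrow> d x (mid x y) = d x y / 2"
    "\<And>x y. x \<in> M \<Longrightarrow> y \<in> M \<Longrightarrow> d (mid x y) y = d x y / 2" by metis
  define g where "g = dyadic mid p q"
  have gM: "g n k \<in> M" for n k
    unfolding g_def by (induction n arbitrary: k) (auto simp: p q mid(1))
  have gd: "d (g n k) (g n (Suc k)) = L / 2 ^ n" if "k < 2 ^ n" for n k
    using that
  proof (induction n arbitrary: k)
    case 0
    then show ?case by (simp add: g_def L_def)
  next
    case (Suc n)
    define j where "j = k div 2"
    have IH: "d (g n j) (g n (Suc j)) = L / 2 ^ n" using Suc.prems by (intro Suc.IH) (auto simp: j_def)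
    have gS: "g (Suc n) k = (if even k then g n (k div 2) else mid (g n (k div 2)) (g n (k div 2 + 1)))" for k
      by (simp add: g_def)
    show ?case
    proof (cases "even k")
      case True
      then have "g (Suc n) k = g n j" "g (Suc n) (Suc k) = mid (g n j) (g n (Suc j))"
        by (simp_all add: gS j_def del: dyadic.simps)
      then show ?thesis using mid(2)[OF gM[of n j] gM[of n "Suc j"]] IH by simp
    next
      case False
      then have "g (Suc n) k = mid (g n j) (g n (Suc j))" "g (Suc n) (Suc k) = g n (Suc j)"
        by (simp_all add: gS j_def del: dyadic.simps)
      then show ?thesis using mid(3)[OF gM[of n j] gM[of n "Suc j"]] IH by simp
    qed
  qed
  have gdk: "d (g n j) (g n (j + i)) \<le> L * i / 2 ^ n" if "j + i \<le> 2 ^ n" for n j i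
    using that
  proof (induction i)
    case 0
    then show ?case by (simp add: d_refl gM)
  next
    case (Suc i)
    have "d (g n j) (g n (j + Suc i)) \<le> d (g n j) (g n (j + i)) + d (g n (j + i)) (g n (j + Suc i))"
      by (rule triangle[OF gM gM gM])
    also have "\<dots> \<le> L * i / 2 ^ n + L / 2 ^ n"
      using Suc gd[of "j + i" n] by (intro add_mono) auto
    also have "\<dots> = L * Suc i / 2 ^ n" by (simp add: add_divide_distrib algebra_simps)
    finally show ?case .
  qed
  define k where "k n t = nat \<lfloor>t * 2 ^ n\<rfloor>" for n and t :: real
  have kb: "real (k n t) \<le> t * 2 ^ n" "t * 2 ^ n < real (k n t) + 1" "k n t \<le> 2 ^ n"
    if t: "0 \<le> t" "t \<le> 1" for n t
  proof -
    have nn: "0 \<le> t * 2 ^ n" using t by simp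
    have fl: "real (k n t) = of_int \<lfloor>t * 2 ^ n\<rfloor>" using nn by (simp add: k_def)
    show *: "real (k n t) \<le> t * 2 ^ n" "t * 2 ^ n < real (k n t) + 1" unfolding fl by linarith+
    have "t * 2 ^ n \<le> 1 * 2 ^ n" using t by (intro mult_right_mono) auto
    then have "real (k n t) \<le> 2 ^ n" using * by linarith
    then show "k n t \<le> 2 ^ n" by (metis of_nat_le_iff of_nat_numeral of_nat_power)
  qed
  \<comment> \<open>Doubling the resolution appends one binary digit, so the new point is the old
    one or its right neighbour on the finer grid.\<close>
  have kS: "k (Suc n) t = 2 * k n t \<or> k (Suc n) t = Suc (2 * k n t)" if t: "0 \<le> t" "t \<le> 1" for n t
  proof -
    have "t * 2 ^ Suc n = 2 * (t * 2 ^ n)" by simp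
    then have "real (k (Suc n) t) < real (2 * k n t + 2)" "real (2 * k n t) < real (k (Suc n) t + 1)"
      using kb[OF t, of n] kb[OF t, of "Suc n"] by auto
    then show ?thesis by linarith
  qed
  define S where "S n t = g n (k n t)" for n t
  have step: "norm (S (Suc n) t - S n t) \<le> L / 2 * (1 / 2) ^ n" if t: "0 \<le> t" "t \<le> 1" for n t
  proof -
    have e: "g (Suc n) (2 * k n t) = g n (k n t)" by (simp add: g_def)
    from kS[OF t, of n] have "d (S n t) (S (Suc n) t) \<le> L / 2 ^ Suc n"
    proof
      assume "k (Suc n) t = 2 * k n t"
      then show ?thesis using e L0 by (simp add: S_def d_refl gM)
    next
      assume k': "k (Suc n) t = Suc (2 * k n t)"
      then have "2 * k n t < 2 ^ Suc n" using kb(3)[OF t, of "Suc n"] by simp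
      from gd[OF this] show ?thesis by (simp add: S_def k' e)
    qed
    moreover have "norm (S (Suc n) t - S n t) \<le> d (S n t) (S (Suc n) t)"
      unfolding S_def by (rule norm_le_d[OF gM gM])
    ultimately show ?thesis by (simp add: power_divide)
  qed
  have "\<exists>l. (\<lambda>n. S n t) \<longlonglongrightarrow> l" if t: "0 \<le> t" "t \<le> 1" for t
  proof -
    have "summable (\<lambda>n. S (Suc n) t - S n t)"
      by (rule summable_comparison_test'[OF summable_mult[OF summable_geometric[of "1 / 2 :: real"]], of 0 _ "L / 2"])
         (simp, rule step[OF t])
    from tendsto_add[OF tendsto_const[of "S 0 t"] summable_LIMSEQ[OF this]] show ?thesis
      unfolding sum_lessThan_telescope[of "\<lambda>n. S n t"] by auto
  qed
  then obtain \<sigma> where \<sigma>: "\<And>t. 0 \<le> t \<Longrightarrow> t \<le> 1 \<Longrightarrow> (\<lambda>n. S n t) \<longlonglongrightarrow> \<sigma> t" by metis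
  have SM: "S n t \<in> M" for n t by (simp add: S_def gM)
  have \<sigma>M: "\<sigma> t \<in> M" if "0 \<le> t" "t \<le> 1" for t
    by (rule closed_sequentially[OF compact_imp_closed[OF compact] _ \<sigma>[OF that]]) (rule SM)
  have le: "d (\<sigma> s) (\<sigma> t) \<le> L * (t - s)" if st: "0 \<le> s" "s \<le> t" "t \<le> 1" for s t
  proof -
    have "(\<lambda>n. d (S n s) (S n t)) \<longlonglongrightarrow> d (\<sigma> s) (\<sigma> t)"
      by (rule tendsto_d[OF \<sigma> \<sigma>]) (use st SM \<sigma>M in auto)
    moreover have "(\<lambda>n. L * (t - s + (1 / 2) ^ n)) \<longlonglongrightarrow> L * (t - s + 0)"
      by (intro tendsto_mult tendsto_add tendsto_const LIMSEQ_power_zero) auto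
    \<comment> \<open>Rounding both parameters down costs at most one grid step, whence the extra
      (1/2)^n.\<close>
    moreover have "d (S n s) (S n t) \<le> L * (t - s + (1 / 2) ^ n)" for n
    proof -
      have "s * 2 ^ n \<le> t * 2 ^ n" using st by (intro mult_right_mono) auto
      then have kk: "k n s \<le> k n t" unfolding k_def by (intro nat_mono floor_mono)
      have "d (S n s) (S n t) \<le> L * real (k n t - k n s) / 2 ^ n"
        using gdk[of "k n s" "k n t - k n s" n] kk kb(3)[of t n] st by (simp add: S_def)
      also have "\<dots> \<le> L * ((t - s) * 2 ^ n + 1) / 2 ^ n"
        using kk kb(1)[of t n] kb(2)[of s n] st L0
        by (intro divide_right_mono mult_left_mono) (auto simp: of_nat_diff algebra_simps)
      also have "\<dots> = L * (t - s + (1 / 2) ^ n)" by (simp add: field_simps)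
      finally show ?thesis .
    qed
    ultimately have "d (\<sigma> s) (\<sigma> t) \<le> L * (t - s + 0)"
      by (intro LIMSEQ_le) auto
    then show ?thesis by simp
  qed
  have "k n 0 = 0" "k n 1 = 2 ^ n" for n
    by (simp_all add: k_def)
  moreover have "g n 0 = p" "g n (2 ^ n) = q" for n
    by (induction n) (auto simp: g_def)
  ultimately have "S n 0 = p" "S n 1 = q" for n by (simp_all add: S_def)
  then have ends: "\<sigma> 0 = p" "\<sigma> 1 = q"
    using \<sigma>[of 0] \<sigma>[of 1] by (simp_all add: LIMSEQ_const_iff)
  have "d (\<sigma> s) (\<sigma> t) = L * (t - s)" if st: "0 \<le> s" "s \<le> t" "t \<le> 1" for s t
  proof -
    have "L \<le> d p (\<sigma> s) + d (\<sigma> s) q" unfolding L_def using st by (intro triangle p q \<sigma>M) auto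
    moreover have "d (\<sigma> s) q \<le> d (\<sigma> s) (\<sigma> t) + d (\<sigma> t) q" using st by (intro triangle p q \<sigma>M) auto
    moreover have "d p (\<sigma> s) \<le> L * s" using le[of 0 s] st ends by simp
    moreover have "d (\<sigma> t) q \<le> L * (1 - t)" using le[of t 1] st ends by simp
    ultimately show ?thesis using le[OF st] by (simp add: algebra_simps)
  qed
  then show ?thesis using ends \<sigma>M by (intro exI[of _ \<sigma>]) (auto simp: L_def)
qed

text \<open>The speed is a separate parameter, so that restriction to a subinterval keeps it and
  short pieces can be studied on their own.\<close>

definition metric_geodesic :: "real \<Rightarrow> real \<Rightarrow> real \<Rightarrow> (real \<Rightarrow> 'a) \<Rightarrow> bool" where
  "metric_geodesic a b c \<sigma> \<longleftrightarrow> \<sigma> ` {a..b} \<subseteq> M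
     \<and> (\<forall>s t. a \<le> s \<and> s \<le> t \<and> t \<le> b \<longrightarrow> d (\<sigma> s) (\<sigma> t) = c * (t - s))"

lemma metric_geodesic_exists:
  assumes "p \<in> M" "q \<in> M" "a < b"
  obtains \<sigma> where "metric_geodesic a b (d p q / (b - a)) \<sigma>" "\<sigma> a = p" "\<sigma> b = q"
proof -
  obtain \<tau> where \<tau>: "\<tau> 0 = p" "\<tau> 1 = q" "\<tau> ` {0..1::real} \<subseteq> M"
     "\<forall>s t. 0 \<le> s \<and> s \<le> t \<and> t \<le> 1 \<longrightarrow> d (\<tau> s) (\<tau> t) = d p q * (t - s)"
    using metric_geodesic_unit[OF assms(1,2)] by blast
  define u where "u t = (t - a) / (b - a)" for t
  have u: "0 \<le> u t" "u t \<le> 1" if "a \<le> t" "t \<le> b" for t using that assms(3) by (auto simp: u_def)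
  have um: "u s \<le> u t" if "s \<le> t" for s t using that assms(3) by (auto simp: u_def divide_right_mono)
  have "d (\<tau> (u s)) (\<tau> (u t)) = d p q / (b - a) * (t - s)" if "a \<le> s" "s \<le> t" "t \<le> b" for s t
  proof -
    have "d (\<tau> (u s)) (\<tau> (u t)) = d p q * (u t - u s)" using \<tau>(4) u um that by simp
    also have "u t - u s = (t - s) / (b - a)" by (simp add: u_def diff_divide_distrib)
    finally show ?thesis by simp
  qed
  then have "metric_geodesic a b (d p q / (b - a)) (\<lambda>t. \<tau> (u t))"
    unfolding metric_geodesic_def using \<tau>(3) u by auto
  moreover have "\<tau> (u a) = p" "\<tau> (u b) = q" using \<tau> assms(3) by (auto simp: u_def)
  ultimately show ?thesis by (rule that)
qed

end

section \<open>From bounds on second differences to a Lipschitz derivative\<close>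

lemma semiconvex_chord_bound:
  fixes \<phi> :: "real \<Rightarrow> real"
  assumes ab: "a < b" and cont: "continuous_on {a..b} \<phi>" and K: "K > 0"
    and sd: "\<And>t h. 0 < h \<Longrightarrow> a \<le> t - h \<Longrightarrow> t + h \<le> b \<Longrightarrow> - K * h\<^sup>2 \<le> \<phi> (t + h) + \<phi> (t - h) - 2 * \<phi> t"
    and s: "s \<in> {a..b}"
  shows "\<phi> s - (\<phi> a + (s - a) * ((\<phi> b - \<phi> a) / (b - a))) \<le> K * (s - a) * (b - s)"
proof -
  define l where "l = (\<phi> b - \<phi> a) / (b - a)"
  \<comment> \<open>The subtracted parabola has second differences - 2 K h^2, so those of \<psi> are
    at least K h^2 > 0, which is impossible at an interior maximum.\<close>
  define \<psi> where "\<psi> s = \<phi> s - (\<phi> a + (s - a) * l) - K * (s - a) * (b - s)" for s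
  have ends: "\<psi> a = 0" "\<psi> b = 0" using ab by (simp_all add: \<psi>_def l_def)
  have "continuous_on {a..b} \<psi>" unfolding \<psi>_def[abs_def] by (intro continuous_intros cont)
  then obtain x where x: "x \<in> {a..b}" "\<And>y. y \<in> {a..b} \<Longrightarrow> \<psi> y \<le> \<psi> x"
    using continuous_attains_sup[of "{a..b}" \<psi>] ab by auto
  have "\<psi> x \<le> 0"
  proof (rule ccontr)
    assume pos: "\<not> \<psi> x \<le> 0"
    define h where "h = min (x - a) (b - x)"
    have "x \<noteq> a" "x \<noteq> b" using pos ends by auto
    then have h: "0 < h" "a \<le> x - h" "x + h \<le> b" using x(1) by (auto simp: h_def)
    have "\<psi> (x + h) + \<psi> (x - h) - 2 * \<psi> x = (\<phi> (x + h) + \<phi> (x - h) - 2 * \<phi> x) + 2 * K * h\<^sup>2"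
      by (simp add: \<psi>_def power2_eq_square algebra_simps)
    moreover have "- K * h\<^sup>2 \<le> \<phi> (x + h) + \<phi> (x - h) - 2 * \<phi> x" by (rule sd[OF h])
    moreover have "K * h\<^sup>2 > 0" using K h by simp
    moreover have "\<psi> (x + h) \<le> \<psi> x" "\<psi> (x - h) \<le> \<psi> x" using h by (auto intro: x(2))
    ultimately show False by simp
  qed
  with x(2)[OF s] show ?thesis by (simp add: \<psi>_def l_def)
qed

text \<open>The scalar bound is applied to the component of \<sigma> in the direction of its own
  deviation from the chord.\<close>

lemma chord_bound:
  fixes \<sigma> :: "real \<Rightarrow> 'a::euclidean_space"
  assumes ab: "a < b" and cont: "continuous_on {a..b} \<sigma>" and K: "K > 0"
    and sd: "\<And>t h. 0 < h \<Longrightarrow> a \<le> t - h \<Longrightarrow> t + h \<le> b \<Longrightarrow> norm (\<sigma> (t + h) + \<sigma> (t - h) - 2 *\<^sub>R \<sigma> t) \<le> K * h\<^sup>2"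
    and s: "s \<in> {a..b}"
  shows "norm (\<sigma> s - \<sigma> a - (s - a) *\<^sub>R ((\<sigma> b - \<sigma> a) /\<^sub>R (b - a))) \<le> K * (s - a) * (b - s)"
proof -
  define w where "w = \<sigma> s - \<sigma> a - (s - a) *\<^sub>R ((\<sigma> b - \<sigma> a) /\<^sub>R (b - a))"
  define e where "e = sgn w"
  have e: "norm e \<le> 1" by (simp add: e_def norm_sgn)
  have "\<sigma> s \<bullet> e - (\<sigma> a \<bullet> e + (s - a) * ((\<sigma> b \<bullet> e - \<sigma> a \<bullet> e) / (b - a))) \<le> K * (s - a) * (b - s)"
  proof (rule semiconvex_chord_bound[OF ab _ K _ s])
    show "continuous_on {a..b} (\<lambda>s. \<sigma> s \<bullet> e)" by (intro continuous_intros cont)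
    fix t h :: real assume th: "0 < h" "a \<le> t - h" "t + h \<le> b"
    let ?D = "\<sigma> (t + h) + \<sigma> (t - h) - 2 *\<^sub>R \<sigma> t"
    have "\<bar>?D \<bullet> e\<bar> \<le> norm ?D * norm e" by (rule Cauchy_Schwarz_ineq2)
    also have "\<dots> \<le> (K * h\<^sup>2) * 1" using sd[OF th] e K by (intro mult_mono) auto
    finally show "- K * h\<^sup>2 \<le> \<sigma> (t + h) \<bullet> e + \<sigma> (t - h) \<bullet> e - 2 * (\<sigma> t \<bullet> e)"
      by (simp add: inner_diff_left inner_add_left abs_le_iff)
  qed
  moreover have "w \<bullet> e = norm w"
    by (cases "w = 0") (simp_all add: e_def sgn_div_norm power2_norm_eq_inner[symmetric] power2_eq_square)
  moreover have "w \<bullet> e = \<sigma> s \<bullet> e - (\<sigma> a \<bullet> e + (s - a) * ((\<sigma> b \<bullet> e - \<sigma> a \<bullet> e) / (b - a)))"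
    by (simp add: w_def inner_diff_left inner_add_left divide_inverse mult_ac)
  ultimately show ?thesis by (simp add: w_def)
qed

text \<open>The chord bound says that nearby difference quotients sharing one end point differ by at
  most K times the distance of the other ends. So they are Cauchy as one end approaches the other,
  and since a quotient \<open>S t u\<close> is close to both \<open>v t\<close> and
  \<open>v u\<close>, the limit \<open>v\<close> is locally Lipschitz.\<close>

lemma second_difference_imp_C1:
  fixes \<sigma> :: "real \<Rightarrow> 'a::euclidean_space"
  assumes ab: "a < b" and cont: "continuous_on {a..b} \<sigma>" and K: "K > 0" and \<eta>: "\<eta> > 0"
    and sd: "\<And>t h. 0 < h \<Longrightarrow> h < \<eta> \<Longrightarrow> a \<le> t - h \<Longrightarrow> t + h \<le> b \<Longrightarrow>
      norm (\<sigma> (t + h) + \<sigma> (t - h) - 2 *\<^sub>R \<sigma> t) \<le> K * h\<^sup>2"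
  obtains v where "\<And>t. t \<in> {a..b} \<Longrightarrow> (\<sigma> has_vector_derivative v t) (at t within {a..b})"
    "continuous_on {a..b} v"
proof -
  define S where "S x y = (\<sigma> y - \<sigma> x) /\<^sub>R (y - x)" for x y
  have Ssym: "S x y = S y x" for x y
  proof -
    have "S y x = (- (\<sigma> y - \<sigma> x)) /\<^sub>R (- (y - x))" by (simp add: S_def)
    also have "\<dots> = S x y" unfolding S_def inverse_minus_eq by (simp only: scaleR_minus_left scaleR_minus_right minus_minus)
    finally show ?thesis by simp
  qed
  have three: "norm (S x s - S x y) \<le> K * (y - s)" "norm (S s y - S x y) \<le> K * (s - x)"
    if xsy: "a \<le> x" "x < s" "s < y" "y \<le> b" "y - x < \<eta>" for x s y
  proof -
    define E where "E = \<sigma> s - \<sigma> x - (s - x) *\<^sub>R S x y"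
    have E: "norm E \<le> K * (s - x) * (y - s)"
      unfolding E_def S_def
      by (rule chord_bound[OF _ continuous_on_subset[OF cont] K sd]) (use xsy in auto)
    have "S x s - S x y = E /\<^sub>R (s - x)"
      using xsy by (simp add: E_def S_def[of x s] scaleR_diff_right)
    then have "norm (S x s - S x y) = norm E / (s - x)" using xsy by (simp add: divide_inverse mult.commute)
    also have "\<dots> \<le> (K * (s - x) * (y - s)) / (s - x)" using xsy by (intro divide_right_mono E) auto
    also have "\<dots> = K * (y - s)" using xsy by simp
    finally show "norm (S x s - S x y) \<le> K * (y - s)" .
    have "\<sigma> y - \<sigma> x = (y - x) *\<^sub>R S x y" using xsy by (simp add: S_def)
    then have "\<sigma> y - \<sigma> s = (y - s) *\<^sub>R S x y - E" by (simp add: E_def algebra_simps)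
    then have "S s y - S x y = - E /\<^sub>R (y - s)"
      using xsy by (simp add: S_def[of s y] scaleR_diff_right)
    then have "norm (S s y - S x y) = norm E / (y - s)" using xsy by (simp add: divide_inverse mult.commute)
    also have "\<dots> \<le> (K * (s - x) * (y - s)) / (y - s)" using xsy by (intro divide_right_mono E) auto
    also have "\<dots> = K * (s - x)" using xsy by simp
    finally show "norm (S s y - S x y) \<le> K * (s - x)" .
  qed
  have lip': "norm (S t u - S t w) \<le> K * \<bar>w - u\<bar>"
    if "t \<in> {a..b}" "u \<in> {a..b}" "w \<in> {a..b}" "u \<noteq> t" "w \<noteq> t" "\<bar>u - t\<bar> < \<eta> / 2" "\<bar>w - t\<bar> < \<eta> / 2" "u < w" for t u w
  proof -
    consider "t < u" | "u < t" "t < w" | "w < t" using \<open>u \<noteq> t\<close> \<open>w \<noteq> t\<close> by (meson linorder_neqE_linordered_idom)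
    then show ?thesis
    proof cases
      case 1
      then show ?thesis using three(1)[of t u w] that by auto
    next
      case 2
      have "w - u < \<eta>" using that by linarith
      \<comment> \<open>When t separates u and w, both quotients are compared with the one over the
        whole interval, and the two errors add up to K (w - u).\<close>
      then have "norm (S u t - S u w) \<le> K * (w - t)" "norm (S t w - S u w) \<le> K * (t - u)"
        using three[of u t w] that 2 by auto
      moreover have "norm (S t u - S t w) \<le> norm (S u t - S u w) + norm (S t w - S u w)"
        using norm_triangle_ineq4[of "S u t - S u w" "S t w - S u w"] Ssym[of t u] by simp
      ultimately show ?thesis using that by (simp add: algebra_simps)
    next
      case 3
      then have "norm (S w t - S u t) \<le> K * (w - u)" using three(2)[of u w t] that by auto
      then show ?thesis using that Ssym by (metis abs_of_pos diff_gt_0_iff_gt norm_minus_commute)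
    qed
  qed
  have lip: "norm (S t u - S t w) \<le> K * \<bar>w - u\<bar>"
    if "t \<in> {a..b}" "u \<in> {a..b}" "w \<in> {a..b}" "u \<noteq> t" "w \<noteq> t" "\<bar>u - t\<bar> < \<eta> / 2" "\<bar>w - t\<bar> < \<eta> / 2" for t u w
  proof (cases u w rule: linorder_cases)
    case less then show ?thesis by (rule lip'[OF that])
  next
    case greater
    then have "norm (S t w - S t u) \<le> K * \<bar>u - w\<bar>" by (intro lip' that)
    then show ?thesis by (simp add: norm_minus_commute abs_minus_commute)
  qed simp
  have "\<exists>l. \<forall>u\<in>{a..b}. u \<noteq> t \<and> \<bar>u - t\<bar> < \<eta> / 2 \<longrightarrow> norm (S t u - l) \<le> K * \<bar>u - t\<bar>" if t: "t \<in> {a..b}" for t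
  proof -
    \<comment> \<open>A nearby point on a side on which the interval extends: to the right unless t
      = b. The sequence \<open>u\<close> then runs from z to t inside the interval.\<close>
    obtain z where z: "z \<in> {a..b}" "z \<noteq> t" "\<bar>z - t\<bar> < \<eta> / 2"
    proof (cases "t < b")
      case True
      show ?thesis by (rule that[of "min b (t + \<eta> / 4)"]) (use True t \<eta> in \<open>auto simp: min_def\<close>)
    next
      case False
      show ?thesis by (rule that[of "max a (t - \<eta> / 4)"]) (use False t \<eta> ab in \<open>auto simp: max_def\<close>)
    qed
    define u where "u n = t + (z - t) * inverse (real (Suc n))" for n
    have inv: "0 < inverse (real (Suc n))" "inverse (real (Suc n)) \<le> 1" for n by (auto simp: inverse_le_1_iff)
    have u: "u n \<in> {a..b}" "u n \<noteq> t" "\<bar>u n - t\<bar> < \<eta> / 2" for n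
    proof -
      show "u n \<noteq> t" using z inv(1)[of n] by (simp add: u_def)
      have "\<bar>u n - t\<bar> = \<bar>z - t\<bar> * inverse (real (Suc n))" by (simp add: u_def abs_mult)
      also have "\<dots> \<le> \<bar>z - t\<bar> * 1" by (intro mult_left_mono inv) auto
      finally show "\<bar>u n - t\<bar> < \<eta> / 2" using z by simp
      have "u n = (1 - inverse (real (Suc n))) *\<^sub>R t + inverse (real (Suc n)) *\<^sub>R z" by (simp add: u_def algebra_simps)
      then show "u n \<in> {a..b}"
        using convexD[of "{a..b}" t z "1 - inverse (real (Suc n))" "inverse (real (Suc n))"] t z inv[of n] by simp
    qed
    have "u \<longlonglongrightarrow> t + (z - t) * 0"
      unfolding u_def[abs_def] by (intro tendsto_intros LIMSEQ_inverse_real_of_nat)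
    then have ut: "u \<longlonglongrightarrow> t" by simp
    have "Cauchy (\<lambda>n. S t (u n))"
    proof (rule metric_CauchyI)
      fix e :: real assume "e > 0"
      then obtain N where N: "\<And>m n. m \<ge> N \<Longrightarrow> n \<ge> N \<Longrightarrow> dist (u m) (u n) < e / K"
        using LIMSEQ_imp_Cauchy[OF ut] metric_CauchyD[of u "e / K"] K by auto
      show "\<exists>N. \<forall>m\<ge>N. \<forall>n\<ge>N. dist (S t (u m)) (S t (u n)) < e"
      proof (intro exI[of _ N] allI impI)
        fix m n assume "N \<le> m" "N \<le> n"
        then have "K * \<bar>u n - u m\<bar> < e" using N[of m n] K by (simp add: dist_real_def pos_less_divide_eq mult.commute abs_minus_commute)
        then show "dist (S t (u m)) (S t (u n)) < e"
          unfolding dist_norm by (rule le_less_trans[OF lip[OF t u(1) u(1) u(2) u(2) u(3) u(3)]])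
      qed
    qed
    then obtain l where l: "(\<lambda>n. S t (u n)) \<longlonglongrightarrow> l" using Cauchy_convergent convergent_def by blast
    have "norm (S t w - l) \<le> K * \<bar>w - t\<bar>" if w: "w \<in> {a..b}" "w \<noteq> t" "\<bar>w - t\<bar> < \<eta> / 2" for w
    proof -
      have "(\<lambda>n. norm (S t w - S t (u n))) \<longlonglongrightarrow> norm (S t w - l)" by (intro tendsto_intros l)
      moreover have "(\<lambda>n. K * \<bar>u n - w\<bar>) \<longlonglongrightarrow> K * \<bar>t - w\<bar>" by (intro tendsto_intros ut)
      ultimately have "norm (S t w - l) \<le> K * \<bar>t - w\<bar>"
        by (rule LIMSEQ_le) (use lip[OF t w(1) u(1) w(2) u(2) w(3) u(3)] in auto)
      then show ?thesis by (simp add: abs_minus_commute)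
    qed
    then show ?thesis by blast
  qed
  then obtain v where v: "\<And>t u. t \<in> {a..b} \<Longrightarrow> u \<in> {a..b} \<Longrightarrow> u \<noteq> t \<Longrightarrow> \<bar>u - t\<bar> < \<eta> / 2 \<Longrightarrow>
      norm (S t u - v t) \<le> K * \<bar>u - t\<bar>" by metis
  have "(\<sigma> has_vector_derivative v t) (at t within {a..b})" if t: "t \<in> {a..b}" for t
    unfolding has_vector_derivative_def
  proof (rule has_derivativeI_sandwich[where e = "\<eta> / 2" and H = "\<lambda>u. K * \<bar>u - t\<bar>"])
    show "((\<lambda>u. K * \<bar>u - t\<bar>) \<longlongrightarrow> 0) (at t within {a..b})" by (auto intro!: tendsto_eq_intros)
    fix u assume u: "u \<in> {a..b}" "u \<noteq> t" "dist u t < \<eta> / 2"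
    have "\<sigma> u - \<sigma> t - (u - t) *\<^sub>R v t = (u - t) *\<^sub>R (S t u - v t)"
      using u by (simp add: S_def scaleR_diff_right)
    then have "norm (\<sigma> u - \<sigma> t - (u - t) *\<^sub>R v t) / norm (u - t) = norm (S t u - v t)" using u by simp
    also have "\<dots> \<le> K * \<bar>u - t\<bar>" using u t by (intro v) (auto simp: dist_real_def)
    finally show "norm (\<sigma> u - \<sigma> t - (u - t) *\<^sub>R v t) / norm (u - t) \<le> K * \<bar>u - t\<bar>" .
  qed (use \<eta> in \<open>auto intro: bounded_linear_scaleR_left\<close>)
  moreover have "continuous_on {a..b} v"
    unfolding continuous_on_def
  proof
    fix t assume t: "t \<in> {a..b}"
    have "\<forall>\<^sub>F u in at t within {a..b}. norm (v u - v t) \<le> 2 * K * \<bar>u - t\<bar>"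
      unfolding eventually_at
    proof (intro exI[of _ "\<eta> / 2"] conjI ballI impI)
      fix u assume u: "u \<in> {a..b}" "u \<noteq> t \<and> dist u t < \<eta> / 2"
      then have "norm (S t u - v t) \<le> K * \<bar>u - t\<bar>" "norm (S u t - v u) \<le> K * \<bar>t - u\<bar>"
        using v[of t u] v[of u t] t by (simp_all add: dist_real_def abs_minus_commute)
      moreover have "norm (v u - v t) \<le> norm (S t u - v t) + norm (S u t - v u)"
        using norm_triangle_ineq4[of "S t u - v t" "S u t - v u"] Ssym[of t u] by simp
      ultimately show "norm (v u - v t) \<le> 2 * K * \<bar>u - t\<bar>" by (simp add: abs_minus_commute)
    qed (use \<eta> in auto)
    moreover have "((\<lambda>u. 2 * K * \<bar>u - t\<bar>) \<longlongrightarrow> 0) (at t within {a..b})" by (auto intro!: tendsto_eq_intros)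
    ultimately have "((\<lambda>u. v u - v t) \<longlongrightarrow> 0) (at t within {a..b})" by (rule Lim_null_comparison)
    then show "(v \<longlongrightarrow> v t) (at t within {a..b})" by (rule LIM_zero_cancel)
  qed
  ultimately show ?thesis by (rule that)
qed

text \<open>Test with the primitive of g = y - B - m, where B is a primitive of \<beta> and the mean
  m makes the test function vanish at \<open>b\<close>. Integration by parts turns the weak equation
  into the vanishing of the integral of |g|^2, so y equals B + m.\<close>

lemma du_Bois_Reymond:
  fixes y \<beta> :: "real \<Rightarrow> 'a::euclidean_space"
  assumes ab: "a < b" and y: "continuous_on {a..b} y" and \<beta>: "continuous_on {a..b} \<beta>"
    and weak: "\<And>\<eta> \<eta>'. (\<And>t. t \<in> {a..b} \<Longrightarrow> (\<eta> has_vector_derivative \<eta>' t) (at t within {a..b})) \<Longrightarrow>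
      continuous_on {a..b} \<eta>' \<Longrightarrow> \<eta> a = 0 \<Longrightarrow> \<eta> b = 0 \<Longrightarrow>
      integral {a..b} (\<lambda>t. \<beta> t \<bullet> \<eta> t + y t \<bullet> \<eta>' t) = 0"
    and t: "t \<in> {a..b}"
  shows "(y has_vector_derivative \<beta> t) (at t within {a..b})"
proof -
  define B where "B t = integral {a..t} \<beta>" for t
  have B: "(B has_vector_derivative \<beta> t) (at t within {a..b})" if "t \<in> {a..b}" for t
    unfolding B_def[abs_def] by (rule integral_has_vector_derivative[OF \<beta> that])
  have cB: "continuous_on {a..b} B"
    using has_vector_derivative_continuous[OF B] by (simp add: continuous_on_eq_continuous_within)
  define m where "m = integral {a..b} (\<lambda>t. y t - B t) /\<^sub>R (b - a)"
  define g where "g t = y t - B t - m" for t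
  have cg: "continuous_on {a..b} g" unfolding g_def[abs_def] by (intro continuous_intros y cB)
  define \<eta> where "\<eta> t = integral {a..t} g" for t
  have \<eta>: "(\<eta> has_vector_derivative g t) (at t within {a..b})" if "t \<in> {a..b}" for t
    unfolding \<eta>_def[abs_def] by (rule integral_has_vector_derivative[OF cg that])
  have c\<eta>: "continuous_on {a..b} \<eta>"
    using has_vector_derivative_continuous[OF \<eta>] by (simp add: continuous_on_eq_continuous_within)
  have \<eta>a: "\<eta> a = 0" by (simp add: \<eta>_def)
  have \<eta>b: "\<eta> b = 0"
  proof -
    have "integral {a..b} g = integral {a..b} (\<lambda>t. y t - B t) - integral {a..b} (\<lambda>t. m)"
      unfolding g_def[abs_def]
      by (intro integral_diff integrable_continuous_real continuous_intros y cB)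
    then show ?thesis using ab by (simp add: \<eta>_def m_def)
  qed
  have "((\<lambda>t. B t \<bullet> \<eta> t) has_vector_derivative (B t \<bullet> g t + \<beta> t \<bullet> \<eta> t)) (at t within {a..b})" if "t \<in> {a..b}" for t
    using bounded_bilinear.has_vector_derivative[OF bounded_bilinear_inner B[OF that] \<eta>[OF that]] .
  then have "((\<lambda>t. B t \<bullet> g t + \<beta> t \<bullet> \<eta> t) has_integral (B b \<bullet> \<eta> b - B a \<bullet> \<eta> a)) {a..b}"
    using ab by (intro fundamental_theorem_of_calculus) auto
  then have i1: "((\<lambda>t. B t \<bullet> g t + \<beta> t \<bullet> \<eta> t) has_integral 0) {a..b}" by (simp add: \<eta>a \<eta>b)
  have "(\<lambda>t. \<beta> t \<bullet> \<eta> t + y t \<bullet> g t) integrable_on {a..b}"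
    by (intro integrable_continuous_real continuous_intros y \<beta> cg c\<eta>)
  with weak[OF \<eta> cg \<eta>a \<eta>b] have i2: "((\<lambda>t. \<beta> t \<bullet> \<eta> t + y t \<bullet> g t) has_integral 0) {a..b}"
    by (simp add: has_integral_iff)
  have "(g has_integral 0) {a..b}"
    using integrable_integral[OF integrable_continuous_real[OF cg]] \<eta>b by (simp add: \<eta>_def)
  from has_integral_linear[OF this bounded_linear_inner_right[of m]]
  have i3: "((\<lambda>t. m \<bullet> g t) has_integral 0) {a..b}" by (simp add: o_def)
  have "((\<lambda>t. g t \<bullet> g t) has_integral 0) {a..b}"
    using has_integral_diff[OF has_integral_diff[OF i2 i1] i3] by (simp add: g_def algebra_simps)
  then have "integral {a..b} (\<lambda>t. g t \<bullet> g t) = 0" by (rule integral_unique)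
  moreover have "continuous_on {a..b} (\<lambda>t. g t \<bullet> g t)" by (intro continuous_intros cg)
  ultimately have g0: "g t = 0" if "t \<in> {a..b}" for t
    using integral_eq_0_iff[of a b "\<lambda>t. g t \<bullet> g t"] ab that by auto
  have "((\<lambda>t. B t + m) has_vector_derivative \<beta> t + 0) (at t within {a..b})"
    by (intro has_vector_derivative_add B t has_vector_derivative_const)
  then have "((\<lambda>t. B t + m) has_vector_derivative \<beta> t) (at t within {a..b})" by simp
  then show ?thesis
    by (rule has_vector_derivative_transform[OF t, rotated]) (use g0 in \<open>auto simp: g_def algebra_simps\<close>)
qed

section \<open>First-order regularity of metric geodesics\<close>

context closed_submanifold
begin

lemma metric_geodesic_norm_le:
  assumes "metric_geodesic a b c \<sigma>" "s \<in> {a..b}" "t \<in> {a..b}"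
  shows "norm (\<sigma> t - \<sigma> s) \<le> c * \<bar>t - s\<bar>"
proof -
  have *: "norm (\<sigma> t - \<sigma> s) \<le> c * (t - s)" if "a \<le> s" "s \<le> t" "t \<le> b" for s t
    using norm_le_d[of "\<sigma> s" "\<sigma> t"] assms(1) that unfolding metric_geodesic_def by (simp add: image_subset_iff)
  then show ?thesis
    using *[of s t] *[of t s] assms(2,3) by (cases "s \<le> t") (auto simp: norm_minus_commute)
qed

lemma metric_geodesic_continuous:
  assumes "metric_geodesic a b c \<sigma>" shows "continuous_on {a..b} \<sigma>"
proof (rule lipschitz_on_continuous_on)
  show "\<bar>c\<bar>-lipschitz_on {a..b} \<sigma>"
  proof (rule lipschitz_onI)
    fix s t assume st: "s \<in> {a..b}" "t \<in> {a..b}"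
    show "dist (\<sigma> s) (\<sigma> t) \<le> \<bar>c\<bar> * dist s t"
      using metric_geodesic_norm_le[OF assms st] mult_right_mono[OF abs_ge_self[of c] abs_ge_zero[of "t - s"]]
      by (simp add: dist_norm norm_minus_commute abs_minus_commute)
  qed simp
qed

text \<open>For consecutive increments p, q over a step h, |p| and |q| are at most c h while |p +
  q|^2 is at least 4 c^2 h^2 - 16 C c^4 h^4; this bounds |p - q|^2 by a multiple of h^4. The same
  two-sided estimate of chords identifies the norm of the derivative.\<close>

lemma metric_geodesic_C1:
  assumes ab: "a < b" and g: "metric_geodesic a b c \<sigma>"
  obtains v where "\<And>t. t \<in> {a..b} \<Longrightarrow> (\<sigma> has_vector_derivative v t) (at t within {a..b})"
    "continuous_on {a..b} v" "\<And>t. t \<in> {a..b} \<Longrightarrow> norm (v t) = c"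
proof -
  obtain \<delta> C where C: "\<delta> > 0" "C \<ge> 0"
    "\<And>x y. x \<in> M \<Longrightarrow> y \<in> M \<Longrightarrow> norm (y - x) < \<delta> \<Longrightarrow> (d x y)\<^sup>2 \<le> norm (y - x) ^ 2 + C * norm (y - x) ^ 4"
    by (rule uniform_estimate) blast
  have gM: "\<sigma> t \<in> M" if "t \<in> {a..b}" for t using g that unfolding metric_geodesic_def by auto
  have gd: "d (\<sigma> s) (\<sigma> t) = c * (t - s)" if "a \<le> s" "s \<le> t" "t \<le> b" for s t
    using g that unfolding metric_geodesic_def by auto
  have c0: "c \<ge> 0"
    using gd[of a b] d_nonneg[OF gM gM, of a b] ab by (simp add: zero_le_mult_iff)
  \<comment> \<open>Two steps shorter than \<eta> move the curve by less than \<delta>, the range of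
    the distance estimate; c + 1 covers c = 0.\<close>
  define \<eta> where "\<eta> = \<delta> / (2 * (c + 1))"
  have eta: "\<eta> > 0" using C(1) c0 by (simp add: \<eta>_def)
  have small: "c * x < \<delta>" if "0 \<le> x" "x < 2 * \<eta>" for x
  proof -
    have "c * x \<le> (c + 1) * x" using that by (simp add: algebra_simps)
    also have "\<dots> < (c + 1) * (2 * \<eta>)" using that c0 by (intro mult_strict_left_mono) auto
    also have "\<dots> = \<delta>" using c0 unfolding \<eta>_def by (simp add: divide_simps)
    finally show ?thesis .
  qed
  have est: "(c * (t - s))\<^sup>2 \<le> (norm (\<sigma> t - \<sigma> s))\<^sup>2 + C * (c * (t - s)) ^ 4"
    if st: "a \<le> s" "s \<le> t" "t \<le> b" "t - s < 2 * \<eta>" for s t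
  proof -
    have n: "norm (\<sigma> t - \<sigma> s) \<le> c * (t - s)" using metric_geodesic_norm_le[OF g, of s t] st by simp
    have "norm (\<sigma> t - \<sigma> s) < \<delta>" using n small[of "t - s"] st by simp
    then have "(c * (t - s))\<^sup>2 \<le> norm (\<sigma> t - \<sigma> s) ^ 2 + C * norm (\<sigma> t - \<sigma> s) ^ 4"
      using C(3)[OF gM gM, of s t] gd[OF st(1-3)] st by simp
    also have "C * norm (\<sigma> t - \<sigma> s) ^ 4 \<le> C * (c * (t - s)) ^ 4"
      by (intro mult_left_mono power_mono n C) auto
    finally show ?thesis by simp
  qed
  \<comment> \<open>4 sqrt C c^2 is the square root of the coefficient 16 C c^4 found below; adding
    1 keeps \<open>K\<close> positive when C or c vanishes.\<close>
  define K where "K = 4 * sqrt C * c\<^sup>2 + 1"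
  have K: "K > 0" using C(2) by (simp add: K_def add_nonneg_pos)
  have sd: "norm (\<sigma> (t + h) + \<sigma> (t - h) - 2 *\<^sub>R \<sigma> t) \<le> K * h\<^sup>2"
    if h: "0 < h" "h < \<eta>" "a \<le> t - h" "t + h \<le> b" for t h
  proof -
    define p where "p = \<sigma> (t + h) - \<sigma> t"
    define q where "q = \<sigma> t - \<sigma> (t - h)"
    have p: "(norm p)\<^sup>2 \<le> (c * h)\<^sup>2" and q: "(norm q)\<^sup>2 \<le> (c * h)\<^sup>2"
      using metric_geodesic_norm_le[OF g, of t "t + h"] metric_geodesic_norm_le[OF g, of "t - h" t] h
      by (auto simp: p_def q_def intro!: power_mono)
    have "(c * (2 * h))\<^sup>2 \<le> (norm (p + q))\<^sup>2 + C * (c * (2 * h)) ^ 4"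
      using est[of "t - h" "t + h"] h by (simp add: p_def q_def)
    moreover have "(norm (p - q))\<^sup>2 = 2 * (norm p)\<^sup>2 + 2 * (norm q)\<^sup>2 - (norm (p + q))\<^sup>2"
      by (simp add: power2_norm_eq_inner inner_diff_left inner_diff_right inner_add_left inner_add_right)
    moreover have "(c * (2 * h))\<^sup>2 = 4 * (c * h)\<^sup>2" by (simp add: power_mult_distrib)
    moreover have "C * (c * (2 * h)) ^ 4 = 16 * (C * (c * h) ^ 4)" by (simp add: power_mult_distrib)
    ultimately have "(norm (p - q))\<^sup>2 \<le> 16 * (C * (c * h) ^ 4)" using p q by linarith
    also have "\<dots> = (4 * sqrt C * (c * h)\<^sup>2)\<^sup>2"
      using C(2) by (simp add: power_mult_distrib flip: power_mult)
    finally have "norm (p - q) \<le> 4 * sqrt C * (c * h)\<^sup>2"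
      by (rule power2_le_imp_le) (use C(2) in auto)
    also have "\<dots> \<le> K * h\<^sup>2" by (simp add: K_def power_mult_distrib algebra_simps)
    also have "p - q = \<sigma> (t + h) + \<sigma> (t - h) - 2 *\<^sub>R \<sigma> t" by (simp add: p_def q_def algebra_simps scaleR_2)
    finally show ?thesis .
  qed
  obtain v where v: "\<And>t. t \<in> {a..b} \<Longrightarrow> (\<sigma> has_vector_derivative v t) (at t within {a..b})"
    "continuous_on {a..b} v"
    using second_difference_imp_C1[OF ab metric_geodesic_continuous[OF g] K eta sd] by blast
  have "norm (v t) = c" if t: "t \<in> {a..b}" for t
  proof -
    have nt: "at t within {a..b} \<noteq> bot" using ab t by (simp add: trivial_limit_within islimpt_Icc)
    have S: "((\<lambda>u. (\<sigma> u - \<sigma> t) /\<^sub>R (u - t)) \<longlongrightarrow> v t) (at t within {a..b})"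
    proof (rule LIM_zero_cancel, rule Lim_null_comparison)
      show "((\<lambda>u. norm (\<sigma> u - \<sigma> t - (u - t) *\<^sub>R v t) / norm (u - t)) \<longlongrightarrow> 0) (at t within {a..b})"
        using v(1)[OF t] by (simp add: has_vector_derivative_def has_derivative_iff_norm)
      have "norm ((\<sigma> u - \<sigma> t) /\<^sub>R (u - t) - v t) \<le> norm (\<sigma> u - \<sigma> t - (u - t) *\<^sub>R v t) / norm (u - t)"
        if "u \<noteq> t" for u
      proof -
        have "(\<sigma> u - \<sigma> t) /\<^sub>R (u - t) - v t = (\<sigma> u - \<sigma> t - (u - t) *\<^sub>R v t) /\<^sub>R (u - t)"
          using that by (simp add: scaleR_diff_right)
        then show ?thesis by (simp add: divide_inverse mult.commute)
      qed
      then show "\<forall>\<^sub>F u in at t within {a..b}. norm ((\<sigma> u - \<sigma> t) /\<^sub>R (u - t) - v t)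
          \<le> norm (\<sigma> u - \<sigma> t - (u - t) *\<^sub>R v t) / norm (u - t)"
        unfolding eventually_at by (intro exI[of _ 1]) auto
    qed
    define s where "s u = norm ((\<sigma> u - \<sigma> t) /\<^sub>R (u - t))" for u
    have s: "(s \<longlongrightarrow> norm (v t)) (at t within {a..b})" unfolding s_def[abs_def] by (rule tendsto_norm[OF S])
    \<comment> \<open>The quotient is squeezed: the Euclidean chord is at most \<open>d\<close>, and
      \<open>d\<close> exceeds it only by the fourth-order term, which after division by the squared
      step vanishes in the limit.\<close>
    have bd: "s u \<le> c \<and> c\<^sup>2 \<le> (s u)\<^sup>2 + C * c ^ 4 * (u - t)\<^sup>2"
      if u: "u \<in> {a..b}" "u \<noteq> t" "\<bar>u - t\<bar> < \<eta>" for u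
    proof -
      let ?n = "norm (\<sigma> u - \<sigma> t)" and ?h = "\<bar>u - t\<bar>"
      have h: "?h > 0" using u by simp
      have su: "s u = ?n / ?h" by (simp add: s_def divide_inverse mult.commute)
      have "s u \<le> c" unfolding su using metric_geodesic_norm_le[OF g t u(1)] h by (simp add: pos_divide_le_eq)
      have "(c * ?h)\<^sup>2 \<le> ?n\<^sup>2 + C * (c * ?h) ^ 4"
        using est[of t u] est[of u t] u t eta by (cases "t \<le> u") (auto simp: norm_minus_commute)
      then have "(c * ?h)\<^sup>2 / ?h\<^sup>2 \<le> (?n\<^sup>2 + C * (c * ?h) ^ 4) / ?h\<^sup>2" by (intro divide_right_mono) auto
      also have "(c * ?h)\<^sup>2 / ?h\<^sup>2 = c\<^sup>2" using h by (simp add: power_mult_distrib)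
      also have "(?n\<^sup>2 + C * (c * ?h) ^ 4) / ?h\<^sup>2 = (s u)\<^sup>2 + C * c ^ 4 * ?h\<^sup>2"
      proof -
        have "C * (c * ?h) ^ 4 = C * c ^ 4 * ?h\<^sup>2 * ?h\<^sup>2"
          unfolding power_mult_distrib by (simp add: power2_eq_square eval_nat_numeral)
        then have "C * (c * ?h) ^ 4 / ?h\<^sup>2 = C * c ^ 4 * ?h\<^sup>2" using h by (simp only:) simp
        then show ?thesis unfolding add_divide_distrib su power_divide by (simp only:)
      qed
      finally show ?thesis using \<open>s u \<le> c\<close> by simp
    qed
    have ev: "\<forall>\<^sub>F u in at t within {a..b}. s u \<le> c \<and> c\<^sup>2 \<le> (s u)\<^sup>2 + C * c ^ 4 * (u - t)\<^sup>2"
      unfolding eventually_at using bd eta by (intro exI[of _ \<eta>]) (auto simp: dist_real_def)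
    have "norm (v t) \<le> c"
      by (rule tendsto_upperbound[OF s _ nt]) (use ev in eventually_elim, blast)
    moreover have "c\<^sup>2 \<le> (norm (v t))\<^sup>2 + C * c ^ 4 * (t - t)\<^sup>2"
    proof (rule tendsto_lowerbound[OF _ _ nt])
      show "((\<lambda>u. (s u)\<^sup>2 + C * c ^ 4 * (u - t)\<^sup>2) \<longlongrightarrow> (norm (v t))\<^sup>2 + C * c ^ 4 * (t - t)\<^sup>2) (at t within {a..b})"
        by (intro tendsto_intros s)
      show "\<forall>\<^sub>F u in at t within {a..b}. c\<^sup>2 \<le> (s u)\<^sup>2 + C * c ^ 4 * (u - t)\<^sup>2"
        using ev by eventually_elim blast
    qed
    then have "c\<^sup>2 \<le> (norm (v t))\<^sup>2" by simp
    then have "c \<le> norm (v t)" by (rule power2_le_imp_le) simp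
    ultimately show ?thesis by simp
  qed
  then show ?thesis using that v by blast
qed

end

section \<open>The geodesic equation\<close>

lemma smooth_on_chain:
  assumes "smooth_on W f" "open W" and \<gamma>: "(\<gamma> has_vector_derivative w) (at t within S)" and "\<gamma> t \<in> W"
  shows "((\<lambda>s. f (\<gamma> s)) has_vector_derivative frechet_derivative f (at (\<gamma> t)) w) (at t within S)"
proof -
  have "((\<lambda>s. f (\<gamma> s)) has_derivative (\<lambda>h. frechet_derivative f (at (\<gamma> t)) (h *\<^sub>R w))) (at t within S)"
    using has_derivative_compose[OF \<gamma>[unfolded has_vector_derivative_def] smooth_on_has_derivative[OF assms(1,2,4)]] .
  then show ?thesis
    using linear_cmul[OF smooth_on_linear[OF assms(1,2,4)]] by (simp add: has_vector_derivative_def)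
qed

lemma continuous_on_frechet_derivative:
  assumes "smooth_on W f" "open W" "continuous_on S p" "continuous_on S k" "p ` S \<subseteq> W"
  shows "continuous_on S (\<lambda>s. frechet_derivative f (at (p s)) (k s))"
proof -
  have "continuous_on S (\<lambda>s. (\<lambda>(x, v). frechet_derivative f (at x) v) (p s, k s))"
    by (rule continuous_on_compose2[OF smooth_on_continuous_on[OF smooth_on_derivative_eval[OF assms(2,1)]]])
       (use assms in \<open>auto intro!: continuous_intros\<close>)
  then show ?thesis by simp
qed

text \<open>Since the derivative \<open>P\<close> of a local retraction at a point of \<open>M\<close> is a projection onto the tangent
  space, \<open>v = P v\<close> and \<open>a \<bottom> range P\<close> determine the acceleration \<open>a\<close> through
  \<open>(I - P + P\<^sup>T) a = D\<^sup>2 r (v, v)\<close>, and \<open>I - P + P\<^sup>T\<close> is invertible because \<open>P\<^sup>T - P\<close> is skew.\<close>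

definition retraction_op :: "('a::euclidean_space \<Rightarrow> 'a) \<Rightarrow> 'a \<Rightarrow> 'a \<Rightarrow> 'a" where
  "retraction_op r x w = w - frechet_derivative r (at x) w
     + (\<Sum>b\<in>Basis. (w \<bullet> frechet_derivative r (at x) b) *\<^sub>R b)"

definition derivative_eval :: "('a::euclidean_space \<Rightarrow> 'a) \<Rightarrow> 'a \<times> 'a \<Rightarrow> 'a" where
  "derivative_eval r z = frechet_derivative r (at (fst z)) (snd z)"

text \<open>The geodesic equation as an autonomous first-order system for position and velocity.
  Differentiating \<open>derivative_eval r\<close> in the base point along the velocity itself
  produces D^2 r (v, v).\<close>

definition geodesic_spray :: "('a::euclidean_space \<Rightarrow> 'a) \<Rightarrow> 'a \<times> 'a \<Rightarrow> 'a \<times> 'a" where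
  "geodesic_spray r z = (snd z, smooth_expanding_family.Op_inv (retraction_op r) (fst z)
     (frechet_derivative (derivative_eval r) (at z) (snd z, 0)))"

section \<open>The geodesic equation attached to a retraction\<close>

context
  fixes M U :: "'a::euclidean_space set" and r :: "'a \<Rightarrow> 'a"
  assumes ret: "local_retraction M U r"
begin

private lemmas oU = open_U[OF ret] and sr = smooth_r[OF ret]

text \<open>P and its transpose contribute equally to the inner product with v, so (I - P + P^T) v .
  v = |v|^2 and Cauchy-Schwarz gives expansion. The argument is valid for any linear P, hence on all
  of \<open>U\<close> and not only on \<open>M\<close>.\<close>

lemma retraction_op_family: "smooth_expanding_family U (retraction_op r)"
proof (rule smooth_expanding_family.intro)
  show "open U" by (rule oU)
  fix v
  have "smooth_on U (\<lambda>x. v + (- 1) *\<^sub>R frechet_derivative r (at x) v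
      + (\<Sum>b\<in>Basis. (v \<bullet> frechet_derivative r (at x) b) *\<^sub>R b))"
    by (rule smooth_on_add[OF oU smooth_on_add[OF oU smooth_on_const[OF oU]
            smooth_on_scaleR[OF oU smooth_on_const[OF oU] smooth_on_Suc[OF sr]]]
          smooth_on_sum[OF oU finite_Basis smooth_on_scaleR[OF oU smooth_on_inner[OF oU smooth_on_const[OF oU] smooth_on_Suc[OF sr]]
            smooth_on_const[OF oU]]]])
  then show "smooth_on U (\<lambda>x. retraction_op r x v)" by (simp add: retraction_op_def)
next
  fix x assume x: "x \<in> U"
  note lin = smooth_on_linear[OF sr oU x]
  show "linear (retraction_op r x)"
    by (rule linearI)
       (simp_all add: retraction_op_def linear_add[OF lin] linear_cmul[OF lin] inner_add_left scaleR_add_left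
         sum.distrib scaleR_diff_right scaleR_add_right scaleR_sum_right)
  fix v
  have "frechet_derivative r (at x) v \<bullet> v = (\<Sum>b\<in>Basis. (v \<bullet> b) * (frechet_derivative r (at x) b \<bullet> v))"
    by (subst linear_eq_sum_Basis[OF lin]) (simp add: inner_sum_left)
  also have "\<dots> = (\<Sum>b\<in>Basis. (v \<bullet> frechet_derivative r (at x) b) *\<^sub>R b) \<bullet> v"
    unfolding inner_sum_left inner_scaleR_left by (intro sum.cong refl) (simp add: inner_commute)
  finally have "retraction_op r x v \<bullet> v = v \<bullet> v"
    by (simp add: retraction_op_def inner_add_left inner_diff_left)
  then have "(norm v)\<^sup>2 \<le> norm (retraction_op r x v) * norm v"
    using norm_cauchy_schwarz[of "retraction_op r x v" v] by (simp add: power2_norm_eq_inner)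
  then show "norm v \<le> norm (retraction_op r x v)"
    by (cases "v = 0") (simp_all add: power2_eq_square)
qed

interpretation fam: smooth_expanding_family U "retraction_op r" by (rule retraction_op_family)

private lemma oW: "open (U \<times> (UNIV :: 'a set))" using oU by (simp add: open_Times)

lemma smooth_derivative_eval: "smooth_on (U \<times> UNIV) (derivative_eval r)"
proof -
  have "derivative_eval r = (\<lambda>(x, v). frechet_derivative r (at x) v)"
    by (auto simp: derivative_eval_def)
  then show ?thesis using smooth_on_derivative_eval[OF oU sr] by simp
qed

private lemmas sQ = smooth_derivative_eval

lemma smooth_geodesic_spray: "smooth_on (U \<times> UNIV) (geodesic_spray r)"
proof -
  let ?Q = "derivative_eval r"
  have snd: "smooth_on (U \<times> UNIV) (snd :: 'a \<times> 'a \<Rightarrow> 'a)"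
    using smooth_on_bounded_linear[OF bounded_linear_snd oW smooth_on_id[OF oW]] by simp
  have fst: "smooth_on (U \<times> UNIV) (fst :: 'a \<times> 'a \<Rightarrow> 'a)"
    using smooth_on_bounded_linear[OF bounded_linear_fst oW smooth_on_id[OF oW]] by simp
  have G: "smooth_on (U \<times> UNIV) (\<lambda>z. \<Sum>b\<in>Basis. (snd z \<bullet> b) *\<^sub>R frechet_derivative ?Q (at z) (b, 0))"
    by (rule smooth_on_sum[OF oW finite_Basis smooth_on_scaleR[OF oW smooth_on_inner[OF oW snd smooth_on_const[OF oW]]
          smooth_on_Suc[OF sQ]]])
  have inv: "smooth_on (U \<times> UNIV) (\<lambda>z :: 'a \<times> 'a. fam.Op_inv (fst z) e)" for e
    by (rule smooth_on_compose[OF oW oU _ fst fam.smooth_on_Op_inv]) auto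
  have "smooth_on (U \<times> UNIV) (\<lambda>z. (snd z, \<Sum>e\<in>Basis.
      ((\<Sum>b\<in>Basis. (snd z \<bullet> b) *\<^sub>R frechet_derivative ?Q (at z) (b, 0)) \<bullet> e) *\<^sub>R fam.Op_inv (fst z) e))"
    by (rule smooth_on_Pair[OF oW snd smooth_on_sum[OF oW finite_Basis
          smooth_on_scaleR[OF oW smooth_on_inner[OF oW G smooth_on_const[OF oW]] inv]]])
  then show ?thesis
  proof (rule smooth_on_cong[OF oW, rotated])
    fix z :: "'a \<times> 'a" assume z: "z \<in> U \<times> UNIV"
    have lQ: "linear (frechet_derivative ?Q (at z))" by (rule smooth_on_linear[OF sQ oW z])
    have l1: "linear (\<lambda>h. frechet_derivative ?Q (at z) (h, 0))"
      by (rule linearI) (metis (no_types) lQ linear_add linear_cmul add_Pair scaleR_Pair add_0 scaleR_zero_right)+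
    have l2: "linear (fam.Op_inv (fst z))" using z by (intro fam.linear_Op_inv) auto
    show "(snd z, \<Sum>e\<in>Basis.
      ((\<Sum>b\<in>Basis. (snd z \<bullet> b) *\<^sub>R frechet_derivative ?Q (at z) (b, 0)) \<bullet> e) *\<^sub>R fam.Op_inv (fst z) e) = geodesic_spray r z"
      unfolding geodesic_spray_def
      by (simp only: linear_eq_sum_Basis[OF l1, of "snd z", symmetric] linear_eq_sum_Basis[OF l2, symmetric])
  qed
qed

lemma derivative_eval_partial_snd:
  assumes "x \<in> U" shows "frechet_derivative (derivative_eval r) (at (x, w)) (0, e) = frechet_derivative r (at x) e"
proof -
  have "((\<lambda>v. derivative_eval r (x, v)) has_derivative (\<lambda>h. frechet_derivative (derivative_eval r) (at (x, w)) (0, h))) (at w)"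
    by (rule has_derivative_compose[OF _ smooth_on_has_derivative[OF sQ oW]])
       (use assms in \<open>auto intro!: derivative_eq_intros\<close>)
  moreover have "((\<lambda>v. derivative_eval r (x, v)) has_derivative frechet_derivative r (at x)) (at w)"
    unfolding derivative_eval_def fst_conv snd_conv
    using smooth_on_linear[OF sr oU assms] by (simp add: linear_imp_has_derivative)
  ultimately show ?thesis using has_derivative_unique by metis
qed

lemma derivative_eval_partial_fst:
  assumes "x \<in> U"
  shows "frechet_derivative (\<lambda>y. frechet_derivative r (at y) w) (at x) h
    = frechet_derivative (derivative_eval r) (at (x, w)) (h, 0)"
proof -
  have "((\<lambda>y. derivative_eval r (y, w)) has_derivative (\<lambda>h. frechet_derivative (derivative_eval r) (at (x, w)) (h, 0))) (at x)"
    by (rule has_derivative_compose[OF _ smooth_on_has_derivative[OF sQ oW]])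
       (use assms in \<open>auto intro!: derivative_eq_intros\<close>)
  from frechet_derivative_at[OF this] show ?thesis by (simp add: derivative_eval_def[abs_def] fun_eq_iff)
qed

text \<open>Symmetry of the second derivative of r, in the phase-space form in which D^2 r enters
  the spray.\<close>

lemma derivative_eval_symmetric:
  assumes "x \<in> U"
  shows "frechet_derivative (derivative_eval r) (at (x, w)) (h, 0) = frechet_derivative (derivative_eval r) (at (x, h)) (w, 0)"
  using second_derivative_symmetric[OF oU sr assms, of w h] by (simp add: derivative_eval_partial_fst[OF assms])

text \<open>The base-point part is the second derivative of r; the velocity part is the derivative
  of r itself, by linearity in the velocity.\<close>

lemma derivative_eval_split:
  assumes "x \<in> U"
  shows "frechet_derivative (derivative_eval r) (at (x, w)) (h, e)
    = frechet_derivative (derivative_eval r) (at (x, w)) (h, 0) + frechet_derivative r (at x) e"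
proof -
  have "linear (frechet_derivative (derivative_eval r) (at (x, w)))"
    using assms by (intro smooth_on_linear[OF sQ oW]) auto
  from linear_add[OF this, of "(h, 0)" "(0, e)"] show ?thesis
    by (simp add: derivative_eval_partial_snd[OF assms])
qed

text \<open>Differentiating v = P v along the curve gives A = D^2 r (v, v) + P A, and normality
  removes the transposed term from \<open>retraction_op\<close>; thus A is the solution that the
  spray selects.\<close>

lemma geodesic_spray_solution:
  assumes ab: "a < b" and M: "\<sigma> ` {a..b} \<subseteq> M" and U: "\<And>s. s \<in> {a..b} \<Longrightarrow> \<sigma> s \<in> U"
    and v: "\<And>s. s \<in> {a..b} \<Longrightarrow> (\<sigma> has_vector_derivative v s) (at s within {a..b})"
    and t: "t \<in> {a..b}" and A: "(v has_vector_derivative A) (at t within {a..b})"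
    and normal: "\<And>e. A \<bullet> frechet_derivative r (at (\<sigma> t)) e = 0"
  shows "((\<lambda>s. (\<sigma> s, v s)) has_vector_derivative geodesic_spray r (\<sigma> t, v t)) (at t within {a..b})"
proof -
  let ?Q = "derivative_eval r"
  have P: "((\<lambda>s. (\<sigma> s, v s)) has_vector_derivative (v t, A)) (at t within {a..b})"
    by (rule has_vector_derivative_Pair[OF v[OF t] A])
  have "((\<lambda>s. ?Q (\<sigma> s, v s)) has_vector_derivative frechet_derivative ?Q (at (\<sigma> t, v t)) (v t, A)) (at t within {a..b})"
    by (rule smooth_on_chain[OF sQ oW P]) (use U[OF t] in auto)
  then have "(v has_vector_derivative frechet_derivative ?Q (at (\<sigma> t, v t)) (v t, A)) (at t within {a..b})"
  proof (rule has_vector_derivative_transform[OF t, rotated])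
    fix s assume s: "s \<in> {a..b}"
    show "v s = ?Q (\<sigma> s, v s)"
      using retraction_fixes_velocity[OF ret v[OF s] ab s U[OF s] M] by (simp add: derivative_eval_def)
  qed
  from velocity_eq[OF this ab t] velocity_eq[OF A ab t]
  have "frechet_derivative ?Q (at (\<sigma> t, v t)) (v t, 0) + frechet_derivative r (at (\<sigma> t)) A = A"
    unfolding derivative_eval_split[OF U[OF t], of "v t" "v t" A, symmetric] by (rule trans[OF sym])
  then have "A - frechet_derivative r (at (\<sigma> t)) A = frechet_derivative ?Q (at (\<sigma> t, v t)) (v t, 0)"
    by (metis add_diff_cancel_right')
  then have "retraction_op r (\<sigma> t) A = frechet_derivative ?Q (at (\<sigma> t, v t)) (v t, 0)"
    by (simp add: retraction_op_def normal)
  then have "geodesic_spray r (\<sigma> t, v t) = (v t, A)"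
    using fam.Op_inv_Op[OF U[OF t], of A] by (simp add: geodesic_spray_def)
  then show ?thesis using P by simp
qed

end

section \<open>First variation of the energy\<close>

context closed_submanifold
begin

text \<open>Admits C1 curves as competitors, beyond the piecewise smooth ones in the definition of
  \<open>geodesic_dist\<close>; the variations below are of this class.\<close>

lemma d_le_integral_speed:
  assumes ab: "a \<le> b" and M: "F ` {a..b} \<subseteq> M"
    and w: "\<And>t. t \<in> {a..b} \<Longrightarrow> (F has_vector_derivative w t) (at t within {a..b})"
    and cw: "continuous_on {a..b} w"
  shows "d (F a) (F b) \<le> integral {a..b} (\<lambda>t. norm (w t))"
proof -
  define \<Lambda> where "\<Lambda> s = integral {a..s} (\<lambda>t. norm (w t))" for s
  have cn: "continuous_on {a..b} (\<lambda>t. norm (w t))" by (intro continuous_intros cw)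
  have "d (F a) (F b) \<le> \<Lambda> b - \<Lambda> a"
  proof (rule d_le_variation[OF ab _ M])
    show "continuous_on {a..b} F"
      using has_vector_derivative_continuous[OF w] by (simp add: continuous_on_eq_continuous_within)
    fix p q assume pq: "a \<le> p" "p \<le> q" "q \<le> b"
    have int: "(\<lambda>t. norm (w t)) integrable_on {p..q}" "(\<lambda>t. norm (w t)) integrable_on {a..q}"
      by (rule integrable_continuous_real, rule continuous_on_subset[OF cn], use pq in auto)+
    have "(w has_integral (F q - F p)) {p..q}"
      using pq by (intro fundamental_theorem_of_calculus has_vector_derivative_within_subset[OF w]) auto
    then have "norm (F q - F p) \<le> integral {p..q} (\<lambda>t. norm (w t))"
      using integral_norm_bound_integral[OF _ int(1), of w] by (auto simp: has_integral_iff)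
    also have "\<dots> = \<Lambda> q - \<Lambda> p"
      using Henstock_Kurzweil_Integration.integral_combine[OF pq(1,2) int(2)] by (simp add: \<Lambda>_def)
    finally show "norm (F q - F p) \<le> \<Lambda> q - \<Lambda> p" .
  qed
  then show ?thesis by (simp add: \<Lambda>_def)
qed

text \<open>By Cauchy-Schwarz every variation with fixed end points has energy at least d^2 / (b -
  a), which a metric geodesic attains. So \<tau> = 0 minimises the energy of r (\<sigma> + \<tau>
  \<eta>), and the derivative, computed under the integral sign, vanishes there.\<close>

lemma first_variation:
  assumes ret: "local_retraction M U r" and ab: "a < b" and g: "metric_geodesic a b c \<sigma>"
    and U: "\<And>s. s \<in> {a..b} \<Longrightarrow> \<sigma> s \<in> U"
    and v: "\<And>s. s \<in> {a..b} \<Longrightarrow> (\<sigma> has_vector_derivative v s) (at s within {a..b})"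
    and cv: "continuous_on {a..b} v" and nv: "\<And>t. t \<in> {a..b} \<Longrightarrow> norm (v t) = c"
    and \<eta>: "\<And>t. t \<in> {a..b} \<Longrightarrow> (\<eta> has_vector_derivative \<eta>' t) (at t within {a..b})"
    and c\<eta>': "continuous_on {a..b} \<eta>'" and \<eta>0: "\<eta> a = 0" "\<eta> b = 0"
  shows "integral {a..b} (\<lambda>t. v t \<bullet> frechet_derivative (derivative_eval r) (at (\<sigma> t, v t)) (\<eta> t, \<eta>' t)) = 0"
proof -
  note oU = open_U[OF ret] and sr = smooth_r[OF ret] and sQ = smooth_derivative_eval[OF ret]
  let ?Q = "derivative_eval r"
  have oW: "open (U \<times> (UNIV :: 'a set))" using oU by (simp add: open_Times)
  have gM: "\<sigma> ` {a..b} \<subseteq> M" and gd: "d (\<sigma> a) (\<sigma> b) = c * (b - a)"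
    using g ab unfolding metric_geodesic_def by auto
  have c0: "c \<ge> 0" using nv[of a] ab norm_ge_zero[of "v a"] by simp
  have c\<sigma>: "continuous_on {a..b} \<sigma>" by (rule metric_geodesic_continuous[OF g])
  have c\<eta>: "continuous_on {a..b} \<eta>"
    using has_vector_derivative_continuous[OF \<eta>] by (simp add: continuous_on_eq_continuous_within)
  have "compact (\<sigma> ` {a..b})" by (rule compact_continuous_image[OF c\<sigma>]) simp
  then obtain e where e: "e > 0" "(\<Union>x\<in>\<sigma> ` {a..b}. ball x e) \<subseteq> U"
    using compact_subset_open_imp_ball_epsilon_subset[OF _ oU] U by blast
  have "bounded (\<eta> ` {a..b})" by (intro compact_imp_bounded compact_continuous_image c\<eta>) simp
  then obtain B where B: "B > 0" "\<And>t. t \<in> {a..b} \<Longrightarrow> norm (\<eta> t) \<le> B" unfolding bounded_pos by auto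
  \<comment> \<open>For |\<tau>| < e / B the perturbed curve stays in the e-neighbourhood of the
    original, which lies in the domain of r.\<close>
  define \<tau>0 where "\<tau>0 = e / B"
  have \<tau>0: "\<tau>0 > 0" using e B by (simp add: \<tau>0_def)
  define I where "I = {-\<tau>0<..<\<tau>0}"
  have inU: "\<sigma> t + \<tau> *\<^sub>R \<eta> t \<in> U" if "\<tau> \<in> I" "t \<in> {a..b}" for \<tau> t
  proof -
    have "norm (\<tau> *\<^sub>R \<eta> t) \<le> \<bar>\<tau>\<bar> * B" using B(2)[OF that(2)] by (simp add: mult_left_mono)
    also have "\<dots> < \<tau>0 * B" using that(1) B(1) by (intro mult_strict_right_mono) (auto simp: I_def)
    also have "\<dots> = e" using B(1) by (simp add: \<tau>0_def)
    finally have "\<sigma> t + \<tau> *\<^sub>R \<eta> t \<in> ball (\<sigma> t) e" by (simp add: dist_norm)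
    then show ?thesis using e(2) that(2) by blast
  qed
  define z where "z \<tau> t = (\<sigma> t + \<tau> *\<^sub>R \<eta> t, v t + \<tau> *\<^sub>R \<eta>' t)" for \<tau> t
  define \<zeta> where "\<zeta> t = (\<eta> t, \<eta>' t)" for t
  have zW: "z \<tau> t \<in> U \<times> UNIV" if "\<tau> \<in> I" "t \<in> {a..b}" for \<tau> t using inU[OF that] by (simp add: z_def)
  define f where "f \<tau> t = ?Q (z \<tau> t) \<bullet> ?Q (z \<tau> t)" for \<tau> t
  define fx where "fx \<tau> t = 2 * (?Q (z \<tau> t) \<bullet> frechet_derivative ?Q (at (z \<tau> t)) (\<zeta> t))" for \<tau> t
  define E where "E \<tau> = integral (cbox a b) (f \<tau>)" for \<tau>
  have cz: "continuous_on (I \<times> {a..b}) (\<lambda>p. z (fst p) (snd p))"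
    unfolding z_def
    by (intro continuous_intros continuous_on_compose2[OF c\<sigma>] continuous_on_compose2[OF c\<eta>]
        continuous_on_compose2[OF cv] continuous_on_compose2[OF c\<eta>']) auto
  have c\<zeta>: "continuous_on (I \<times> {a..b}) (\<lambda>p. \<zeta> (snd p))"
    unfolding \<zeta>_def by (intro continuous_intros continuous_on_compose2[OF c\<eta>] continuous_on_compose2[OF c\<eta>']) auto
  have zsub: "(\<lambda>p. z (fst p) (snd p)) ` (I \<times> {a..b}) \<subseteq> U \<times> UNIV" using inU by (auto simp: z_def)
  have cQz: "continuous_on (I \<times> {a..b}) (\<lambda>p. ?Q (z (fst p) (snd p)))"
    by (rule continuous_on_compose2[OF smooth_on_continuous_on[OF sQ] cz zsub])
  have cQ: "continuous_on {a..b} (\<lambda>t. ?Q (z \<tau> t))" if "\<tau> \<in> I" for \<tau>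
  proof -
    have "continuous_on {a..b} (\<lambda>t. (\<tau>, t))" by (rule continuous_on_Pair[OF continuous_on_const continuous_on_id])
    from continuous_on_compose2[OF cQz this] that show ?thesis by auto
  qed
  have DE0: "(E has_field_derivative integral (cbox a b) (fx 0)) (at 0 within I)"
    unfolding E_def[abs_def]
  proof (rule leibniz_rule_field_derivative)
    fix \<tau> t assume \<tau>: "\<tau> \<in> I" and t: "t \<in> cbox a b"
    have "((\<lambda>\<tau>. z \<tau> t) has_vector_derivative \<zeta> t) (at \<tau> within I)"
      unfolding z_def \<zeta>_def by (intro has_vector_derivative_Pair) (auto intro!: derivative_eq_intros)
    from smooth_on_chain[OF sQ oW this] zW \<tau> t
    have "((\<lambda>\<tau>. ?Q (z \<tau> t)) has_vector_derivative frechet_derivative ?Q (at (z \<tau> t)) (\<zeta> t)) (at \<tau> within I)" by simp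
    from bounded_bilinear.has_vector_derivative[OF bounded_bilinear_inner this this]
    show "((\<lambda>\<tau>. f \<tau> t) has_field_derivative fx \<tau> t) (at \<tau> within I)"
      unfolding f_def fx_def has_real_derivative_iff_has_vector_derivative by (simp add: inner_commute)
  next
    fix \<tau> assume "\<tau> \<in> I"
    then show "f \<tau> integrable_on cbox a b"
      unfolding f_def[abs_def] cbox_interval by (intro integrable_continuous_real continuous_intros cQ)
  next
    show "continuous_on (I \<times> cbox a b) (\<lambda>(\<tau>, t). fx \<tau> t)"
      unfolding fx_def case_prod_beta cbox_interval
      by (intro continuous_intros cQz continuous_on_frechet_derivative[OF sQ oW cz c\<zeta> zsub])
  qed (use \<tau>0 in \<open>auto simp: I_def\<close>)
  have "at (0::real) within I = at 0" using \<tau>0 unfolding I_def by (intro at_within_open) auto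
  note DE = DE0[unfolded this]
  have I0: "0 \<in> I" using \<tau>0 by (simp add: I_def)
  have Q0: "?Q (z 0 t) = v t" if t: "t \<in> {a..b}" for t
    using retraction_fixes_velocity[OF ret v[OF t] ab t U[OF t] gM] by (simp add: z_def derivative_eval_def)
  have E0: "E 0 = c\<^sup>2 * (b - a)"
  proof -
    have "E 0 = integral {a..b} (\<lambda>t. c\<^sup>2)"
      unfolding E_def cbox_interval
      by (rule integral_cong) (simp add: f_def Q0 nv flip: power2_norm_eq_inner)
    then show ?thesis using ab by simp
  qed
  have Emin: "E 0 \<le> E \<tau>" if \<tau>: "\<tau> \<in> I" for \<tau>
  proof -
    let ?F = "\<lambda>t. r (\<sigma> t + \<tau> *\<^sub>R \<eta> t)"
    have "d (?F a) (?F b) \<le> integral {a..b} (\<lambda>t. norm (?Q (z \<tau> t)))"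
    proof (rule d_le_integral_speed)
      show "?F ` {a..b} \<subseteq> M" using r_in[OF ret] inU[OF \<tau>] by auto
      fix t assume t: "t \<in> {a..b}"
      have "((\<lambda>t. \<sigma> t + \<tau> *\<^sub>R \<eta> t) has_vector_derivative v t + \<tau> *\<^sub>R \<eta>' t) (at t within {a..b})"
        by (intro has_vector_derivative_add v[OF t] bounded_linear.has_vector_derivative[OF bounded_linear_scaleR_right] \<eta>[OF t])
      from smooth_on_chain[OF sr oU this inU[OF \<tau> t]]
      show "(?F has_vector_derivative ?Q (z \<tau> t)) (at t within {a..b})"
        by (simp add: z_def derivative_eval_def)
    qed (use ab cQ[OF \<tau>] in auto)
    moreover have "\<sigma> a \<in> M" "\<sigma> b \<in> M" "\<sigma> a \<in> U" "\<sigma> b \<in> U" using gM U ab by auto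
    then have "?F a = \<sigma> a" "?F b = \<sigma> b" using \<eta>0 r_id[OF ret] by simp_all
    ultimately have "c * (b - a) \<le> integral {a..b} (\<lambda>t. norm (?Q (z \<tau> t)))" using gd by simp
    then have "(c * (b - a))\<^sup>2 \<le> (integral {a..b} (\<lambda>t. norm (?Q (z \<tau> t))))\<^sup>2"
      using c0 ab by (intro power_mono) auto
    also have "\<dots> \<le> (b - a) * integral {a..b} (\<lambda>t. (norm (?Q (z \<tau> t)))\<^sup>2)"
      using ab by (intro integral_square_le continuous_intros cQ[OF \<tau>]) auto
    also have "integral {a..b} (\<lambda>t. (norm (?Q (z \<tau> t)))\<^sup>2) = E \<tau>"
      by (simp add: E_def f_def[abs_def] power2_norm_eq_inner)
    finally have "(b - a) * E 0 \<le> (b - a) * E \<tau>" by (simp add: E0 power2_eq_square algebra_simps)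
    then show ?thesis using ab by simp
  qed
  have "integral (cbox a b) (fx 0) = 0"
    by (rule DERIV_local_min[OF DE \<tau>0]) (use Emin in \<open>auto simp: I_def abs_less_iff\<close>)
  moreover have "integral (cbox a b) (fx 0) = integral {a..b} (\<lambda>t. 2 * (v t \<bullet> frechet_derivative ?Q (at (\<sigma> t, v t)) (\<eta> t, \<eta>' t)))"
    unfolding cbox_interval by (rule integral_cong) (simp only: fx_def Q0, simp add: z_def \<zeta>_def)
  ultimately show ?thesis by simp
qed

end

lemma inner_sum_Basis_adjoint:
  fixes h :: "'a::euclidean_space \<Rightarrow> 'a"
  assumes "linear h"
  shows "(\<Sum>b\<in>Basis. (v \<bullet> h b) *\<^sub>R b) \<bullet> e = v \<bullet> h e"
  by (subst (2) linear_eq_sum_Basis[OF assms])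
     (simp add: inner_sum_left inner_sum_right inner_commute mult.commute)

lemma at_within_Icc_nhd:
  fixes t \<eta> :: real
  assumes "\<eta> > 0"
  shows "at t within {max a (t - \<eta>)..min b (t + \<eta>)} = at t within {a..b}"
  by (rule at_within_nhd[of t "{t - \<eta><..<t + \<eta>}"]) (use assms in auto)

section \<open>Smoothness of metric geodesics\<close>

context closed_submanifold
begin

lemma metric_geodesic_subinterval:
  "metric_geodesic a b c \<sigma> \<Longrightarrow> a \<le> a' \<Longrightarrow> b' \<le> b \<Longrightarrow> metric_geodesic a' b' c \<sigma>"
  unfolding metric_geodesic_def by (auto simp: image_subset_iff)

text \<open>The weak equation differentiates y = P^T v, with derivative \<beta>. Since P v = v,
  applying \<open>retraction_op\<close> to v gives y, and inverting it recovers v as a smooth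
  function of \<sigma> and y, hence differentiable. Normality follows by computing the derivative of
  y . e = v . P e in a second way, where the symmetry of D^2 r cancels everything but A . P
  e.\<close>

lemma metric_geodesic_acceleration:
  assumes ret: "local_retraction M U r" and ab: "a < b" and g: "metric_geodesic a b c \<sigma>"
    and U: "\<And>s. s \<in> {a..b} \<Longrightarrow> \<sigma> s \<in> U"
    and v: "\<And>s. s \<in> {a..b} \<Longrightarrow> (\<sigma> has_vector_derivative v s) (at s within {a..b})"
    and cv: "continuous_on {a..b} v" and nv: "\<And>t. t \<in> {a..b} \<Longrightarrow> norm (v t) = c"
    and t: "t \<in> {a..b}"
  shows "\<exists>A. (v has_vector_derivative A) (at t within {a..b})
    \<and> (\<forall>e. A \<bullet> frechet_derivative r (at (\<sigma> t)) e = 0)"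
proof -
  note oU = open_U[OF ret] and sr = smooth_r[OF ret] and sQ = smooth_derivative_eval[OF ret]
  interpret fam: smooth_expanding_family U "retraction_op r" by (rule retraction_op_family[OF ret])
  let ?Q = "derivative_eval r"
  have oW: "open (U \<times> (UNIV :: 'a set))" using oU by (simp add: open_Times)
  have gM: "\<sigma> ` {a..b} \<subseteq> M" using g unfolding metric_geodesic_def by auto
  have c\<sigma>: "continuous_on {a..b} \<sigma>" by (rule metric_geodesic_continuous[OF g])
  define G where "G s h = frechet_derivative ?Q (at (\<sigma> s, v s)) (h, 0)" for s h
  define y where "y s = (\<Sum>b\<in>Basis. (v s \<bullet> frechet_derivative r (at (\<sigma> s)) b) *\<^sub>R b)" for s
  define \<beta> where "\<beta> s = (\<Sum>b\<in>Basis. (v s \<bullet> G s b) *\<^sub>R b)" for s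
  have linP: "linear (frechet_derivative r (at (\<sigma> s)))" if "s \<in> {a..b}" for s
    by (rule smooth_on_linear[OF sr oU U[OF that]])
  have linG: "linear (G s)" if s: "s \<in> {a..b}" for s
  proof -
    have l: "linear (frechet_derivative ?Q (at (\<sigma> s, v s)))"
      by (rule smooth_on_linear[OF sQ oW]) (use U[OF s] in auto)
    show ?thesis unfolding G_def
      by (rule linearI) (metis (no_types) l linear_add linear_cmul add_Pair scaleR_Pair add_0 scaleR_zero_right)+
  qed
  have cy: "continuous_on {a..b} y"
    unfolding y_def by (intro continuous_intros cv continuous_on_frechet_derivative[OF sr oU c\<sigma>]) (use U in auto)
  have c\<beta>: "continuous_on {a..b} \<beta>"
    unfolding \<beta>_def G_def
    by (intro continuous_intros cv continuous_on_frechet_derivative[OF sQ oW continuous_on_Pair[OF c\<sigma> cv]]) (use U in auto)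
  have y: "(y has_vector_derivative \<beta> s) (at s within {a..b})" if "s \<in> {a..b}" for s
  proof (rule du_Bois_Reymond[OF ab cy c\<beta> _ that])
    fix \<eta> \<eta>' :: "real \<Rightarrow> 'a" assume eta: "\<And>t. t \<in> {a..b} \<Longrightarrow> (\<eta> has_vector_derivative \<eta>' t) (at t within {a..b})"
      "continuous_on {a..b} \<eta>'" "\<eta> a = 0" "\<eta> b = 0"
    have "integral {a..b} (\<lambda>t. \<beta> t \<bullet> \<eta> t + y t \<bullet> \<eta>' t)
        = integral {a..b} (\<lambda>t. v t \<bullet> frechet_derivative ?Q (at (\<sigma> t, v t)) (\<eta> t, \<eta>' t))"
    proof (rule integral_cong)
      fix s assume s: "s \<in> {a..b}"
      show "\<beta> s \<bullet> \<eta> s + y s \<bullet> \<eta>' s = v s \<bullet> frechet_derivative ?Q (at (\<sigma> s, v s)) (\<eta> s, \<eta>' s)"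
        unfolding \<beta>_def y_def inner_sum_Basis_adjoint[OF linG[OF s]] inner_sum_Basis_adjoint[OF linP[OF s]]
        by (simp add: derivative_eval_split[OF ret U[OF s], of _ "\<eta> s" "\<eta>' s"] G_def inner_add_right)
    qed
    then show "integral {a..b} (\<lambda>t. \<beta> t \<bullet> \<eta> t + y t \<bullet> \<eta>' t) = 0"
      using first_variation[OF ret ab g U v cv nv eta] by simp
  qed
  have vy: "v s = (\<Sum>b\<in>Basis. (y s \<bullet> b) *\<^sub>R fam.Op_inv (\<sigma> s) b)" if s: "s \<in> {a..b}" for s
  proof -
    have "retraction_op r (\<sigma> s) (v s) = y s"
      using retraction_fixes_velocity[OF ret v[OF s] ab s U[OF s] gM] by (simp add: retraction_op_def y_def)
    then have "v s = fam.Op_inv (\<sigma> s) (y s)" using fam.Op_inv_Op[OF U[OF s], of "v s"] by simp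
    then show ?thesis using linear_eq_sum_Basis[OF fam.linear_Op_inv[OF U[OF s]], of "y s"] by simp
  qed
  have summand: "((\<lambda>s. (y s \<bullet> e) *\<^sub>R fam.Op_inv (\<sigma> s) e) has_vector_derivative
      (y t \<bullet> e) *\<^sub>R frechet_derivative (\<lambda>x. fam.Op_inv x e) (at (\<sigma> t)) (v t) + (\<beta> t \<bullet> e) *\<^sub>R fam.Op_inv (\<sigma> t) e)
      (at t within {a..b})" for e
    by (rule bounded_bilinear.has_vector_derivative[OF bounded_bilinear_scaleR
          bounded_linear.has_vector_derivative[OF bounded_linear_inner_left y[OF t]]
          smooth_on_chain[OF fam.smooth_on_Op_inv oU v[OF t] U[OF t]]])
  define A where "A = (\<Sum>b\<in>Basis. (y t \<bullet> b) *\<^sub>R frechet_derivative (\<lambda>x. fam.Op_inv x b) (at (\<sigma> t)) (v t) + (\<beta> t \<bullet> b) *\<^sub>R fam.Op_inv (\<sigma> t) b)"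
  have "((\<lambda>s. \<Sum>b\<in>Basis. (y s \<bullet> b) *\<^sub>R fam.Op_inv (\<sigma> s) b) has_vector_derivative A) (at t within {a..b})"
    unfolding A_def by (intro has_vector_derivative_sum summand)
  then have A: "(v has_vector_derivative A) (at t within {a..b})"
    by (rule has_vector_derivative_transform[OF t, rotated]) (rule vy)
  have perp: "A \<bullet> frechet_derivative r (at (\<sigma> t)) e = 0" for e
  proof -
    let ?De = "\<lambda>x. frechet_derivative r (at x) e"
    have "((\<lambda>s. y s \<bullet> e) has_vector_derivative \<beta> t \<bullet> e) (at t within {a..b})"
      by (rule bounded_linear.has_vector_derivative[OF bounded_linear_inner_left y[OF t]])
    then have "((\<lambda>s. v s \<bullet> ?De (\<sigma> s)) has_vector_derivative \<beta> t \<bullet> e) (at t within {a..b})"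
      by (rule has_vector_derivative_transform[OF t, rotated]) (simp add: y_def inner_sum_Basis_adjoint[OF linP])
    from velocity_eq[OF this ab t]
    have 1: "velocity a b (\<lambda>s. v s \<bullet> ?De (\<sigma> s)) t = v t \<bullet> G t e"
      by (simp add: \<beta>_def inner_sum_Basis_adjoint[OF linG[OF t]])
    have "((\<lambda>s. v s \<bullet> ?De (\<sigma> s)) has_vector_derivative
        v t \<bullet> frechet_derivative ?De (at (\<sigma> t)) (v t) + A \<bullet> ?De (\<sigma> t)) (at t within {a..b})"
      by (rule bounded_bilinear.has_vector_derivative[OF bounded_bilinear_inner A
            smooth_on_chain[OF smooth_on_Suc[OF sr] oU v[OF t] U[OF t]]])
    from velocity_eq[OF this ab t] 1
    have "v t \<bullet> G t e = v t \<bullet> frechet_derivative ?De (at (\<sigma> t)) (v t) + A \<bullet> ?De (\<sigma> t)" by simp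
    moreover have "frechet_derivative ?De (at (\<sigma> t)) (v t) = G t e"
      unfolding G_def derivative_eval_partial_fst[OF ret U[OF t]]
      by (rule derivative_eval_symmetric[OF ret U[OF t]])
    ultimately show ?thesis by simp
  qed
  show ?thesis using A perp by blast
qed

text \<open>Localisation around a parameter so that one retraction serves. The subinterval is
  clipped at \<open>a\<close> and \<open>b\<close>, which keeps derivatives at t one-sided exactly
  when they are so on the full interval.\<close>

lemma local_retraction_along:
  fixes a b :: real and \<sigma> :: "real \<Rightarrow> 'a"
  assumes ab: "a < b" and c: "continuous_on {a..b} \<sigma>" and M: "\<sigma> ` {a..b} \<subseteq> M" and t: "t \<in> {a..b}"
  obtains U r \<eta> where "local_retraction M U r" "\<eta> > 0"
    "\<forall>s\<in>{max a (t - \<eta>)..min b (t + \<eta>)}. \<sigma> s \<in> U" "max a (t - \<eta>) < min b (t + \<eta>)"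
    "t \<in> {max a (t - \<eta>)..min b (t + \<eta>)}"
proof -
  obtain U r where U: "local_retraction M U r" "\<sigma> t \<in> U"
    using smooth_submanifold_local_retraction[OF submanifold, of "\<sigma> t"] M t by blast
  obtain e where e: "e > 0" "ball (\<sigma> t) e \<subseteq> U" using open_U[OF U(1)] U(2) open_contains_ball by blast
  obtain \<delta> where d: "\<delta> > 0" "\<And>s. s \<in> {a..b} \<Longrightarrow> dist s t < \<delta> \<Longrightarrow> dist (\<sigma> s) (\<sigma> t) < e"
    using c t e(1) unfolding continuous_on_iff by metis
  show ?thesis
  proof (rule that[OF U(1), of "\<delta> / 2"])
    show "\<forall>s\<in>{max a (t - \<delta> / 2)..min b (t + \<delta> / 2)}. \<sigma> s \<in> U"
    proof
      fix s assume "s \<in> {max a (t - \<delta> / 2)..min b (t + \<delta> / 2)}"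
      then have "s \<in> {a..b}" "dist s t < \<delta>" using d(1) by (auto simp: dist_real_def)
      from d(2)[OF this] e(2) show "\<sigma> s \<in> U" by (auto simp: dist_commute)
    qed
  qed (use d(1) ab t in auto)
qed

text \<open>Smoothness and the geodesic equation are local, so both are checked near each parameter
  with one retraction. There the pair (\<sigma>, v) solves the smooth spray, which gives smoothness;
  the length comes from the constant speed c.\<close>

lemma metric_geodesic_minimizing:
  assumes ab: "a < b" and g: "metric_geodesic a b c \<sigma>"
  shows "minimizing_geodesic_on M a b \<sigma>"
proof -
  obtain v where v: "\<And>t. t \<in> {a..b} \<Longrightarrow> (\<sigma> has_vector_derivative v t) (at t within {a..b})"
    "continuous_on {a..b} v" "\<And>t. t \<in> {a..b} \<Longrightarrow> norm (v t) = c"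
    using metric_geodesic_C1[OF ab g] by blast
  have gM: "\<sigma> ` {a..b} \<subseteq> M" using g unfolding metric_geodesic_def by auto
  have c\<sigma>: "continuous_on {a..b} \<sigma>" by (rule metric_geodesic_continuous[OF g])
  have loc: "(\<exists>W h. open W \<and> t \<in> W \<and> smooth_on W h \<and> (\<forall>s\<in>{a..b} \<inter> W. h s = \<sigma> s))
      \<and> (\<exists>A. (v has_vector_derivative A) (at t within {a..b}) \<and> (\<forall>w\<in>tangent_space M (\<sigma> t). A \<bullet> w = 0))"
    if t: "t \<in> {a..b}" for t
  proof -
    obtain U r \<eta> where U: "local_retraction M U r" and eta: "\<eta> > 0"
      and inU: "\<forall>s\<in>{max a (t - \<eta>)..min b (t + \<eta>)}. \<sigma> s \<in> U"
      and a'b': "max a (t - \<eta>) < min b (t + \<eta>)" and t': "t \<in> {max a (t - \<eta>)..min b (t + \<eta>)}"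
      by (rule local_retraction_along[OF ab c\<sigma> gM t])
    define a' b' where "a' = max a (t - \<eta>)" and "b' = min b (t + \<eta>)"
    note a'b' = a'b'[folded a'_def b'_def] and t' = t'[folded a'_def b'_def]
    have inU: "\<sigma> s \<in> U" if "s \<in> {a'..b'}" for s using inU that by (simp add: a'_def b'_def)
    have sub: "{a'..b'} \<subseteq> {a..b}" by (auto simp: a'_def b'_def)
    have g': "metric_geodesic a' b' c \<sigma>" by (rule metric_geodesic_subinterval[OF g]) (auto simp: a'_def b'_def)
    have v': "(\<sigma> has_vector_derivative v s) (at s within {a'..b'})" if "s \<in> {a'..b'}" for s
      by (rule has_vector_derivative_within_subset[OF v(1) sub]) (use that sub in auto)
    have cv': "continuous_on {a'..b'} v" by (rule continuous_on_subset[OF v(2) sub])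
    have nv': "norm (v s) = c" if "s \<in> {a'..b'}" for s using v(3) sub that by auto
    have M': "\<sigma> ` {a'..b'} \<subseteq> M" using gM sub by blast
    have "\<forall>s\<in>{a'..b'}. \<exists>A. (v has_vector_derivative A) (at s within {a'..b'})
        \<and> (\<forall>e. A \<bullet> frechet_derivative r (at (\<sigma> s)) e = 0)"
      using metric_geodesic_acceleration[OF U a'b' g' inU v' cv' nv'] by blast
    then obtain A where A: "\<And>s. s \<in> {a'..b'} \<Longrightarrow> (v has_vector_derivative A s) (at s within {a'..b'})"
      "\<And>s e. s \<in> {a'..b'} \<Longrightarrow> A s \<bullet> frechet_derivative r (at (\<sigma> s)) e = 0" by metis
    have "smooth_map_on {a'..b'} (\<lambda>s. (\<sigma> s, v s))"
    proof (rule ode_smooth_map_on[OF _ smooth_geodesic_spray[OF U]])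
      show "open (U \<times> (UNIV :: 'a set))" using open_U[OF U] by (simp add: open_Times)
      show "(\<sigma> s, v s) \<in> U \<times> UNIV" if "s \<in> {a'..b'}" for s using inU[OF that] by simp
      show "((\<lambda>s. (\<sigma> s, v s)) has_vector_derivative geodesic_spray r (\<sigma> s, v s)) (at s within {a'..b'})"
        if "s \<in> {a'..b'}" for s
        by (rule geodesic_spray_solution[OF U a'b' M' inU v' that A(1)[OF that] A(2)[OF that]])
    qed
    then obtain W h where W: "open W" "t \<in> W" "smooth_on W h" "\<forall>s\<in>{a'..b'} \<inter> W. h s = (\<sigma> s, v s)"
      using t' unfolding smooth_map_on_def by blast
    \<comment> \<open>Restricting to the open window turns agreement on [a', b'] into agreement on
      [a, b].\<close>
    define W' where "W' = W \<inter> {t - \<eta><..<t + \<eta>}"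
    have "open W'" "t \<in> W'" using W eta by (auto simp: W'_def)
    moreover have "smooth_on W' (\<lambda>s. fst (h s))"
      by (rule smooth_on_bounded_linear[OF bounded_linear_fst \<open>open W'\<close> smooth_on_subset[OF W(3)]]) (auto simp: W'_def)
    moreover have "\<forall>s\<in>{a..b} \<inter> W'. fst (h s) = \<sigma> s" using W(4) by (auto simp: W'_def a'_def b'_def)
    ultimately have 1: "\<exists>W h. open W \<and> t \<in> W \<and> smooth_on W h \<and> (\<forall>s\<in>{a..b} \<inter> W. h s = \<sigma> s)"
      by (intro exI[of _ W'] exI[of _ "\<lambda>s. fst (h s)"]) auto
    have "(v has_vector_derivative A t) (at t within {a..b})"
      using A(1)[OF t'] at_within_Icc_nhd[OF eta, of t a b] by (simp add: a'_def b'_def)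
    moreover have "A t \<bullet> w = 0" if w: "w \<in> tangent_space M (\<sigma> t)" for w
      using A(2)[OF t', of w] retraction_fixes_tangent[OF U inU[OF t'] w] by simp
    ultimately show ?thesis using 1 by blast
  qed
  have sm: "smooth_map_on {a..b} \<sigma>" unfolding smooth_map_on_def using loc by blast
  have vel: "velocity a b \<sigma> s = v s" if "s \<in> {a..b}" for s by (rule velocity_eq[OF v(1)[OF that] ab that])
  have "velocity a b (\<lambda>s. velocity a b \<sigma> s) t \<bullet> w = 0"
    if t: "t \<in> {a..b}" and w: "w \<in> tangent_space M (\<sigma> t)" for t w
  proof -
    obtain A where A: "(v has_vector_derivative A) (at t within {a..b})" "A \<bullet> w = 0"
      using loc[OF t] w by blast
    have "velocity a b (\<lambda>s. velocity a b \<sigma> s) t = velocity a b v t" by (rule velocity_cong[OF vel t])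
    also have "\<dots> = A" by (rule velocity_eq[OF A(1) ab t])
    finally show ?thesis using A(2) by simp
  qed
  moreover have "curve_length a b \<sigma> = d (\<sigma> a) (\<sigma> b)"
  proof -
    have "curve_length a b \<sigma> = integral {a..b} (\<lambda>t. c)"
      unfolding curve_length_def by (rule integral_cong) (simp add: vel v(3))
    also have "\<dots> = d (\<sigma> a) (\<sigma> b)" using g ab by (simp add: metric_geodesic_def)
    finally show ?thesis .
  qed
  ultimately show ?thesis
    unfolding minimizing_geodesic_on_def geodesic_on_def using sm gM by blast
qed

end

section \<open>Uniqueness of short minimizers\<close>

lemma has_vector_derivative_rescale:
  fixes f :: "real \<Rightarrow> 'a::real_normed_vector"
  assumes "a < b" "s \<in> {0..1}" and f: "(f has_vector_derivative w) (at (a + s * (b - a)) within {a..b})"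
  shows "((\<lambda>s. f (a + s * (b - a))) has_vector_derivative (b - a) *\<^sub>R w) (at s within {0..1})"
proof -
  let ?u = "\<lambda>s. a + s * (b - a)"
  have "?u ` {0..1} \<subseteq> {a..b}"
  proof
    fix x assume "x \<in> ?u ` {0..1}"
    then obtain s where "s \<in> {0..1}" "x = ?u s" by blast
    moreover then have "0 \<le> s * (b - a)" "s * (b - a) \<le> 1 * (b - a)" using assms(1) by (auto intro!: mult_right_mono)
    ultimately show "x \<in> {a..b}" by auto
  qed
  then have "(f has_vector_derivative w) (at (?u s) within ?u ` {0..1})"
    by (rule has_vector_derivative_within_subset[OF f])
  moreover have "(?u has_vector_derivative (b - a)) (at s within {0..1})" by (auto intro!: derivative_eq_intros)
  ultimately have "(f \<circ> ?u has_vector_derivative (b - a) *\<^sub>R w) (at s within {0..1})"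
    by (rule vector_diff_chain_within[rotated])
  then show ?thesis by (simp add: o_def)
qed

section \<open>Initial value problem for geodesics and the exponential map\<close>

context closed_submanifold
begin

text \<open>The velocity is fixed by the derivative of a retraction, whose values are tangent. The
  factor \<open>k\<close> serves constant speed with k = 1 and the exponential map with k = b -
  a.\<close>

lemma geodesic_tangent_velocity:
  assumes g: "geodesic_on M a b \<gamma>" and ab: "a < b" and t: "t \<in> {a..b}"
  shows "k *\<^sub>R velocity a b \<gamma> t \<in> tangent_space M (\<gamma> t)"
proof -
  have gM: "\<gamma> ` {a..b} \<subseteq> M" and sm: "smooth_map_on {a..b} \<gamma>" using g by (auto simp: geodesic_on_def)
  then have M: "\<gamma> t \<in> M" using t by auto
  obtain U r where U: "local_retraction M U r" "\<gamma> t \<in> U"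
    using smooth_submanifold_local_retraction[OF submanifold M] by blast
  have "frechet_derivative r (at (\<gamma> t)) (velocity a b \<gamma> t) = velocity a b \<gamma> t"
    by (rule retraction_fixes_velocity[OF U(1) smooth_curve_velocity[OF sm ab t] ab t U(2) gM])
  then have "frechet_derivative r (at (\<gamma> t)) (k *\<^sub>R velocity a b \<gamma> t) = k *\<^sub>R velocity a b \<gamma> t"
    using linear_cmul[OF smooth_on_linear[OF smooth_r[OF U(1)] open_U[OF U(1)] U(2)]] by metis
  then show ?thesis using retraction_range_tangent[OF U(1) M U(2)] by metis
qed

lemma geodesic_acceleration:
  assumes g: "geodesic_on M a b \<gamma>" and ab: "a < b" and t: "t \<in> {a..b}"
  shows "\<exists>A. (velocity a b \<gamma> has_vector_derivative A) (at t within {a..b})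
    \<and> (\<forall>w\<in>tangent_space M (\<gamma> t). A \<bullet> w = 0)"
proof -
  have sm: "smooth_map_on {a..b} (velocity a b \<gamma>)"
    using g ab smooth_map_on_velocity by (auto simp: geodesic_on_def)
  show ?thesis
    by (intro exI conjI, rule smooth_curve_velocity[OF sm ab t]) (use g t in \<open>auto simp: geodesic_on_def\<close>)
qed

text \<open>The acceleration is normal and the velocity tangent, so |v|^2 has derivative zero;
  integrating the constant speed identifies it.\<close>

lemma geodesic_constant_speed:
  assumes g: "geodesic_on M a b \<gamma>" and ab: "a < b"
  shows "\<And>t. t \<in> {a..b} \<Longrightarrow> norm (velocity a b \<gamma> t) = curve_length a b \<gamma> / (b - a)"
proof -
  let ?v = "velocity a b \<gamma>"
  have "((\<lambda>s. ?v s \<bullet> ?v s) has_vector_derivative 0) (at t within {a..b})" if t: "t \<in> {a..b}" for t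
  proof -
    obtain A where A: "(?v has_vector_derivative A) (at t within {a..b})"
      "\<forall>w\<in>tangent_space M (\<gamma> t). A \<bullet> w = 0"
      using geodesic_acceleration[OF g ab t] by blast
    have "A \<bullet> ?v t = 0" using bspec[OF A(2) geodesic_tangent_velocity[OF g ab t, of 1]] by simp
    with bounded_bilinear.has_vector_derivative[OF bounded_bilinear_inner A(1) A(1)] show ?thesis
      by (simp add: inner_commute)
  qed
  then obtain k where "\<And>t. t \<in> {a..b} \<Longrightarrow> ?v t \<bullet> ?v t = k"
    using has_vector_derivative_zero_constant[of "{a..b}" "\<lambda>s. ?v s \<bullet> ?v s"] by auto
  then have n: "norm (?v t) = sqrt k" if "t \<in> {a..b}" for t using that by (simp add: norm_eq_sqrt_inner)
  then have "curve_length a b \<gamma> = integral {a..b} (\<lambda>t. sqrt k)"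
    unfolding curve_length_def by (intro integral_cong) auto
  then have "curve_length a b \<gamma> / (b - a) = sqrt k" using ab by simp
  then show "norm (?v t) = curve_length a b \<gamma> / (b - a)" if "t \<in> {a..b}" for t using n[OF that] by simp
qed

lemma geodesic_phase_solution:
  assumes g: "geodesic_on M a b \<gamma>" and ab: "a < b" and ret: "local_retraction M U r"
    and sub: "{a'..b'} \<subseteq> {a..b}" "a' < b'" and U: "\<And>s. s \<in> {a'..b'} \<Longrightarrow> \<gamma> s \<in> U" and s: "s \<in> {a'..b'}"
  shows "((\<lambda>s. (\<gamma> s, velocity a b \<gamma> s)) has_vector_derivative geodesic_spray r (\<gamma> s, velocity a b \<gamma> s))
    (at s within {a'..b'})"
proof -
  have gM: "\<gamma> ` {a..b} \<subseteq> M" and sm: "smooth_map_on {a..b} \<gamma>" using g by (auto simp: geodesic_on_def)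
  have s': "s \<in> {a..b}" using s sub by auto
  obtain A where A: "(velocity a b \<gamma> has_vector_derivative A) (at s within {a..b})"
      "\<forall>w\<in>tangent_space M (\<gamma> s). A \<bullet> w = 0"
    using geodesic_acceleration[OF g ab s'] by blast
  have "\<gamma> s \<in> M" using gM s' by auto
  show ?thesis
  proof (rule geodesic_spray_solution[OF ret sub(2) _ U _ s])
    show "\<gamma> ` {a'..b'} \<subseteq> M" using gM sub by blast
    show "(\<gamma> has_vector_derivative velocity a b \<gamma> q) (at q within {a'..b'})" if "q \<in> {a'..b'}" for q
      by (rule has_vector_derivative_within_subset[OF smooth_curve_velocity[OF sm ab] sub(1)]) (use that sub in auto)
    show "(velocity a b \<gamma> has_vector_derivative A) (at s within {a'..b'})"
      by (rule has_vector_derivative_within_subset[OF A(1) sub(1)])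
    show "A \<bullet> frechet_derivative r (at (\<gamma> s)) e = 0" for e
      by (rule bspec[OF A(2)], rule retraction_range_tangent[OF ret \<open>\<gamma> s \<in> M\<close> U[OF s]])
  qed
qed

text \<open>The set where the two phase curves agree is open and closed in the interval. Near a
  point of agreement both stay in a ball where the spray is Lipschitz and local uniqueness applies;
  near a point of disagreement they remain distinct by continuity.\<close>

lemma geodesic_unique:
  assumes g1: "geodesic_on M a b \<gamma>1" and g2: "geodesic_on M a b \<gamma>2" and ab: "a < b"
    and eq: "\<gamma>1 a = \<gamma>2 a" "velocity a b \<gamma>1 a = velocity a b \<gamma>2 a" and t: "t \<in> {a..b}"
  shows "\<gamma>1 t = \<gamma>2 t"
proof -
  define z1 where "z1 s = (\<gamma>1 s, velocity a b \<gamma>1 s)" for s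
  define z2 where "z2 s = (\<gamma>2 s, velocity a b \<gamma>2 s)" for s
  have c: "continuous_on {a..b} (\<lambda>s. (\<gamma> s, velocity a b \<gamma> s))" if "geodesic_on M a b \<gamma>" for \<gamma>
    using that ab unfolding geodesic_on_def
    by (intro continuous_on_Pair smooth_map_on_imp_continuous_on smooth_map_on_velocity) auto
  have c1: "continuous_on {a..b} z1" and c2: "continuous_on {a..b} z2"
    unfolding z1_def z2_def by (rule c[OF g1] c[OF g2])+
  have "z1 t = z2 t"
  proof (rule connected_induction_simple[of "{a..b}" a t "\<lambda>s. z1 s = z2 s"])
    show "z1 a = z2 a" using eq by (simp add: z1_def z2_def)
    fix s assume s: "s \<in> {a..b}"
    have nbhd: "\<exists>\<delta>>0. \<forall>u\<in>{a..b}. \<bar>u - s\<bar> < \<delta> \<longrightarrow> dist (z1 u) (z1 s) < e \<and> dist (z2 u) (z2 s) < e"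
      if e: "e > 0" for e
    proof -
      obtain \<delta>1 where "\<delta>1 > 0" "\<forall>u\<in>{a..b}. dist u s < \<delta>1 \<longrightarrow> dist (z1 u) (z1 s) < e"
        using c1 s e unfolding continuous_on_iff by blast
      moreover obtain \<delta>2 where "\<delta>2 > 0" "\<forall>u\<in>{a..b}. dist u s < \<delta>2 \<longrightarrow> dist (z2 u) (z2 s) < e"
        using c2 s e unfolding continuous_on_iff by blast
      ultimately show ?thesis by (intro exI[of _ "min \<delta>1 \<delta>2"]) (auto simp: dist_real_def)
    qed
    show "\<exists>T. openin (top_of_set {a..b}) T \<and> s \<in> T \<and> (\<forall>x\<in>T. \<forall>y\<in>T. z1 x = z2 x \<longrightarrow> z1 y = z2 y)"
    proof (cases "z1 s = z2 s")
      case False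
      then have "dist (z1 s) (z2 s) / 2 > 0" by simp
      from nbhd[OF this] obtain \<delta> where \<delta>: "\<delta> > 0" "\<forall>u\<in>{a..b}. \<bar>u - s\<bar> < \<delta> \<longrightarrow>
          dist (z1 u) (z1 s) < dist (z1 s) (z2 s) / 2 \<and> dist (z2 u) (z2 s) < dist (z1 s) (z2 s) / 2" by blast
      have "z1 x \<noteq> z2 x" if "x \<in> {a..b} \<inter> ball s \<delta>" for x
      proof
        assume "z1 x = z2 x"
        moreover have "dist (z1 x) (z1 s) < dist (z1 s) (z2 s) / 2" "dist (z2 x) (z2 s) < dist (z1 s) (z2 s) / 2"
          using \<delta>(2) that by (auto simp: dist_real_def abs_minus_commute)
        ultimately show False using dist_triangle3[of "z1 s" "z2 s" "z1 x"] by simp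
      qed
      then show ?thesis using s \<delta>(1) by (intro exI[of _ "{a..b} \<inter> ball s \<delta>"]) (auto simp: openin_open_Int)
    next
      case True
      have "\<gamma>1 s \<in> M" using g1 s by (auto simp: geodesic_on_def)
      then obtain U r where U: "local_retraction M U r" "\<gamma>1 s \<in> U"
        using smooth_submanifold_local_retraction[OF submanifold] by metis
      have oW: "open (U \<times> (UNIV :: 'a set))" using open_U[OF U(1)] by (simp add: open_Times)
      have "z1 s \<in> U \<times> UNIV" using U(2) by (simp add: z1_def)
      then have "\<exists>R>0. cball (z1 s) R \<subseteq> U \<times> UNIV" by (simp only: open_contains_cball_eq[OF oW])
      then obtain R where R: "R > 0" "cball (z1 s) R \<subseteq> U \<times> UNIV" by (elim exE conjE)
      obtain L where L: "L \<ge> 0" "\<And>x y. x \<in> cball (z1 s) R \<Longrightarrow> y \<in> cball (z1 s) R \<Longrightarrow>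
          norm (geodesic_spray r x - geodesic_spray r y) \<le> L * norm (x - y)"
        using smooth_on_lipschitz_cball[OF oW smooth_geodesic_spray[OF U(1)] R(2)] by blast
      obtain \<delta> where \<delta>: "\<delta> > 0" "\<forall>u\<in>{a..b}. \<bar>u - s\<bar> < \<delta> \<longrightarrow> dist (z1 u) (z1 s) < R \<and> dist (z2 u) (z2 s) < R"
        using nbhd[OF R(1)] by blast
      define \<eta> where "\<eta> = min (\<delta> / 2) (1 / (4 * (L + 1)))"
      have eta: "\<eta> > 0" "\<eta> < \<delta>" "\<eta> \<le> 1 / (4 * (L + 1))" using \<delta>(1) L(1) by (auto simp: \<eta>_def)
      define a' b' where "a' = max a (s - \<eta>)" and "b' = min b (s + \<eta>)"
      have sub: "{a'..b'} \<subseteq> {a..b}" "a' < b'" using ab s eta by (auto simp: a'_def b'_def)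
      have z: "z1 u \<in> cball (z1 s) R" "z2 u \<in> cball (z1 s) R" if "u \<in> {a'..b'}" for u
      proof -
        have "\<bar>u - s\<bar> < \<delta>" using that eta by (auto simp: a'_def b'_def)
        then have "dist (z1 u) (z1 s) < R \<and> dist (z2 u) (z2 s) < R" using that sub \<delta>(2) by blast
        then show "z1 u \<in> cball (z1 s) R" "z2 u \<in> cball (z1 s) R"
          using True by (simp_all add: dist_commute)
      qed
      then have inU: "\<gamma>1 u \<in> U" "\<gamma>2 u \<in> U" if "u \<in> {a'..b'}" for u
        using subsetD[OF R(2) z(1)[OF that]] subsetD[OF R(2) z(2)[OF that]] by (auto simp: z1_def z2_def)
      have uniq: "z1 y = z2 y" if x: "x \<in> {a'..b'}" "z1 x = z2 x" and y: "y \<in> {a'..b'}" for x y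
      proof (rule ode_local_unique[where y = z1 and z = z2 and X = "geodesic_spray r" and a = a' and b = b',
            OF _ _ z L(2) _ L(1) x y])
        show "(z1 has_vector_derivative geodesic_spray r (z1 u)) (at u within {a'..b'})" if "u \<in> {a'..b'}" for u
          unfolding z1_def by (rule geodesic_phase_solution[OF g1 ab U(1) sub inU(1) that])
        show "(z2 has_vector_derivative geodesic_spray r (z2 u)) (at u within {a'..b'})" if "u \<in> {a'..b'}" for u
          unfolding z2_def by (rule geodesic_phase_solution[OF g2 ab U(1) sub inU(2) that])
        have "(b' - a') * L \<le> 2 * \<eta> * L" using L(1) by (intro mult_right_mono) (auto simp: a'_def b'_def)
        also have "\<dots> \<le> 2 * (1 / (4 * (L + 1))) * L" using L eta(3) by (intro mult_right_mono mult_left_mono) auto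
        also have "\<dots> < 1" using L by (simp add: divide_simps)
        finally show "(b' - a') * L < 1" .
      qed
      have nb: "{a..b} \<inter> ball s \<eta> \<subseteq> {a'..b'}" by (auto simp: a'_def b'_def dist_real_def)
      show ?thesis
      proof (intro exI[of _ "{a..b} \<inter> ball s \<eta>"] conjI ballI impI)
        fix x y assume "x \<in> {a..b} \<inter> ball s \<eta>" "y \<in> {a..b} \<inter> ball s \<eta>" "z1 x = z2 x"
        then show "z1 y = z2 y" using nb by (intro uniq[of x y]) blast+
      qed (use s eta(1) in \<open>auto simp: openin_open_Int\<close>)
    qed
  qed (use ab t in auto)
  then show ?thesis by (simp add: z1_def z2_def)
qed

text \<open>\<open>geodesic_unique\<close> settles the uniqueness demanded by the definite
  description in \<open>riem_exp\<close>; the given \<gamma> is itself the witness of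
  existence.\<close>

lemma riem_exp_geodesic:
  assumes g: "geodesic_on M 0 1 \<gamma>" and "(\<gamma> has_vector_derivative v) (at 0 within {0..1})"
  shows "riem_exp M (\<gamma> 0) v = \<gamma> 1"
  unfolding riem_exp_def
proof (rule the_equality)
  show "\<exists>\<gamma>'. geodesic_on M 0 1 \<gamma>' \<and> \<gamma>' 0 = \<gamma> 0 \<and> (\<gamma>' has_vector_derivative v) (at 0 within {0..1}) \<and> \<gamma>' 1 = \<gamma> 1"
    using assms by blast
  fix q assume "\<exists>\<gamma>'. geodesic_on M 0 1 \<gamma>' \<and> \<gamma>' 0 = \<gamma> 0 \<and> (\<gamma>' has_vector_derivative v) (at 0 within {0..1}) \<and> \<gamma>' 1 = q"
  then obtain \<gamma>' where g': "geodesic_on M 0 1 \<gamma>'" "\<gamma>' 0 = \<gamma> 0" "(\<gamma>' has_vector_derivative v) (at 0 within {0..1})" "\<gamma>' 1 = q"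
    by blast
  have "velocity 0 1 \<gamma>' 0 = velocity 0 1 \<gamma> 0"
    using velocity_eq[OF g'(3)] velocity_eq[OF assms(2)] by simp
  from geodesic_unique[OF g'(1) g _ g'(2) this, of 1] g'(4) show "q = \<gamma> 1" by simp
qed

text \<open>\<open>riem_exp\<close> follows geodesics over [0, 1]. The affine change of time
  multiplies the velocity by b - a and the acceleration by its square, so normality is kept.\<close>

lemma geodesic_rescale:
  assumes g: "geodesic_on M a b \<gamma>" and ab: "a < b"
  shows "geodesic_on M 0 1 (\<lambda>s. \<gamma> (a + s * (b - a)))"
    and "((\<lambda>s. \<gamma> (a + s * (b - a))) has_vector_derivative (b - a) *\<^sub>R velocity a b \<gamma> a) (at 0 within {0..1})"
proof -
  let ?u = "\<lambda>s. a + s * (b - a)"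
  let ?v = "velocity a b \<gamma>"
  have u: "?u s \<in> {a..b}" if "s \<in> {0..1}" for s
  proof -
    have "0 \<le> s * (b - a)" "s * (b - a) \<le> 1 * (b - a)" using ab that by (auto intro!: mult_right_mono)
    then show ?thesis by auto
  qed
  have sm: "smooth_map_on {a..b} \<gamma>" using g by (simp add: geodesic_on_def)
  have D: "((\<lambda>s. \<gamma> (?u s)) has_vector_derivative (b - a) *\<^sub>R ?v (?u s)) (at s within {0..1})" if "s \<in> {0..1}" for s
    by (rule has_vector_derivative_rescale[OF ab that smooth_curve_velocity[OF sm ab u[OF that]]])
  show "((\<lambda>s. \<gamma> (?u s)) has_vector_derivative (b - a) *\<^sub>R ?v a) (at 0 within {0..1})"
    using D[of 0] by simp
  have vel: "velocity 0 1 (\<lambda>s. \<gamma> (?u s)) s = (b - a) *\<^sub>R ?v (?u s)" if "s \<in> {0..1}" for s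
    by (rule velocity_eq[OF D[OF that]]) (use that in auto)
  have aff: "smooth_on UNIV ?u" using smooth_on_affine[of UNIV a "b - a"] by simp
  have "smooth_map_on {0..1} (\<lambda>s. \<gamma> (?u s))"
    by (rule smooth_map_on_compose_smooth_on[OF sm u open_UNIV _ aff]) auto
  moreover have "velocity 0 1 (\<lambda>s. velocity 0 1 (\<lambda>s. \<gamma> (?u s)) s) s \<bullet> w = 0"
    if s: "s \<in> {0..1}" and w: "w \<in> tangent_space M (\<gamma> (?u s))" for s w
  proof -
    obtain A where A: "(?v has_vector_derivative A) (at (?u s) within {a..b})" "A \<bullet> w = 0"
      using geodesic_acceleration[OF g ab u[OF s]] w by blast
    have "((\<lambda>s. (b - a) *\<^sub>R ?v (?u s)) has_vector_derivative (b - a) *\<^sub>R ((b - a) *\<^sub>R A)) (at s within {0..1})"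
      by (rule bounded_linear.has_vector_derivative[OF bounded_linear_scaleR_right has_vector_derivative_rescale[OF ab s A(1)]])
    then have "velocity 0 1 (\<lambda>s. (b - a) *\<^sub>R ?v (?u s)) s = (b - a) *\<^sub>R ((b - a) *\<^sub>R A)"
      using s by (intro velocity_eq) auto
    moreover have "velocity 0 1 (\<lambda>s. velocity 0 1 (\<lambda>s. \<gamma> (?u s)) s) s = velocity 0 1 (\<lambda>s. (b - a) *\<^sub>R ?v (?u s)) s"
      by (rule velocity_cong[OF vel s])
    ultimately show ?thesis using A(2) by simp
  qed
  ultimately show "geodesic_on M 0 1 (\<lambda>s. \<gamma> (?u s))"
    using g u unfolding geodesic_on_def by (auto simp: image_subset_iff)
qed

text \<open>After rescaling to [0, 1], the common end point is the exponential image of both initial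
  vectors, which have norm d < \<rho>. Injectivity on the ball of radius \<rho> makes these vectors
  equal, and the initial value problem decides the rest.\<close>

lemma minimizing_geodesic_unique:
  assumes g1: "minimizing_geodesic_on M a b \<gamma>1" and g2: "minimizing_geodesic_on M a b \<gamma>2" and ab: "a < b"
    and ends: "\<gamma>1 a = \<gamma>2 a" "\<gamma>1 b = \<gamma>2 b"
    and inj: "ereal (d (\<gamma>1 a) (\<gamma>1 b)) < inj_radius M" and t: "t \<in> {a..b}"
  shows "\<gamma>1 t = \<gamma>2 t"
proof -
  have G: "geodesic_on M a b \<gamma>1" "geodesic_on M a b \<gamma>2"
    and len: "curve_length a b \<gamma>1 = d (\<gamma>1 a) (\<gamma>1 b)" "curve_length a b \<gamma>2 = d (\<gamma>1 a) (\<gamma>1 b)"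
    using g1 g2 ends by (auto simp: minimizing_geodesic_on_def)
  have "\<gamma>1 a \<in> M" using G(1) ab by (auto simp: geodesic_on_def)
  then have "inj_radius M \<le> inj_radius_at M (\<gamma>1 a)" unfolding inj_radius_def by (rule INF_lower)
  with inj have "ereal (d (\<gamma>1 a) (\<gamma>1 b)) < inj_radius_at M (\<gamma>1 a)" by (rule less_le_trans)
  \<comment> \<open>A number below the supremum lies below some admissible radius, on whose ball the
    exponential map is injective.\<close>
  then obtain \<rho> where \<rho>: "d (\<gamma>1 a) (\<gamma>1 b) < \<rho>"
    "inj_on (riem_exp M (\<gamma>1 a)) (ball 0 \<rho> \<inter> tangent_space M (\<gamma>1 a))"
    unfolding inj_radius_at_def less_SUP_iff by (auto simp: Let_def diffeo_betw_def bij_betw_def)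
  have w: "(b - a) *\<^sub>R velocity a b \<gamma> a \<in> ball 0 \<rho> \<inter> tangent_space M (\<gamma>1 a)
      \<and> riem_exp M (\<gamma>1 a) ((b - a) *\<^sub>R velocity a b \<gamma> a) = \<gamma>1 b"
    if g: "geodesic_on M a b \<gamma>" and l: "curve_length a b \<gamma> = d (\<gamma>1 a) (\<gamma>1 b)" and e: "\<gamma> a = \<gamma>1 a" "\<gamma> b = \<gamma>1 b" for \<gamma>
  proof -
    have "norm ((b - a) *\<^sub>R velocity a b \<gamma> a) = d (\<gamma>1 a) (\<gamma>1 b)"
      using geodesic_constant_speed[OF g ab, of a] ab l by simp
    then show ?thesis
      using \<rho>(1) geodesic_tangent_velocity[OF g ab, of a "b - a"] ab e
        riem_exp_geodesic[OF geodesic_rescale[OF g ab]] by simp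
  qed
  have "(b - a) *\<^sub>R velocity a b \<gamma>1 a = (b - a) *\<^sub>R velocity a b \<gamma>2 a"
    by (rule inj_onD[OF \<rho>(2)])
       (use w[OF G(1) len(1) refl refl] w[OF G(2) len(2) ends(1)[symmetric] ends(2)[symmetric]] in simp_all)
  then have "velocity a b \<gamma>1 a = velocity a b \<gamma>2 a" using ab by simp
  then show ?thesis by (rule geodesic_unique[OF G ab ends(1) _ t])
qed

end

section \<open>Weak derivatives on the unit interval\<close>

text \<open>For a sufficiently fine tagged division Henstock's lemma makes the sum of the norms of
  the local errors small. The local integrals vanish, so this sum is a Riemann sum of |H|. It is the
  route to uniqueness of weak derivatives almost everywhere.\<close>

lemma integral_subintervals_zero_imp_norm:
  fixes H :: "real \<Rightarrow> 'a::euclidean_space"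
  assumes H: "H integrable_on {a..b}"
    and zero: "\<And>r s. a \<le> r \<Longrightarrow> r \<le> s \<Longrightarrow> s \<le> b \<Longrightarrow> integral {r..s} H = 0"
  shows "((\<lambda>t. norm (H t)) has_integral 0) {a..b}"
proof -
  have "((\<lambda>t. norm (H t)) has_integral 0) (cbox a b)"
    unfolding has_integral
  proof (intro allI impI)
    fix e :: real assume "e > 0"
    have H': "H integrable_on cbox a b" using H by simp
    have "\<exists>\<gamma>. gauge \<gamma> \<and> (\<forall>p. p tagged_partial_division_of cbox a b \<and> \<gamma> fine p \<longrightarrow>
        (\<Sum>(x, k)\<in>p. norm (measure lborel k *\<^sub>R H x - integral k H)) < e)"
    proof (rule Henstock_lemma[OF H' \<open>e > 0\<close>])
      fix \<gamma> assume "gauge \<gamma>" "\<And>p. p tagged_partial_division_of cbox a b \<Longrightarrow> \<gamma> fine p \<Longrightarrow>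
        (\<Sum>(x, k)\<in>p. norm (measure lborel k *\<^sub>R H x - integral k H)) < e"
      then show ?thesis by (intro exI[of _ \<gamma>] conjI allI impI) (assumption, simp only:)
    qed
    then obtain \<gamma> where \<gamma>: "gauge \<gamma>" "\<forall>p. p tagged_partial_division_of cbox a b \<and> \<gamma> fine p \<longrightarrow>
        (\<Sum>(x, k)\<in>p. norm (measure lborel k *\<^sub>R H x - integral k H)) < e"
      by (elim exE conjE)
    show "\<exists>\<gamma>. gauge \<gamma> \<and> (\<forall>D. D tagged_division_of cbox a b \<and> \<gamma> fine D \<longrightarrow>
        norm ((\<Sum>(x, k)\<in>D. measure lborel k *\<^sub>R norm (H x)) - 0) < e)"
    proof (intro exI[of _ \<gamma>] conjI allI impI, rule \<gamma>(1))
      fix D assume D: "D tagged_division_of cbox a b \<and> \<gamma> fine D"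
      have "norm (measure lborel k *\<^sub>R H x - integral k H) = measure lborel k *\<^sub>R norm (H x)" if xk: "(x, k) \<in> D" for x k
      proof -
        obtain r s where k: "k = cbox r s" "k \<subseteq> cbox a b"
          using tagged_division_ofD(3,4)[OF conjunct1[OF D] xk] by (elim exE)
        have "integral k H = 0"
        proof (cases "r \<le> s")
          case True then show ?thesis using k zero[of r s] by auto
        qed (use k in simp)
        then show ?thesis by simp
      qed
      then have "(\<Sum>(x, k)\<in>D. norm (measure lborel k *\<^sub>R H x - integral k H)) = (\<Sum>(x, k)\<in>D. measure lborel k *\<^sub>R norm (H x))"
        by (intro sum.cong) auto
      moreover have "(\<Sum>(x, k)\<in>D. norm (measure lborel k *\<^sub>R H x - integral k H)) < e"
        using D by (intro \<gamma>(2)[rule_format]) (auto simp: tagged_division_of_def)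
      moreover have "0 \<le> (\<Sum>(x, k)\<in>D. measure lborel k *\<^sub>R norm (H x))" by (intro sum_nonneg) auto
      ultimately show "norm ((\<Sum>(x, k)\<in>D. measure lborel k *\<^sub>R norm (H x)) - 0) < e" by simp
    qed
  qed
  then show ?thesis by simp
qed

text \<open>|G| \<le> 1 + |G|^2 on a space of finite measure.\<close>

lemma L2_unit_integrable:
  assumes "L2_unit G"
  shows "integrable (lebesgue_on {0..1}) G"
proof (rule Bochner_Integration.integrable_bound)
  show "integrable (lebesgue_on {0..1}) (\<lambda>t. 1 + (norm (G t))\<^sup>2)"
    using assms by (intro Bochner_Integration.integrable_add) (auto simp: L2_unit_def)
  have "norm (G t) \<le> norm (1 + (norm (G t))\<^sup>2)" for t
  proof -
    have "2 * norm (G t) \<le> (norm (G t))\<^sup>2 + 1" using sum_squares_bound[of "norm (G t)" 1] by simp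
    then have "norm (G t) \<le> 1 + (norm (G t))\<^sup>2" using zero_le_power2[of "norm (G t)"] by linarith
    then show ?thesis by simp
  qed
  then show "AE t in lebesgue_on {0..1}. norm (G t) \<le> norm (1 + (norm (G t))\<^sup>2)" by simp
qed (use assms in \<open>simp add: L2_unit_def\<close>)

text \<open>A \<open>C\<^sup>1\<close> smoothed step built from the truncated squares \<open>(x\<^sub>+)\<^sup>2\<close>.\<close>

definition smooth_step :: "real \<Rightarrow> real" where
  "smooth_step x = ((max 0 (x + 1))\<^sup>2 - 2 * (max 0 x)\<^sup>2 + (max 0 (x - 1))\<^sup>2) / 2"

text \<open>The tent function of height one on [-1, 1]: the derivative of
  \<open>smooth_step\<close>, and after rescaling an approximate identity.\<close>

definition hat :: "real \<Rightarrow> real" where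
  "hat x = max 0 (x + 1) - 2 * max 0 x + max 0 (x - 1)"

lemma has_real_derivative_max_square: "((\<lambda>x::real. (max 0 x)\<^sup>2) has_real_derivative 2 * max 0 x) (at x)"
proof (cases x "0::real" rule: linorder_cases)
  case less
  have "((\<lambda>x::real. 0) has_real_derivative 2 * max 0 x) (at x)" using less by simp
  then show ?thesis
    by (rule has_field_derivative_transform_within_open[of _ _ _ "{..<0}"]) (use less in auto)
next
  case greater
  have "((\<lambda>x::real. x\<^sup>2) has_real_derivative 2 * max 0 x) (at x)"
    using greater by (auto intro!: derivative_eq_intros)
  then show ?thesis
    by (rule has_field_derivative_transform_within_open[of _ _ _ "{0<..}"]) (use greater in auto)
next
  case equal
  have "((\<lambda>h. (max 0 h)\<^sup>2 / h) \<longlongrightarrow> 0) (at (0::real))"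
  proof (rule Lim_null_comparison)
    have "norm ((max 0 h)\<^sup>2 / h) \<le> \<bar>h\<bar>" for h :: real
      by (cases "h > 0") (auto simp: power2_eq_square max_def)
    then show "\<forall>\<^sub>F h in at (0::real). norm ((max 0 h)\<^sup>2 / h) \<le> \<bar>h\<bar>" by simp
    show "((\<lambda>h::real. \<bar>h\<bar>) \<longlongrightarrow> 0) (at 0)" by (auto intro!: tendsto_eq_intros)
  qed
  then show ?thesis using equal by (simp add: DERIV_def)
qed

lemma smooth_step_derivative: "(smooth_step has_real_derivative hat x) (at x)"
proof -
  have sh: "((\<lambda>x. (max 0 (x + c))\<^sup>2) has_real_derivative 2 * max 0 (x + c)) (at x)" for c
    using has_real_derivative_max_square[of "x + c"] by (subst (asm) DERIV_shift)
  have "((\<lambda>x. ((max 0 (x + 1))\<^sup>2 - 2 * (max 0 x)\<^sup>2 + (max 0 (x + - 1))\<^sup>2) / 2) has_real_derivative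
      (2 * max 0 (x + 1) - 2 * (2 * max 0 x) + 2 * max 0 (x + - 1)) / 2) (at x)"
    by (intro DERIV_cdivide DERIV_add DERIV_diff DERIV_cmult sh has_real_derivative_max_square)
  moreover have "(2 * max 0 (x + 1) - 2 * (2 * max 0 x) + 2 * max 0 (x + - 1)) / 2 = hat x"
    unfolding hat_def by (simp add: field_simps)
  ultimately show ?thesis by (simp add: smooth_step_def[abs_def])
qed

lemma hat_properties:
  "hat x \<ge> 0" "\<bar>x\<bar> \<ge> 1 \<Longrightarrow> hat x = 0" "continuous_on S hat"
  "x \<le> - 1 \<Longrightarrow> smooth_step x = 0" "x \<ge> 1 \<Longrightarrow> smooth_step x = 1" "0 \<le> smooth_step x" "smooth_step x \<le> 1"
proof -
  show h: "hat x \<ge> 0" for x by (auto simp: hat_def max_def)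
  show "\<bar>x\<bar> \<ge> 1 \<Longrightarrow> hat x = 0" by (auto simp: hat_def max_def abs_if split: if_splits)
  show "continuous_on S hat" unfolding hat_def[abs_def] by (intro continuous_intros)
  show l: "x \<le> - 1 \<Longrightarrow> smooth_step x = 0" for x by (auto simp: smooth_step_def max_def)
  show u: "x \<ge> 1 \<Longrightarrow> smooth_step x = 1" for x
    by (auto simp: smooth_step_def max_def power2_eq_square algebra_simps)
  have mono: "smooth_step y \<le> smooth_step z" if "y \<le> z" for y z
    by (rule DERIV_nonneg_imp_nondecreasing[OF that]) (use smooth_step_derivative h in blast)
  show "0 \<le> smooth_step x" using mono[of "min x (- 1)" x] l[of "min x (- 1)"] by simp
  show "smooth_step x \<le> 1" using mono[of x "max x 1"] u[of "max x 1"] by simp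
qed

text \<open>The rescaled tents are nonnegative of mass one and concentrate at r. The conditions on
  \<open>e\<close> keep each of them inside [0, 1], so that no mass is lost.\<close>

lemma hat_average_tendsto:
  fixes F :: "real \<Rightarrow> 'a::euclidean_space"
  assumes F: "continuous_on {0..1} F" and r: "0 < r" "r < 1"
    and e0: "\<And>n. e n > 0" "e \<longlonglongrightarrow> 0" and er: "\<And>n. 0 \<le> r - e n" "\<And>n. r + e n \<le> 1"
  shows "(\<lambda>n. integral {0..1} (\<lambda>t. (hat ((t - r) / e n) / e n) *\<^sub>R F t)) \<longlonglongrightarrow> F r"
proof (rule LIMSEQ_I)
  fix \<epsilon> :: real assume "\<epsilon> > 0"
  then obtain \<delta> where \<delta>: "\<delta> > 0" "\<And>t. t \<in> {0..1} \<Longrightarrow> dist t r < \<delta> \<Longrightarrow> dist (F t) (F r) < \<epsilon> / 2"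
    using F r half_gt_zero[OF \<open>\<epsilon> > 0\<close>] unfolding continuous_on_iff by (metis atLeastAtMost_iff less_eq_real_def)
  obtain N where N: "\<And>n. n \<ge> N \<Longrightarrow> e n < \<delta>"
    using LIMSEQ_D[OF e0(2) \<delta>(1)] by force
  show "\<exists>N. \<forall>n\<ge>N. norm (integral {0..1} (\<lambda>t. (hat ((t - r) / e n) / e n) *\<^sub>R F t) - F r) < \<epsilon>"
  proof (intro exI[of _ N] allI impI)
    fix n assume n: "n \<ge> N"
    let ?k = "\<lambda>t. hat ((t - r) / e n) / e n"
    note en = e0(1)[of n]
    have ck: "continuous_on {0..1} ?k"
      using en by (intro continuous_intros continuous_on_compose2[OF hat_properties(3)[of UNIV]]) auto
    have "(?k has_integral (smooth_step ((1 - r) / e n) - smooth_step ((0 - r) / e n))) {0..1}"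
    proof (rule fundamental_theorem_of_calculus)
      fix t :: real
      have "((\<lambda>t. smooth_step ((t - r) / e n)) has_real_derivative hat ((t - r) / e n) * (1 / e n)) (at t)"
        by (rule DERIV_chain2[OF smooth_step_derivative]) (use en in \<open>auto intro!: derivative_eq_intros\<close>)
      then show "((\<lambda>t. smooth_step ((t - r) / e n)) has_vector_derivative ?k t) (at t within {0..1})"
        by (simp add: has_real_derivative_iff_has_vector_derivative has_vector_derivative_at_within)
    qed simp
    moreover have "smooth_step ((1 - r) / e n) = 1" "smooth_step ((0 - r) / e n) = 0"
      using en er[of n] by (auto intro!: hat_properties simp: field_simps)
    ultimately have k1: "(?k has_integral 1) {0..1}" by simp
    have "((\<lambda>t. ?k t *\<^sub>R F t) has_integral integral {0..1} (\<lambda>t. ?k t *\<^sub>R F t)) {0..1}"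
      by (intro integrable_integral integrable_continuous_real continuous_on_scaleR ck F)
    moreover have "((\<lambda>t. ?k t *\<^sub>R F r) has_integral 1 *\<^sub>R F r) {0..1}"
      by (rule has_integral_scaleR_left[OF k1])
    ultimately have "((\<lambda>t. ?k t *\<^sub>R F t - ?k t *\<^sub>R F r) has_integral integral {0..1} (\<lambda>t. ?k t *\<^sub>R F t) - 1 *\<^sub>R F r) {0..1}"
      by (rule has_integral_diff)
    then have D: "((\<lambda>t. ?k t *\<^sub>R (F t - F r)) has_integral integral {0..1} (\<lambda>t. ?k t *\<^sub>R F t) - F r) {0..1}"
      by (simp add: scaleR_diff_right)
    have "norm (integral {0..1} (\<lambda>t. ?k t *\<^sub>R (F t - F r))) \<le> integral {0..1} (\<lambda>t. ?k t * (\<epsilon> / 2))"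
    proof (rule integral_norm_bound_integral)
      show "(\<lambda>t. ?k t *\<^sub>R (F t - F r)) integrable_on {0..1}" using D by blast
      show "(\<lambda>t. ?k t * (\<epsilon> / 2)) integrable_on {0..1}" by (intro integrable_continuous_real continuous_intros ck)
      fix t :: real assume t: "t \<in> {0..1}"
      show "norm (?k t *\<^sub>R (F t - F r)) \<le> ?k t * (\<epsilon> / 2)"
      proof (cases "dist t r < \<delta>")
        case True
        then have "norm (F t - F r) \<le> \<epsilon> / 2" using \<delta>(2)[OF t True] by (simp add: dist_norm)
        moreover have "?k t \<ge> 0" using en hat_properties(1)[of "(t - r) / e n"] by simp
        ultimately have "?k t * norm (F t - F r) \<le> ?k t * (\<epsilon> / 2)" by (rule mult_left_mono)
        then show ?thesis using \<open>?k t \<ge> 0\<close> by (simp only: norm_scaleR real_norm_def abs_of_nonneg)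
      next
        case False
        then have "hat ((t - r) / e n) = 0"
          using en N[OF n] by (intro hat_properties(2)) (simp add: dist_real_def field_simps)
        then show ?thesis by simp
      qed
    qed
    also have "\<dots> = \<epsilon> / 2" using integral_unique[OF has_integral_mult_left[OF k1, of "\<epsilon> / 2"]] by (simp only: mult_1)
    also have "\<dots> < \<epsilon>" using \<open>\<epsilon> > 0\<close> by simp
    finally show "norm (integral {0..1} (\<lambda>t. ?k t *\<^sub>R F t) - F r) < \<epsilon>" using integral_unique[OF D] by simp
  qed
qed

text \<open>The test functions are smoothed indicators of [r, s]. Their derivatives are a tent at r
  minus a tent at s, so the left side of the weak equation tends to F r - F s, while the right side
  converges by dominated convergence with majorant |G|.\<close>

lemma H1_representation_open:
  fixes F :: "real \<Rightarrow> 'a::euclidean_space"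
  assumes F: "continuous_on {0..1} F" and G: "L2_unit G" and wd: "is_weak_deriv F G"
    and rs: "0 < r" "r < s" "s < 1"
  shows "F s - F r = integral {r..s} G"
proof -
  \<comment> \<open>Half-widths at most \<open>e1 / 2\<close> keep the supports inside (0, 1) and
    the two transition zones disjoint, as \<open>ee\<close> records.\<close>
  define e1 where "e1 = min (min r (1 - s)) ((s - r) / 2)"
  define e where "e n = e1 / 2 * inverse (real (Suc n))" for n
  have e1: "e1 > 0" "e1 \<le> r" "e1 \<le> 1 - s" "e1 \<le> (s - r) / 2" using rs by (simp_all add: e1_def min_def)
  have e: "e n > 0" "e n \<le> e1 / 2" for n
  proof -
    show "e n > 0" using e1(1) by (simp add: e_def)
    have "e1 / 2 * inverse (real (Suc n)) \<le> e1 / 2 * 1"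
      using e1(1) by (intro mult_left_mono) (auto simp: inverse_le_1_iff)
    then show "e n \<le> e1 / 2" by (simp add: e_def)
  qed
  have "e \<longlonglongrightarrow> e1 / 2 * 0"
    unfolding e_def[abs_def] by (intro tendsto_intros LIMSEQ_inverse_real_of_nat)
  then have elim: "e \<longlonglongrightarrow> 0" by simp
  have ee: "0 < r - e n" "r + e n < s - e n" "s + e n < 1" for n
  proof -
    note facts = e(1)[of n] e(2)[of n] e1 rs
    show "0 < r - e n" using facts by linarith
    show "r + e n < s - e n" using facts by argo
    show "s + e n < 1" using facts by argo
  qed
  define \<phi> where "\<phi> n t = smooth_step ((t - r) / e n) - smooth_step ((t - s) / e n)" for n t
  define \<phi>' where "\<phi>' n t = hat ((t - r) / e n) / e n - hat ((t - s) / e n) / e n" for n t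
  have D: "(\<phi> n has_real_derivative \<phi>' n t) (at t)" for n t
  proof -
    have "((\<lambda>t. smooth_step ((t - r) / e n)) has_real_derivative hat ((t - r) / e n) * (1 / e n)) (at t)" for r
      by (rule DERIV_chain2[OF smooth_step_derivative]) (use e(1)[of n] in \<open>auto intro!: derivative_eq_intros\<close>)
    from DERIV_diff[OF this this] show ?thesis by (simp add: \<phi>_def[abs_def] \<phi>'_def)
  qed
  have c\<phi>': "continuous_on S (\<phi>' n)" for n S
    unfolding \<phi>'_def[abs_def]
    using e(1)[of n] by (intro continuous_intros continuous_on_compose2[OF hat_properties(3)[of UNIV]]) auto
  have c\<phi>: "continuous_on S (\<phi> n)" for n S
    using D by (meson DERIV_isCont continuous_at_imp_continuous_on)
  have C1: "\<phi> n C1_differentiable_on UNIV" for n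
    unfolding C1_differentiable_on_def
    using D c\<phi>' by (intro exI[of _ "\<phi>' n"]) (auto simp: has_real_derivative_iff_has_vector_derivative)
  have supp: "\<phi> n t = 0" if "t \<notin> {r - e n..s + e n}" for n t
  proof (cases "t < r - e n")
    case True
    then have "(t - r) / e n \<le> - 1" "(t - s) / e n \<le> - 1" using e(1)[of n] rs by (auto simp: field_simps)
    then show ?thesis by (simp add: \<phi>_def hat_properties)
  next
    case False
    then have "t > s + e n" using that by auto
    then have "(t - r) / e n \<ge> 1" "(t - s) / e n \<ge> 1" using e(1)[of n] rs by (auto simp: field_simps)
    then show ?thesis by (simp add: \<phi>_def hat_properties)
  qed
  have weak: "(LINT t|lebesgue_on {0..1}. \<phi>' n t *\<^sub>R F t) = - (LINT t|lebesgue_on {0..1}. \<phi> n t *\<^sub>R G t)" for n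
  proof -
    have "\<exists>a b. 0 < a \<and> b < 1 \<and> (\<forall>t. t \<notin> {a..b} \<longrightarrow> \<phi> n t = 0)"
      using ee[of n] supp by (intro exI[of _ "r - e n"] exI[of _ "s + e n"]) auto
    with C1[of n] have "(LINT t|lebesgue_on {0..1}. deriv (\<phi> n) t *\<^sub>R F t) = - (LINT t|lebesgue_on {0..1}. \<phi> n t *\<^sub>R G t)"
      by (intro wd[unfolded is_weak_deriv_def, rule_format] conjI)
    then show ?thesis by (simp only: DERIV_imp_deriv[OF D])
  qed
  have "(LINT t|lebesgue_on {0..1}. \<phi>' n t *\<^sub>R F t)
      = integral {0..1} (\<lambda>t. (hat ((t - r) / e n) / e n) *\<^sub>R F t) - integral {0..1} (\<lambda>t. (hat ((t - s) / e n) / e n) *\<^sub>R F t)" for n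
  proof -
    have "(LINT t|lebesgue_on {0..1}. \<phi>' n t *\<^sub>R F t) = integral {0..1} (\<lambda>t. \<phi>' n t *\<^sub>R F t)"
      by (intro lebesgue_integral_eq_integral continuous_imp_integrable_real continuous_on_scaleR c\<phi>' F) simp
    also have "\<dots> = integral {0..1} (\<lambda>t. (hat ((t - r) / e n) / e n) *\<^sub>R F t - (hat ((t - s) / e n) / e n) *\<^sub>R F t)"
      by (simp add: \<phi>'_def scaleR_diff_left)
    also have "\<dots> = integral {0..1} (\<lambda>t. (hat ((t - r) / e n) / e n) *\<^sub>R F t) - integral {0..1} (\<lambda>t. (hat ((t - s) / e n) / e n) *\<^sub>R F t)"
      using e(1)[of n]
      by (intro integral_diff integrable_continuous_real continuous_intros F continuous_on_compose2[OF hat_properties(3)[of UNIV]]) auto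
    finally show ?thesis .
  qed
  moreover have "(\<lambda>n. integral {0..1} (\<lambda>t. (hat ((t - r) / e n) / e n) *\<^sub>R F t)
      - integral {0..1} (\<lambda>t. (hat ((t - s) / e n) / e n) *\<^sub>R F t)) \<longlonglongrightarrow> F r - F s"
  proof (rule tendsto_diff)
    have "0 \<le> r - e n" "r + e n \<le> 1" "0 \<le> s - e n" "s + e n \<le> 1" for n using ee[of n] e(1)[of n] by auto
    then show "(\<lambda>n. integral {0..1} (\<lambda>t. (hat ((t - r) / e n) / e n) *\<^sub>R F t)) \<longlonglongrightarrow> F r"
      "(\<lambda>n. integral {0..1} (\<lambda>t. (hat ((t - s) / e n) / e n) *\<^sub>R F t)) \<longlonglongrightarrow> F s"
      using rs by (auto intro!: hat_average_tendsto[OF F _ _ e(1) elim])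
  qed
  ultimately have lim1: "(\<lambda>n. LINT t|lebesgue_on {0..1}. \<phi>' n t *\<^sub>R F t) \<longlonglongrightarrow> F r - F s" by simp
  define G0 where "G0 t = (if t \<in> {r..s} then G t else 0)" for t
  have mG: "G \<in> borel_measurable (lebesgue_on {0..1})" using G by (simp add: L2_unit_def)
  have m\<phi>: "\<phi> n \<in> borel_measurable (lebesgue_on {0..1})" for n
    by (rule continuous_imp_measurable_on_sets_lebesgue[OF c\<phi>]) simp
  have conv: "(\<lambda>n. \<phi> n t *\<^sub>R G t) \<longlonglongrightarrow> G0 t" if t: "t \<noteq> r" "t \<noteq> s" for t
  proof -
    define \<delta> where "\<delta> = min \<bar>t - r\<bar> \<bar>t - s\<bar>"
    have "\<delta> > 0" using t by (simp add: \<delta>_def)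
    then have "\<forall>\<^sub>F n in sequentially. e n < \<delta>" using elim order_tendstoD(2) by blast
    then have "\<forall>\<^sub>F n in sequentially. \<phi> n t *\<^sub>R G t = G0 t"
    proof eventually_elim
      case (elim n)
      have en: "e n > 0" "e n < \<bar>t - r\<bar>" "e n < \<bar>t - s\<bar>" using elim e(1)[of n] by (auto simp: \<delta>_def)
      consider "t < r" | "r < t" "t < s" | "s < t" using t by linarith
      then show ?case
      proof cases
        case 1
        then have "(t - r) / e n \<le> - 1" "(t - s) / e n \<le> - 1" using en rs by (auto simp: field_simps)
        then show ?thesis using 1 by (simp add: \<phi>_def G0_def hat_properties)
      next
        case 2
        then have "(t - r) / e n \<ge> 1" "(t - s) / e n \<le> - 1" using en rs by (auto simp: field_simps)
        then show ?thesis using 2 by (simp add: \<phi>_def G0_def hat_properties)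
      next
        case 3
        then have "(t - r) / e n \<ge> 1" "(t - s) / e n \<ge> 1" using en rs by (auto simp: field_simps)
        then show ?thesis using 3 rs by (simp add: \<phi>_def G0_def hat_properties)
      qed
    qed
    then show ?thesis by (rule tendsto_eventually)
  qed
  have "(\<lambda>n. LINT t|lebesgue_on {0..1}. \<phi> n t *\<^sub>R G t) \<longlonglongrightarrow> (LINT t|lebesgue_on {0..1}. G0 t)"
  proof (rule integral_dominated_convergence[where w = "\<lambda>t. norm (G t)"])
    show "G0 \<in> borel_measurable (lebesgue_on {0..1})"
      unfolding G0_def[abs_def] by (rule measurable_If_set[OF mG]) (auto simp: sets_restrict_space_iff)
    show "(\<lambda>t. \<phi> n t *\<^sub>R G t) \<in> borel_measurable (lebesgue_on {0..1})" for n
      using m\<phi> mG by (rule borel_measurable_scaleR)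
    show "integrable (lebesgue_on {0..1}) (\<lambda>t. norm (G t))"
      by (rule integrable_norm[OF L2_unit_integrable[OF G]])
    have "\<bar>\<phi> n t\<bar> \<le> 1" for n t
      unfolding \<phi>_def using hat_properties(6,7)[of "(t - r) / e n"] hat_properties(6,7)[of "(t - s) / e n"]
      by (simp add: abs_le_iff)
    then show "AE t in lebesgue_on {0..1}. norm (\<phi> n t *\<^sub>R G t) \<le> norm (G t)" for n
      by (simp add: mult_left_le_one_le)
    have "{r, s} \<in> null_sets (lebesgue_on {0..1})"
      using rs by (intro null_sets_restrict_space[THEN iffD2]) (auto intro: negligible_finite[unfolded negligible_iff_null_sets])
    then show "AE t in lebesgue_on {0..1}. (\<lambda>n. \<phi> n t *\<^sub>R G t) \<longlonglongrightarrow> G0 t"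
      by (rule AE_I') (use conv in auto)
  qed
  then have "(\<lambda>n. LINT t|lebesgue_on {0..1}. \<phi>' n t *\<^sub>R F t) \<longlonglongrightarrow> - (LINT t|lebesgue_on {0..1}. G0 t)"
    unfolding weak by (rule tendsto_minus)
  with lim1 have "F r - F s = - (LINT t|lebesgue_on {0..1}. G0 t)" by (rule LIMSEQ_unique)
  moreover have "(LINT t|lebesgue_on {0..1}. G0 t) = integral {r..s} G"
  proof -
    have "(LINT t|lebesgue_on {0..1}. G0 t) = (LINT t|lebesgue_on ({r..s} \<inter> {0..1}). G t)"
      unfolding G0_def by (rule Lebesgue_Measure.integral_restrict_Int) auto
    also have "{r..s} \<inter> {0..1} = {r..s}" using rs by auto
    also have "(LINT t|lebesgue_on {r..s}. G t) = integral {r..s} G"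
    proof (rule lebesgue_integral_eq_integral)
      show "integrable (lebesgue_on {r..s}) G"
        by (rule Equivalence_Lebesgue_Henstock_Integration.integrable_subinterval[OF L2_unit_integrable[OF G]]) (use rs in auto)
    qed simp
    finally show ?thesis .
  qed
  ultimately show ?thesis by (metis minus_diff_eq minus_minus)
qed

text \<open>The difference between F and the primitive of G is constant on the open interval; both
  are continuous up to the end points, so the constant extends.\<close>

lemma H1_representation:
  fixes F :: "real \<Rightarrow> 'a::euclidean_space"
  assumes F: "continuous_on {0..1} F" and G: "L2_unit G" and wd: "is_weak_deriv F G"
    and rs: "0 \<le> r" "r \<le> s" "s \<le> 1"
  shows "F s - F r = integral {r..s} G"
proof -
  have iG: "G integrable_on {0..1}" by (rule integrable_on_lebesgue_on[OF L2_unit_integrable[OF G]]) simp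
  define g where "g t = F t - integral {0..t} G" for t
  have split: "integral {0..u} G + integral {u..v} G = integral {0..v} G" if "0 \<le> u" "u \<le> v" "v \<le> 1" for u v
    by (rule Henstock_Kurzweil_Integration.integral_combine[OF that(1,2)], rule integrable_subinterval_real[OF iG])
       (use that in auto)
  have eq: "g u = g v" if "0 < u" "u < v" "v < 1" for u v
    using H1_representation_open[OF F G wd that] split[of u v] that by (simp add: g_def algebra_simps)
  have open_const: "g u = g (1/2)" if "u \<in> {0<..<1}" for u
  proof (cases u "1/2 :: real" rule: linorder_cases)
    case less
    then show ?thesis using that by (intro eq) auto
  next
    case greater
    then have "g (1/2) = g u" using that by (intro eq) auto
    then show ?thesis by simp
  next
    case equal
    then show ?thesis by (rule arg_cong)
  qed
  have "continuous_on {0..1} g"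
    unfolding g_def[abs_def] by (intro continuous_on_diff F indefinite_integral_continuous_1 iG)
  moreover have cl: "closure {0<..<1} = {0..1::real}" by (rule closure_greaterThanLessThan) simp
  ultimately have cg: "continuous_on (closure {0<..<1}) g" by simp
  have "g u = g (1/2)" if "u \<in> {0..1}" for u
    by (rule continuous_constant_on_closure[OF cg open_const]) (simp_all only: cl that)
  from trans[OF this[of s] sym[OF this[of r]]] have "g s = g r" using rs by simp
  then have "F s - F r = integral {0..s} G - integral {0..r} G" by (simp add: g_def algebra_simps)
  then show ?thesis using split[OF rs] by (metis add_diff_cancel_left')
qed

lemma weak_deriv_spec:
  assumes "F \<in> H1_unit"
  shows "L2_unit (weak_deriv F)" "is_weak_deriv F (weak_deriv F)"
proof -
  have "\<exists>G. L2_unit G \<and> is_weak_deriv F G" using assms by (simp add: H1_unit_def)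
  from someI_ex[OF this] show "L2_unit (weak_deriv F)" "is_weak_deriv F (weak_deriv F)"
    by (simp_all add: weak_deriv_def)
qed

lemma J1_eq_integral:
  assumes "F \<in> H1_unit"
  shows "(\<lambda>t. (norm (weak_deriv F t))\<^sup>2) integrable_on {0..1}"
    and "(\<lambda>t. norm (weak_deriv F t)) integrable_on {0..1}"
    and "J1 F = integral {0..1} (\<lambda>t. (norm (weak_deriv F t))\<^sup>2)"
proof -
  note L2 = weak_deriv_spec(1)[OF assms]
  show "(\<lambda>t. (norm (weak_deriv F t))\<^sup>2) integrable_on {0..1}"
    by (rule integrable_on_lebesgue_on) (use L2 in \<open>auto simp: L2_unit_def\<close>)
  show "(\<lambda>t. norm (weak_deriv F t)) integrable_on {0..1}"
    by (rule integrable_on_lebesgue_on[OF integrable_norm[OF L2_unit_integrable[OF L2]]]) simp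
  show "J1 F = integral {0..1} (\<lambda>t. (norm (weak_deriv F t))\<^sup>2)"
    unfolding J1_def by (rule lebesgue_integral_eq_integral) (use L2 in \<open>auto simp: L2_unit_def\<close>)
qed

text \<open>\<open>weak_deriv\<close> is an arbitrary choice. Two weak derivatives have the same
  integral over every subinterval and hence agree almost everywhere, so the energy may be computed
  from any of them.\<close>

lemma J1_eq:
  fixes F :: "real \<Rightarrow> 'a::euclidean_space"
  assumes F: "F \<in> H1_unit" and G: "L2_unit G" "is_weak_deriv F G"
  shows "J1 F = (LINT t|lebesgue_on {0..1}. (norm (G t))\<^sup>2)"
proof -
  let ?W = "weak_deriv F"
  note W = weak_deriv_spec[OF F]
  have cF: "continuous_on {0..1} F" using F by (simp add: H1_unit_def)
  have int: "?W integrable_on {0..1}" "G integrable_on {0..1}"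
    by (rule integrable_on_lebesgue_on, rule L2_unit_integrable, rule W G, simp)+
  have H: "integrable (lebesgue_on {0..1}) (\<lambda>t. ?W t - G t)"
    by (rule Bochner_Integration.integrable_diff[OF L2_unit_integrable[OF W(1)] L2_unit_integrable[OF G(1)]])
  have "((\<lambda>t. norm (?W t - G t)) has_integral 0) {0..1}"
  proof (rule integral_subintervals_zero_imp_norm)
    show "(\<lambda>t. ?W t - G t) integrable_on {0..1}" by (intro integrable_diff int)
    fix r s :: real assume rs: "0 \<le> r" "r \<le> s" "s \<le> 1"
    have "?W integrable_on {r..s}" "G integrable_on {r..s}"
      by (rule integrable_subinterval_real[OF int(1)] integrable_subinterval_real[OF int(2)], use rs in auto)+
    then have "integral {r..s} (\<lambda>t. ?W t - G t) = integral {r..s} ?W - integral {r..s} G"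
      by (rule integral_diff)
    then show "integral {r..s} (\<lambda>t. ?W t - G t) = 0"
      using H1_representation[OF cF W rs] H1_representation[OF cF G rs] by simp
  qed
  then have "(LINT t|lebesgue_on {0..1}. norm (?W t - G t)) = 0"
    using lebesgue_integral_eq_integral[OF integrable_norm[OF H]] by (simp add: integral_unique)
  then have "AE t in lebesgue_on {0..1}. norm (?W t - G t) = 0"
    using integral_nonneg_eq_0_iff_AE[OF integrable_norm[OF H]] by simp
  then have "AE t in lebesgue_on {0..1}. (norm (?W t))\<^sup>2 = (norm (G t))\<^sup>2" by eventually_elim simp
  then show ?thesis
    unfolding J1_def using W(1) G(1) by (intro integral_cong_AE) (auto simp: L2_unit_def)
qed

text \<open>Integration by parts for \<phi> F, where the fundamental theorem tolerates finitely many
  exceptional points; boundedness of \<open>G\<close> puts it in L2.\<close>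

lemma piecewise_weak_deriv:
  fixes F :: "real \<Rightarrow> 'a::euclidean_space"
  assumes F: "continuous_on {0..1} F" and P: "finite P"
    and D: "\<And>t. t \<in> {0<..<1} - P \<Longrightarrow> (F has_vector_derivative G t) (at t)"
    and mG: "G \<in> borel_measurable (lebesgue_on {0..1})" and bG: "\<And>t. norm (G t) \<le> B"
  shows "L2_unit G" "is_weak_deriv F G" "F \<in> H1_unit"
proof -
  interpret fin: finite_measure "lebesgue_on {0..1::real}" by (rule finite_measure_lebesgue_on) simp
  have "integrable (lebesgue_on {0..1}) (\<lambda>t. (norm (G t))\<^sup>2)"
    by (rule fin.integrable_const_bound[of _ "B\<^sup>2"]) (use mG bG in \<open>auto intro!: power_mono\<close>)
  then show L2: "L2_unit G" using mG by (simp add: L2_unit_def)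
  have iG: "integrable (lebesgue_on {0..1}) G" by (rule L2_unit_integrable[OF L2])
  show wd: "is_weak_deriv F G"
    unfolding is_weak_deriv_def
  proof (intro allI impI, elim conjE exE)
    fix \<phi> :: "real \<Rightarrow> real" and a b :: real
    assume C1: "\<phi> C1_differentiable_on UNIV" and ab: "0 < a" "b < 1" and supp: "\<forall>t. t \<notin> {a..b} \<longrightarrow> \<phi> t = 0"
    obtain \<phi>' where "(\<forall>t\<in>UNIV. (\<phi> has_vector_derivative \<phi>' t) (at t)) \<and> continuous_on UNIV \<phi>'"
      using C1 unfolding C1_differentiable_on_def by (elim exE)
    then have p: "\<And>t. (\<phi> has_vector_derivative \<phi>' t) (at t)" "continuous_on UNIV \<phi>'" by simp_all
    have der: "deriv \<phi> t = \<phi>' t" for t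
      using p(1)[of t] by (intro DERIV_imp_deriv) (simp add: has_real_derivative_iff_has_vector_derivative)
    have c\<phi>: "continuous_on S \<phi>" for S
      using has_vector_derivative_continuous[OF p(1)] by (intro continuous_at_imp_continuous_on) auto
    have "((\<lambda>t. \<phi> t *\<^sub>R G t + \<phi>' t *\<^sub>R F t) has_integral (\<phi> 1 *\<^sub>R F 1 - \<phi> 0 *\<^sub>R F 0)) {0..1}"
    proof (rule fundamental_theorem_of_calculus_interior_strong[OF P])
      fix t assume "t \<in> {0<..<1} - P"
      from bounded_bilinear.has_vector_derivative[OF bounded_bilinear_scaleR p(1) D[OF this]]
      show "((\<lambda>t. \<phi> t *\<^sub>R F t) has_vector_derivative \<phi> t *\<^sub>R G t + \<phi>' t *\<^sub>R F t) (at t)" .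
    qed (use continuous_on_scaleR[OF c\<phi> F] in auto)
    moreover have "\<phi> 0 = 0" "\<phi> 1 = 0" using supp ab by auto
    ultimately have I: "((\<lambda>t. \<phi> t *\<^sub>R G t + \<phi>' t *\<^sub>R F t) has_integral 0) {0..1}" by simp
    have "bounded (\<phi> ` {0..1})" by (intro compact_imp_bounded compact_continuous_image c\<phi>) simp
    then obtain K where "\<forall>x\<in>\<phi> ` {0..1}. norm x \<le> K" unfolding bounded_iff by (elim exE)
    then have K: "norm (\<phi> t) \<le> K" if "t \<in> {0..1}" for t using that by simp
    have m\<phi>: "\<phi> \<in> borel_measurable (lebesgue_on {0..1})"
      by (rule continuous_imp_measurable_on_sets_lebesgue[OF c\<phi>]) simp
    have i1: "integrable (lebesgue_on {0..1}) (\<lambda>t. \<phi> t *\<^sub>R G t)"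
    proof (rule fin.integrable_const_bound[of _ "K * B"])
      show "AE t in lebesgue_on {0..1}. norm (\<phi> t *\<^sub>R G t) \<le> K * B"
      proof (rule AE_I2)
        fix t assume "t \<in> space (lebesgue_on {0..1::real})"
        then have t: "t \<in> {0..1}" by simp
        have "norm (\<phi> t) * norm (G t) \<le> K * B"
          using K[OF t] order_trans[OF norm_ge_zero K[OF t]] by (intro mult_mono bG) auto
        then show "norm (\<phi> t *\<^sub>R G t) \<le> K * B" by simp
      qed
      show "(\<lambda>t. \<phi> t *\<^sub>R G t) \<in> borel_measurable (lebesgue_on {0..1})" by (rule borel_measurable_scaleR[OF m\<phi> mG])
    qed
    have i2: "integrable (lebesgue_on {0..1}) (\<lambda>t. \<phi>' t *\<^sub>R F t)"
      by (intro continuous_imp_integrable_real continuous_on_scaleR F continuous_on_subset[OF p(2)]) simp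
    have "(LINT t|lebesgue_on {0..1}. \<phi> t *\<^sub>R G t + \<phi>' t *\<^sub>R F t) = 0"
      using lebesgue_integral_eq_integral[OF Bochner_Integration.integrable_add[OF i1 i2]] integral_unique[OF I] by simp
    then have "(LINT t|lebesgue_on {0..1}. \<phi> t *\<^sub>R G t) + (LINT t|lebesgue_on {0..1}. \<phi>' t *\<^sub>R F t) = 0"
      by (simp only: Bochner_Integration.integral_add[OF i1 i2])
    then show "(LINT t|lebesgue_on {0..1}. deriv \<phi> t *\<^sub>R F t) = - (LINT t|lebesgue_on {0..1}. \<phi> t *\<^sub>R G t)"
      unfolding der by (simp add: eq_neg_iff_add_eq_0 add.commute)
  qed
  have "continuous_on {0..1} (\<lambda>t. (norm (F t))\<^sup>2)" by (intro continuous_intros F)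
  then have "L2_unit F"
    unfolding L2_unit_def
    by (intro conjI continuous_imp_measurable_on_sets_lebesgue[OF F] continuous_imp_integrable_real) auto
  then show "F \<in> H1_unit" using F L2 wd by (auto simp: H1_unit_def)
qed

text \<open>The inequality f \<le> c + \<epsilon> + (f - c)^2 / \<epsilon> transfers the vanishing
  quadratic deviation to the integral of f, up to an error \<epsilon> (s - r).\<close>

lemma integral_deviation_zero:
  fixes f :: "real \<Rightarrow> real"
  assumes f: "f integrable_on {a..b}" and f2: "(\<lambda>t. (f t)\<^sup>2) integrable_on {a..b}"
    and z: "integral {a..b} (\<lambda>t. (f t - c)\<^sup>2) \<le> 0" and rs: "a \<le> r" "r \<le> s" "s \<le> b"
  shows "integral {r..s} f \<le> c * (s - r)"
proof (rule field_le_epsilon)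
  have isq: "(\<lambda>t. (f t - c)\<^sup>2) integrable_on {a..b}"
  proof -
    have "(\<lambda>t. (f t)\<^sup>2 - 2 * c * f t + c\<^sup>2) integrable_on {a..b}"
      by (intro integrable_add integrable_diff f2 integrable_on_mult_right f integrable_const_ivl)
    then show ?thesis by (simp add: power2_eq_square algebra_simps)
  qed
  have sub: "{r..s} \<subseteq> {a..b}" using rs by auto
  note isq' = integrable_subinterval_real[OF isq sub] and f' = integrable_subinterval_real[OF f sub]
  have "integral {r..s} (\<lambda>t. (f t - c)\<^sup>2) \<le> integral {a..b} (\<lambda>t. (f t - c)\<^sup>2)"
    by (rule integral_subset_le[OF sub isq' isq]) simp
  with z have z': "integral {r..s} (\<lambda>t. (f t - c)\<^sup>2) \<le> 0" by simp
  fix e :: real assume e: "e > 0"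
  define \<epsilon> where "\<epsilon> = e / (s - r + 1)"
  have eps: "\<epsilon> > 0" "\<epsilon> * (s - r) \<le> e" using e rs by (auto simp: \<epsilon>_def field_simps)
  have "((\<lambda>t. (c + \<epsilon>) + (f t - c)\<^sup>2 / \<epsilon>) has_integral
      (s - r) * (c + \<epsilon>) + integral {r..s} (\<lambda>t. (f t - c)\<^sup>2) / \<epsilon>) {r..s}"
    using has_integral_const_real[of "c + \<epsilon>" r s] rs
    by (intro has_integral_add has_integral_divide integrable_integral isq') auto
  moreover have "f t \<le> (c + \<epsilon>) + (f t - c)\<^sup>2 / \<epsilon>" for t
  proof (cases "f t - c \<le> \<epsilon>")
    case True
    moreover have "0 \<le> (f t - c)\<^sup>2 / \<epsilon>" using eps by simp
    ultimately show ?thesis by argo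
  next
    case False
    then have "(f t - c) * \<epsilon> \<le> (f t - c)\<^sup>2" using eps by (simp add: power2_eq_square mult_left_mono)
    then have "f t - c \<le> (f t - c)\<^sup>2 / \<epsilon>" using eps by (simp add: pos_le_divide_eq)
    then show ?thesis using eps by simp
  qed
  ultimately have "integral {r..s} f \<le> (s - r) * (c + \<epsilon>) + integral {r..s} (\<lambda>t. (f t - c)\<^sup>2) / \<epsilon>"
    by (intro has_integral_le[OF integrable_integral[OF f']])
  moreover have "integral {r..s} (\<lambda>t. (f t - c)\<^sup>2) / \<epsilon> \<le> 0" using z' eps by (simp add: divide_le_0_iff)
  ultimately show "integral {r..s} f \<le> c * (s - r) + e" using eps(2) by (simp add: algebra_simps)
qed

section \<open>Energy, length and distance for H1 maps\<close>

context closed_submanifold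
begin

context
  fixes F :: "real \<Rightarrow> 'a"
  assumes F: "F \<in> H1_maps M"
begin

private abbreviation "W \<equiv> weak_deriv F"

private lemma H1: "F \<in> H1_unit" and FM: "\<And>t. t \<in> {0..1} \<Longrightarrow> F t \<in> M"
  using F by (auto simp: H1_maps_def)

private lemma contF: "continuous_on {0..1} F" using H1 by (simp add: H1_unit_def)

private lemmas W_rep = H1_representation[OF contF weak_deriv_spec[OF H1]]
private lemmas W_int = J1_eq_integral(1,2)[OF H1]

lemma H1_displacement:
  assumes "0 \<le> r" "r \<le> s" "s \<le> 1"
  shows "norm (F s - F r) \<le> integral {r..s} (\<lambda>t. norm (W t))"
  unfolding W_rep[OF assms]
proof (rule integral_norm_bound_integral)
  have "W integrable_on {0..1}"
    by (rule integrable_on_lebesgue_on[OF L2_unit_integrable[OF weak_deriv_spec(1)[OF H1]]]) simp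
  then show "W integrable_on {r..s}" by (rule integrable_subinterval_real) (use assms in auto)
  show "(\<lambda>t. norm (W t)) integrable_on {r..s}"
    by (rule integrable_subinterval_real[OF W_int(2)]) (use assms in auto)
qed simp

text \<open>\<open>d_le_variation\<close>, with the primitive of the norm of the weak derivative as
  \<Lambda>.\<close>

lemma H1_dist_le:
  assumes "0 \<le> r" "r \<le> s" "s \<le> 1"
  shows "d (F r) (F s) \<le> integral {r..s} (\<lambda>t. norm (W t))"
proof -
  define \<Lambda> where "\<Lambda> t = integral {0..t} (\<lambda>t. norm (W t))" for t
  have split: "integral {u..v} (\<lambda>t. norm (W t)) = \<Lambda> v - \<Lambda> u" if "0 \<le> u" "u \<le> v" "v \<le> 1" for u v
  proof -
    have "(\<lambda>t. norm (W t)) integrable_on {0..v}"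
      by (rule integrable_subinterval_real[OF W_int(2)]) (use that in auto)
    from Henstock_Kurzweil_Integration.integral_combine[OF that(1,2) this] show ?thesis by (simp add: \<Lambda>_def)
  qed
  have "d (F r) (F s) \<le> \<Lambda> s - \<Lambda> r"
  proof (rule d_le_variation[OF assms(2)])
    show "continuous_on {r..s} F" by (rule continuous_on_subset[OF contF]) (use assms in auto)
    show "F ` {r..s} \<subseteq> M" using FM assms by auto
    fix u v assume uv: "r \<le> u" "u \<le> v" "v \<le> s"
    then have "0 \<le> u" "v \<le> 1" using assms by auto
    from H1_displacement[OF this(1) uv(2) this(2)] split[OF this(1) uv(2) this(2)]
    show "norm (F v - F u) \<le> \<Lambda> v - \<Lambda> u" by simp
  qed
  then show ?thesis using split[OF assms] by simp
qed

text \<open>The expansion of a square whose nonnegativity gives the energy bound and whose vanishing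
  characterises equality.\<close>

lemma H1_deviation:
  assumes ab: "0 \<le> a" "a \<le> b" "b \<le> 1"
  shows "integral {a..b} (\<lambda>t. (norm (W t) - c)\<^sup>2) = integral {a..b} (\<lambda>t. (norm (W t))\<^sup>2)
    - 2 * c * integral {a..b} (\<lambda>t. norm (W t)) + c\<^sup>2 * (b - a)"
    and "0 \<le> integral {a..b} (\<lambda>t. (norm (W t) - c)\<^sup>2)"
proof -
  have sub: "{a..b} \<subseteq> {0..1}" using ab by auto
  have "((\<lambda>t. (norm (W t))\<^sup>2 - 2 * c * norm (W t) + c\<^sup>2) has_integral (integral {a..b} (\<lambda>t. (norm (W t))\<^sup>2)
    - 2 * c * integral {a..b} (\<lambda>t. norm (W t)) + (b - a) * c\<^sup>2)) {a..b}"
    using has_integral_const_real[of "c\<^sup>2" a b] ab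
    by (intro has_integral_add has_integral_diff has_integral_mult_right integrable_integral
        integrable_subinterval_real[OF W_int(1) sub] integrable_subinterval_real[OF W_int(2) sub]) auto
  moreover have "(norm (W t))\<^sup>2 - 2 * c * norm (W t) + c\<^sup>2 = (norm (W t) - c)\<^sup>2" for t
    by (simp add: power2_eq_square algebra_simps)
  ultimately have I: "((\<lambda>t. (norm (W t) - c)\<^sup>2) has_integral (integral {a..b} (\<lambda>t. (norm (W t))\<^sup>2)
    - 2 * c * integral {a..b} (\<lambda>t. norm (W t)) + (b - a) * c\<^sup>2)) {a..b}" by (simp only:)
  then show "integral {a..b} (\<lambda>t. (norm (W t) - c)\<^sup>2) = integral {a..b} (\<lambda>t. (norm (W t))\<^sup>2)
    - 2 * c * integral {a..b} (\<lambda>t. norm (W t)) + c\<^sup>2 * (b - a)"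
    by (simp add: integral_unique mult.commute)
  show "0 \<le> integral {a..b} (\<lambda>t. (norm (W t) - c)\<^sup>2)"
    by (rule integral_nonneg) (use I in auto)
qed

lemma H1_energy_lower_bound:
  assumes ab: "0 \<le> a" "a < b" "b \<le> 1"
  shows "(d (F a) (F b))\<^sup>2 / (b - a) \<le> integral {a..b} (\<lambda>t. (norm (W t))\<^sup>2)"
proof -
  define c where "c = d (F a) (F b) / (b - a)"
  have dc: "d (F a) (F b) = c * (b - a)" using ab by (simp add: c_def)
  have c0: "c \<ge> 0" using d_nonneg[OF FM FM, of a b] ab by (simp add: c_def)
  have "c * (c * (b - a)) \<le> c * integral {a..b} (\<lambda>t. norm (W t))"
    using H1_dist_le[of a b] ab c0 by (intro mult_left_mono) (auto simp: dc)
  moreover have "0 \<le> integral {a..b} (\<lambda>t. (norm (W t))\<^sup>2) - 2 * c * integral {a..b} (\<lambda>t. norm (W t)) + c\<^sup>2 * (b - a)"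
    using H1_deviation[of a b c] ab by simp
  ultimately have "c\<^sup>2 * (b - a) \<le> integral {a..b} (\<lambda>t. (norm (W t))\<^sup>2)"
    by (simp add: power2_eq_square algebra_simps)
  moreover have "(d (F a) (F b))\<^sup>2 / (b - a) = c\<^sup>2 * (b - a)" using ab by (simp add: dc power2_eq_square)
  ultimately show ?thesis by simp
qed

text \<open>Equality makes the quadratic deviation of the speed from c vanish, which bounds
  \<open>d\<close> by c (s - r) on each subinterval. As the whole interval realises c (b - a), the
  triangle inequality over three pieces makes each bound an equality.\<close>

lemma H1_energy_equality:
  assumes ab: "0 \<le> a" "a < b" "b \<le> 1"
    and eq: "integral {a..b} (\<lambda>t. (norm (W t))\<^sup>2) \<le> (d (F a) (F b))\<^sup>2 / (b - a)"
  shows "metric_geodesic a b (d (F a) (F b) / (b - a)) F"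
proof -
  define c where "c = d (F a) (F b) / (b - a)"
  have dc: "d (F a) (F b) = c * (b - a)" using ab by (simp add: c_def)
  have c0: "c \<ge> 0" using d_nonneg[OF FM FM, of a b] ab by (simp add: c_def)
  have "c * (c * (b - a)) \<le> c * integral {a..b} (\<lambda>t. norm (W t))"
    using H1_dist_le[of a b] ab c0 by (intro mult_left_mono) (auto simp: dc)
  moreover have "integral {a..b} (\<lambda>t. (norm (W t))\<^sup>2) \<le> c\<^sup>2 * (b - a)"
    using eq ab by (simp add: dc power2_eq_square)
  ultimately have "integral {a..b} (\<lambda>t. (norm (W t) - c)\<^sup>2) \<le> 0"
    using H1_deviation(1)[of a b c] ab by (simp add: power2_eq_square algebra_simps)
  moreover have sub: "{a..b} \<subseteq> {0..1}" using ab by auto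
  ultimately have le: "d (F r) (F s) \<le> c * (s - r)" if "a \<le> r" "r \<le> s" "s \<le> b" for r s
    using integral_deviation_zero[OF integrable_subinterval_real[OF W_int(2) sub]
        integrable_subinterval_real[OF W_int(1) sub] _ that] H1_dist_le[of r s] that ab by force
  have M: "F t \<in> M" if "a \<le> t" "t \<le> b" for t using FM[of t] that ab by simp
  have "d (F r) (F s) = c * (s - r)" if rs: "a \<le> r" "r \<le> s" "s \<le> b" for r s
  proof -
    have "F a \<in> M" "F b \<in> M" "F r \<in> M" "F s \<in> M" using rs M ab by auto
    then have "c * (b - a) \<le> d (F a) (F r) + (d (F r) (F s) + d (F s) (F b))"
      unfolding dc[symmetric] using triangle[of "F a" "F r" "F b"] triangle[of "F r" "F s" "F b"] by simp
    moreover have "d (F a) (F r) \<le> c * (r - a)" "d (F s) (F b) \<le> c * (b - s)" using rs ab by (auto intro: le)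
    ultimately show ?thesis using le[OF rs] by (simp add: algebra_simps)
  qed
  then show ?thesis unfolding metric_geodesic_def c_def[symmetric] using M by auto
qed

text \<open>The case c = 0 of the deviation argument, for the two boundary intervals.\<close>

lemma H1_zero_energy_constant:
  assumes ab: "0 \<le> a" "a \<le> b" "b \<le> 1" and z: "integral {a..b} (\<lambda>t. (norm (W t))\<^sup>2) \<le> 0" and t: "t \<in> {a..b}"
  shows "F t = F a"
proof -
  have sub: "{a..b} \<subseteq> {0..1}" using ab by auto
  have "integral {a..t} (\<lambda>t. norm (W t)) \<le> 0 * (t - a)"
    by (rule integral_deviation_zero[OF integrable_subinterval_real[OF W_int(2) sub]
        integrable_subinterval_real[OF W_int(1) sub]]) (use z t in auto)
  moreover have "norm (F t - F a) \<le> integral {a..t} (\<lambda>t. norm (W t))"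
    by (rule H1_displacement) (use ab t in auto)
  ultimately have "norm (F t - F a) \<le> 0" by linarith
  then show ?thesis by simp
qed

end

end

section \<open>The discretized regression problem\<close>

lemma ord_stat_strict_mono:
  assumes "inj_on t {1..n}" "1 \<le> i" "i < j" "j \<le> n"
  shows "ord_stat n t i < ord_stat n t j"
proof -
  let ?xs = "sort (map t [1..<Suc n])"
  have "distinct (map t [1..<Suc n])"
    using assms(1) by (auto simp: distinct_map atLeastLessThanSuc_atLeastAtMost simp del: upt_Suc)
  then have "sorted_wrt (<) ?xs" by (simp add: strict_sorted_iff del: upt_Suc)
  then show ?thesis
    unfolding ord_stat_def
    by (rule sorted_wrt_nth_less) (use assms in \<open>auto simp del: upt_Suc\<close>)
qed

lemma ord_stat_image: "ord_stat n t ` {1..n} = t ` {1..n}"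
proof -
  let ?xs = "sort (map t [1..<Suc n])"
  have len: "length ?xs = n" by simp
  have "ord_stat n t ` {1..n} = (\<lambda>k. ?xs ! k) ` ((\<lambda>i. i - 1) ` {1..n})"
    by (simp add: ord_stat_def[abs_def] image_image del: upt_Suc)
  also have "(\<lambda>i. i - 1) ` {1..n} = {..<n}"
  proof (intro equalityI subsetI)
    fix x assume "x \<in> {..<n}"
    then show "x \<in> (\<lambda>i. i - 1) ` {1..n}" by (intro image_eqI[of _ _ "Suc x"]) auto
  qed auto
  also have "(\<lambda>k. ?xs ! k) ` {..<n} = set ?xs"
  proof -
    have "set xs = (!) xs ` {..<length xs}" for xs :: "real list" by (auto simp: set_conv_nth)
    from this[of ?xs] show ?thesis by (simp only: len)
  qed
  also have "\<dots> = t ` {1..n}" by (simp add: atLeastLessThanSuc_atLeastAtMost del: upt_Suc)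
  finally show ?thesis .
qed

text \<open>Subsequences are extracted one coordinate at a time, in an induction on the finite index
  set.\<close>

lemma compact_finite_product_subsequence:
  fixes M :: "'a::metric_space set" and f :: "nat \<Rightarrow> 'i \<Rightarrow> 'a"
  assumes "compact M" "finite I" "\<And>k i. i \<in> I \<Longrightarrow> f k i \<in> M"
  shows "\<exists>r l. strict_mono (r :: nat \<Rightarrow> nat) \<and> (\<forall>i\<in>I. l i \<in> M \<and> (\<lambda>k. f (r k) i) \<longlonglongrightarrow> l i)"
  using assms(2,3)
proof (induction I rule: finite_induct)
  case empty
  show ?case by (intro exI[of _ id]) (auto simp: strict_mono_def)
next
  case (insert j I)
  then obtain r l where r: "strict_mono (r :: nat \<Rightarrow> nat)" "\<forall>i\<in>I. l i \<in> M \<and> (\<lambda>k. f (r k) i) \<longlonglongrightarrow> l i" by auto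
  have "\<forall>k. f (r k) j \<in> M" using insert.prems by simp
  then obtain x s where x: "x \<in> M" "strict_mono (s :: nat \<Rightarrow> nat)" "((\<lambda>k. f (r k) j) \<circ> s) \<longlonglongrightarrow> x"
    using assms(1) unfolding compact_def by meson
  have "(\<lambda>k. f (r (s k)) i) \<longlonglongrightarrow> l i" if "i \<in> I" for i
    using LIMSEQ_subseq_LIMSEQ[OF _ x(2), of "\<lambda>k. f (r k) i" "l i"] r(2) that by (auto simp: o_def)
  moreover have "strict_mono (r \<circ> s)" by (rule strict_mono_o[OF r(1) x(2)])
  ultimately show ?case
    using x r(2) insert.hyps(2) by (intro exI[of _ "r \<circ> s"] exI[of _ "l(j := x)"]) (auto simp: o_def)
qed

section \<open>Nodal decomposition of the regression problem\<close>

locale regression_design = closed_submanifold M m for M :: "'a::euclidean_space set" and m +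
  fixes n :: nat and t :: "nat \<Rightarrow> real" and Y :: "nat \<Rightarrow> 'a" and lam :: real
  assumes n1: "n \<ge> 1" and t01: "\<And>i. i \<in> {1..n} \<Longrightarrow> t i \<in> {0..1}" and inj_t: "inj_on t {1..n}"
    and YM: "\<And>i. i \<in> {1..n} \<Longrightarrow> Y i \<in> M" and lam: "lam > 0"
begin

abbreviation T :: "nat \<Rightarrow> real" where "T \<equiv> ord_stat n t"

lemma T_less: "1 \<le> i \<Longrightarrow> i < j \<Longrightarrow> j \<le> n \<Longrightarrow> T i < T j"
  by (rule ord_stat_strict_mono[OF inj_t])

lemma T_le: "1 \<le> i \<Longrightarrow> i \<le> j \<Longrightarrow> j \<le> n \<Longrightarrow> T i \<le> T j"
  using T_less[of i j] by (cases "i = j") auto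

lemma T_Suc: "i \<in> {1..<n} \<Longrightarrow> T i < T (i + 1)" by (rule T_less) auto

lemma T01: assumes "1 \<le> i" "i \<le> n" shows "0 \<le> T i" "T i \<le> 1"
proof -
  have "T i \<in> t ` {1..n}" using assms by (subst ord_stat_image[symmetric]) auto
  then show "0 \<le> T i" "T i \<le> 1" using t01 by auto
qed

text \<open>With half-open pieces even a node belongs to one piece only, so that an interpolant and
  its velocity can be defined piece by piece.\<close>

lemma T_piece_unique:
  assumes "i \<in> {1..<n}" "j \<in> {1..<n}" "T i \<le> s" "s < T (i + 1)" "T j \<le> s" "s < T (j + 1)"
  shows "i = j"
proof (rule ccontr)
  assume "i \<noteq> j"
  then consider "i + 1 \<le> j" | "j + 1 \<le> i" by linarith
  then show False using T_le[of "i + 1" j] T_le[of "j + 1" i] assms by cases auto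
qed

lemma T_piece_exists:
  assumes "T 1 \<le> s" "s < T n"
  shows "\<exists>i\<in>{1..<n}. T i \<le> s \<and> s < T (i + 1)"
proof -
  have "k \<le> n \<Longrightarrow> 1 \<le> k \<Longrightarrow> s < T k \<Longrightarrow> \<exists>i\<in>{1..<n}. T i \<le> s \<and> s < T (i + 1)" for k
  proof (induction k)
    case (Suc k)
    show ?case
    proof (cases "k = 0 \<or> s < T k")
      case True
      then show ?thesis using Suc assms by (cases "k = 0") auto
    next
      case False
      then show ?thesis using Suc.prems by (intro bexI[of _ k]) auto
    qed
  qed simp
  from this[of n] assms n1 show ?thesis by simp
qed

definition response :: "nat \<Rightarrow> 'a" where "response = paired_response n t Y"

lemma emp_risk_ordered: "emp_risk M n t Y F = (\<Sum>i=1..n. (d (response i) (F (T i)))\<^sup>2) / real n"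
  and response_in: "i \<in> {1..n} \<Longrightarrow> response i \<in> M"
proof -
  \<comment> \<open>The permutation that sorts the design: \<open>p i\<close> is the index of the
    observation in position i.\<close>
  define p where "p i = the_inv_into {1..n} t (T i)" for i
  have Tin: "T i \<in> t ` {1..n}" if "i \<in> {1..n}" for i using that by (subst ord_stat_image[symmetric]) auto
  have p: "p i \<in> {1..n}" "t (p i) = T i" if "i \<in> {1..n}" for i
    unfolding p_def using the_inv_into_into[OF inj_t Tin[OF that] subset_refl] f_the_inv_into_f[OF inj_t Tin[OF that]] by auto
  have "inj_on p {1..n}"
  proof (rule inj_onI)
    fix i j assume ij: "i \<in> {1..n}" "j \<in> {1..n}" "p i = p j"
    then have "T i = T j" using p by metis
    then show "i = j" using T_less[of i j] T_less[of j i] ij by (cases i j rule: linorder_cases) auto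
  qed
  moreover have "p ` {1..n} \<subseteq> {1..n}" using p by blast
  ultimately have bij: "bij_betw p {1..n} {1..n}" by (simp add: bij_betw_def endo_inj_surj)
  have resp: "response i = Y (p i)" for i by (simp add: response_def paired_response_def p_def)
  show "i \<in> {1..n} \<Longrightarrow> response i \<in> M" using YM p by (simp add: resp)
  have "(\<Sum>i=1..n. (d (Y i) (F (t i)))\<^sup>2) = (\<Sum>i=1..n. (d (Y (p i)) (F (t (p i))))\<^sup>2)"
    using sum.reindex_bij_betw[OF bij, of "\<lambda>i. (d (Y i) (F (t i)))\<^sup>2"] by simp
  also have "\<dots> = (\<Sum>i=1..n. (d (response i) (F (T i)))\<^sup>2)"
    by (rule sum.cong) (auto simp: resp p)
  finally show "emp_risk M n t Y F = (\<Sum>i=1..n. (d (response i) (F (T i)))\<^sup>2) / real n"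
    by (simp add: emp_risk_def)
qed

abbreviation Phi :: "(nat \<Rightarrow> 'a) \<Rightarrow> real" where "Phi \<equiv> phi_disc M n t Y lam"

abbreviation Risk :: "(real \<Rightarrow> 'a) \<Rightarrow> real" where "Risk \<equiv> penalized_risk M n t Y lam"

text \<open>The least energy \<open>J1\<close> compatible with nodal values in \<open>M\<close>, and
  the value of \<open>J1\<close> on every geodesic interpolant of them.\<close>

definition roughness :: "(nat \<Rightarrow> 'a) \<Rightarrow> real" where
  "roughness f = (\<Sum>i=1..<n. (d (f i) (f (i + 1)))\<^sup>2 / (T (i + 1) - T i))"

lemma Phi_eq: "Phi f = (\<Sum>i=1..n. (d (response i) (f i))\<^sup>2) / real n + lam * roughness f"
  by (simp add: phi_disc_def response_def roughness_def)

lemma Risk_eq: "Risk F = (\<Sum>i=1..n. (d (response i) (F (T i)))\<^sup>2) / real n + lam * J1 F"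
  by (simp add: penalized_risk_def emp_risk_ordered)

lemma Phi_cong:
  assumes "\<And>i. i \<in> {1..n} \<Longrightarrow> f i = g i" shows "Phi f = Phi g"
proof -
  have "roughness f = roughness g" unfolding roughness_def by (rule sum.cong) (use assms in auto)
  then show ?thesis unfolding Phi_eq using assms by simp
qed

lemma integral_pieces:
  fixes h :: "real \<Rightarrow> real"
  assumes h: "h integrable_on {0..1}"
  shows "integral {0..1} h = integral {0..T 1} h + (\<Sum>i=1..<n. integral {T i..T (i + 1)} h) + integral {T n..1} h"
proof -
  have comb: "integral {a..b} h + integral {b..c} h = integral {a..c} h" if "0 \<le> a" "a \<le> b" "b \<le> c" "c \<le> 1" for a b c
    by (rule Henstock_Kurzweil_Integration.integral_combine[OF that(2,3)], rule integrable_subinterval_real[OF h])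
       (use that in auto)
  have "k \<le> n \<Longrightarrow> 1 \<le> k \<Longrightarrow> integral {T 1..T k} h = (\<Sum>i=1..<k. integral {T i..T (i + 1)} h)" for k
  proof (induction k)
    case (Suc k)
    show ?case
    proof (cases "k = 0")
      case False
      then have k: "1 \<le> k" "k \<le> n" "Suc k \<le> n" using Suc.prems by auto
      have "0 \<le> T 1" "T 1 \<le> T k" "T k \<le> T (Suc k)" "T (Suc k) \<le> 1"
        using k n1 by (auto intro: T01 T_le)
      from comb[OF this] Suc.IH[OF k(2,1)] False show ?thesis by simp
    qed simp
  qed simp
  then have mid: "integral {T 1..T n} h = (\<Sum>i=1..<n. integral {T i..T (i + 1)} h)" using n1 by blast
  have Tn: "0 \<le> T 1" "T 1 \<le> T n" "T n \<le> 1" "0 \<le> T n" using n1 by (auto intro: T01 T_le)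
  have "integral {0..T 1} h + integral {T 1..T n} h = integral {0..T n} h" by (rule comb) (use Tn in auto)
  moreover have "integral {0..T n} h + integral {T n..1} h = integral {0..1} h" by (rule comb) (use Tn in auto)
  ultimately show ?thesis unfolding mid by simp
qed

text \<open>The energy splits at the nodes into the two boundary intervals and the design intervals.
  The total excess over the discrete value is a sum of nonnegative terms, so in the case of equality
  each vanishes: the boundary pieces are constant and every inner piece is a minimizing
  geodesic.\<close>

lemma H1_maps_lower_bound:
  assumes F: "F \<in> H1_maps M"
  shows "roughness (\<lambda>i. F (T i)) \<le> J1 F"
    and "J1 F \<le> roughness (\<lambda>i. F (T i)) \<Longrightarrow> geodesic_interpolant M n t (\<lambda>i. F (T i)) F"
proof -
  let ?e = "\<lambda>a b. integral {a..b} (\<lambda>s. (norm (weak_deriv F s))\<^sup>2)"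
  let ?q = "\<lambda>i. (d (F (T i)) (F (T (i + 1))))\<^sup>2 / (T (i + 1) - T i)"
  have H1: "F \<in> H1_unit" using F by (simp add: H1_maps_def)
  have J: "J1 F = ?e 0 (T 1) + (\<Sum>i=1..<n. ?e (T i) (T (i + 1))) + ?e (T n) 1"
    unfolding J1_eq_integral(3)[OF H1] by (rule integral_pieces[OF J1_eq_integral(1)[OF H1]])
  have nn: "0 \<le> ?e a b" if "0 \<le> a" "b \<le> 1" for a b
  proof (rule integral_nonneg)
    show "(\<lambda>s. (norm (weak_deriv F s))\<^sup>2) integrable_on {a..b}"
      by (rule integrable_subinterval_real[OF J1_eq_integral(1)[OF H1]]) (use that in auto)
  qed simp
  have bnd: "0 \<le> ?e 0 (T 1)" "0 \<le> ?e (T n) 1" using T01 n1 by (auto intro!: nn)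
  have piece: "?q i \<le> ?e (T i) (T (i + 1))" if i: "i \<in> {1..<n}" for i
    by (rule H1_energy_lower_bound[OF F _ T_Suc[OF i]]) (use i T01 in auto)
  then have le: "roughness (\<lambda>i. F (T i)) \<le> (\<Sum>i=1..<n. ?e (T i) (T (i + 1)))"
    unfolding roughness_def by (rule sum_mono)
  then show "roughness (\<lambda>i. F (T i)) \<le> J1 F" using J bnd by linarith
  assume up: "J1 F \<le> roughness (\<lambda>i. F (T i))"
  have e0: "?e 0 (T 1) \<le> 0" and e1: "?e (T n) 1 \<le> 0" using up J bnd le by linarith+
  have piece_eq: "?e (T i) (T (i + 1)) \<le> ?q i" if i: "i \<in> {1..<n}" for i
  proof -
    have "?e (T i) (T (i + 1)) - ?q i \<le> (\<Sum>i=1..<n. ?e (T i) (T (i + 1)) - ?q i)"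
      by (rule member_le_sum[OF i]) (use piece in auto)
    also have "\<dots> = (\<Sum>i=1..<n. ?e (T i) (T (i + 1))) - roughness (\<lambda>i. F (T i))"
      by (simp only: sum_subtractf roughness_def)
    also have "\<dots> \<le> 0" using up J bnd by linarith
    finally show ?thesis by simp
  qed
  show "geodesic_interpolant M n t (\<lambda>i. F (T i)) F"
    unfolding geodesic_interpolant_def
  proof (intro conjI ballI)
    fix i assume i: "i \<in> {1..<n}"
    show "minimizing_geodesic_on M (T i) (T (i + 1)) F"
      by (rule metric_geodesic_minimizing[OF T_Suc[OF i] H1_energy_equality[OF F _ T_Suc[OF i] _ piece_eq[OF i]]])
         (use i T01 in auto)
  next
    fix s assume s: "s \<in> {0..T 1}"
    show "(F has_vector_derivative 0) (at s within {0..T 1})"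
    proof (rule has_vector_derivative_transform[OF s _ has_vector_derivative_const])
      show "F u = F 0" if "u \<in> {0..T 1}" for u
        by (rule H1_zero_energy_constant[OF F _ _ _ e0 that]) (use T01 n1 in auto)
    qed
  next
    fix s assume s: "s \<in> {T n..1}"
    show "(F has_vector_derivative 0) (at s within {T n..1})"
    proof (rule has_vector_derivative_transform[OF s _ has_vector_derivative_const])
      show "F u = F (T n)" if "u \<in> {T n..1}" for u
        by (rule H1_zero_energy_constant[OF F _ _ _ e1 that]) (use T01 n1 in auto)
    qed
  qed simp
qed

lemma geodesic_interpolant_exists:
  assumes f: "f \<in> {1..n} \<rightarrow> M"
  shows "\<exists>F. geodesic_interpolant M n t f F"
proof -
  have "\<exists>\<sigma>. metric_geodesic (T i) (T (i + 1)) (d (f i) (f (i + 1)) / (T (i + 1) - T i)) \<sigma>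
      \<and> \<sigma> (T i) = f i \<and> \<sigma> (T (i + 1)) = f (i + 1)" if i: "i \<in> {1..<n}" for i
  proof -
    have "f i \<in> M" "f (i + 1) \<in> M" using f i by (auto simp: Pi_iff)
    from metric_geodesic_exists[OF this T_Suc[OF i]] show ?thesis by metis
  qed
  then obtain \<sigma> where \<sigma>: "\<And>i. i \<in> {1..<n} \<Longrightarrow>
      metric_geodesic (T i) (T (i + 1)) (d (f i) (f (i + 1)) / (T (i + 1) - T i)) (\<sigma> i)"
    "\<And>i. i \<in> {1..<n} \<Longrightarrow> \<sigma> i (T i) = f i" "\<And>i. i \<in> {1..<n} \<Longrightarrow> \<sigma> i (T (i + 1)) = f (i + 1)" by metis
  \<comment> \<open>Well defined on [T 1, T n) by uniqueness of the half-open piece; elsewhere the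
    value is never consulted.\<close>
  define k where "k s = (SOME i. i \<in> {1..<n} \<and> T i \<le> s \<and> s < T (i + 1))" for s
  have k: "k s = i" if "i \<in> {1..<n}" "T i \<le> s" "s < T (i + 1)" for s i
    unfolding k_def by (rule some_equality) (use that T_piece_unique in blast)+
  define F where "F s = (if s \<le> T 1 then f 1 else if T n \<le> s then f n else \<sigma> (k s) s)" for s
  have half: "F s = \<sigma> i s" if i: "i \<in> {1..<n}" and s: "T i \<le> s" "s < T (i + 1)" for i s
  proof (cases "s \<le> T 1")
    case True
    have "i = 1" using T_less[of 1 i] i s True by (cases "i = 1") auto
    then show ?thesis using True s \<sigma>(2)[OF i] by (simp add: F_def)
  next
    case False
    have "s < T n" using T_le[of "i + 1" n] i s by auto
    then show ?thesis using False k[OF i s] by (simp add: F_def)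
  qed
  have node: "F (T i) = f i" if i: "i \<in> {1..n}" for i
  proof (cases "i = n")
    case True
    then show ?thesis using T_less[of 1 n] n1 by (cases "n = 1") (auto simp: F_def)
  next
    case False
    then have "i \<in> {1..<n}" using i by auto
    then show ?thesis using half[of i "T i"] T_Suc[of i] \<sigma>(2)[of i] by simp
  qed
  \<comment> \<open>Half-open pieces become closed ones because adjacent geodesics share the nodal
    value.\<close>
  have piece: "F s = \<sigma> i s" if i: "i \<in> {1..<n}" and s: "s \<in> {T i..T (i + 1)}" for i s
  proof (cases "s = T (i + 1)")
    case True
    then show ?thesis using node[of "i + 1"] \<sigma>(3)[OF i] i by simp
  next
    case False
    then show ?thesis using s by (intro half[OF i]) auto
  qed
  have "geodesic_interpolant M n t f F"
    unfolding geodesic_interpolant_def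
  proof (intro conjI ballI)
    show "i \<in> {1..n} \<Longrightarrow> F (T i) = f i" for i by (rule node)
    fix i assume i: "i \<in> {1..<n}"
    have "metric_geodesic (T i) (T (i + 1)) (d (f i) (f (i + 1)) / (T (i + 1) - T i)) F"
      using \<sigma>(1)[OF i] piece[OF i] unfolding metric_geodesic_def by (simp add: image_subset_iff)
    then show "minimizing_geodesic_on M (T i) (T (i + 1)) F" by (rule metric_geodesic_minimizing[OF T_Suc[OF i]])
  next
    fix s assume s: "s \<in> {0..T 1}"
    show "(F has_vector_derivative 0) (at s within {0..T 1})"
      by (rule has_vector_derivative_transform[OF s _ has_vector_derivative_const[of "f 1"]]) (simp add: F_def)
  next
    fix s assume s: "s \<in> {T n..1}"
    show "(F has_vector_derivative 0) (at s within {T n..1})"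
    proof (rule has_vector_derivative_transform[OF s _ has_vector_derivative_const[of "f n"]])
      fix u assume u: "u \<in> {T n..1}"
      then show "F u = f n" using T_le[of 1 n] n1 node[of n] by (cases "u \<le> T 1") (auto simp: F_def)
    qed
  qed
  then show ?thesis by blast
qed

text \<open>The pieces have constant speed, so the piecewise velocity is bounded and serves as a
  weak derivative; its squared norm integrates to d^2 / \<Delta> on each design interval and to zero
  on the boundary intervals.\<close>

lemma geodesic_interpolant_H1:
  assumes f: "f \<in> {1..n} \<rightarrow> M" and F: "geodesic_interpolant M n t f F"
  shows "F \<in> H1_maps M" "Risk F = Phi f"
proof -
  define v where "v i = velocity (T i) (T (i + 1)) F" for i
  define c where "c i = d (f i) (f (i + 1)) / (T (i + 1) - T i)" for i
  have node: "F (T i) = f i" if "i \<in> {1..n}" for i using F that by (auto simp: geodesic_interpolant_def)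
  have min: "minimizing_geodesic_on M (T i) (T (i + 1)) F" if "i \<in> {1..<n}" for i
    using F that unfolding geodesic_interpolant_def by blast
  have geo: "geodesic_on M (T i) (T (i + 1)) F" if "i \<in> {1..<n}" for i
    using min[OF that] by (simp add: minimizing_geodesic_on_def)
  have sm: "smooth_map_on {T i..T (i + 1)} F" if "i \<in> {1..<n}" for i
    using geo[OF that] by (simp add: geodesic_on_def)
  have len: "curve_length (T i) (T (i + 1)) F = d (f i) (f (i + 1))" if "i \<in> {1..<n}" for i
    using min[OF that] node[of i] node[of "i + 1"] that by (simp add: minimizing_geodesic_on_def)
  have speed: "norm (v i s) = c i" if "i \<in> {1..<n}" "s \<in> {T i..T (i + 1)}" for i s
    using geodesic_constant_speed[OF geo[OF that(1)] T_Suc[OF that(1)] that(2)] len[OF that(1)]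
    by (simp add: v_def c_def)
  have c0: "c i \<ge> 0" if "i \<in> {1..<n}" for i
    using speed[OF that, of "T i"] T_Suc[OF that] norm_ge_zero[of "v i (T i)"] by simp
  have Tb: "0 \<le> T 1" "T 1 \<le> T n" "T n \<le> 1" "T 1 \<le> 1" "0 \<le> T n" using n1 by (auto intro: T01 T_le)
  have left: "F s = f 1" if s: "s \<in> {0..T 1}" for s
  proof -
    obtain k where k: "\<And>u. u \<in> {0..T 1} \<Longrightarrow> F u = k"
      using has_vector_derivative_zero_constant[of "{0..T 1}" F] F by (auto simp: geodesic_interpolant_def)
    show ?thesis using k[OF s] k[of "T 1"] Tb node[of 1] n1 by simp
  qed
  have right: "F s = f n" if s: "s \<in> {T n..1}" for s
  proof -
    obtain k where k: "\<And>u. u \<in> {T n..1} \<Longrightarrow> F u = k"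
      using has_vector_derivative_zero_constant[of "{T n..1}" F] F by (auto simp: geodesic_interpolant_def)
    show ?thesis using k[OF s] k[of "T n"] Tb node[of n] n1 by simp
  qed
  have fM: "f 1 \<in> M" "f n \<in> M" using f n1 by (auto simp: Pi_iff)
  have FM: "F s \<in> M" if s: "s \<in> {0..1}" for s
  proof -
    consider "s \<le> T 1" | "T n \<le> s" | "T 1 \<le> s" "s < T n" by linarith
    then show ?thesis
    proof cases
      case 3
      then obtain i where i: "i \<in> {1..<n}" "T i \<le> s" "s < T (i + 1)" using T_piece_exists by blast
      then have "F ` {T i..T (i + 1)} \<subseteq> M" using geo[OF i(1)] by (simp add: geodesic_on_def)
      then show ?thesis using i by auto
    qed (use left[of s] right[of s] s fM in auto)
  qed
  have "k \<le> n \<Longrightarrow> 1 \<le> k \<Longrightarrow> continuous_on {0..T k} F" for k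
  proof (induction k)
    case (Suc k)
    show ?case
    proof (cases "k = 0")
      case True
      have "continuous_on {0..T 1} (\<lambda>s. f 1)" by (rule continuous_on_const)
      then have "continuous_on {0..T 1} F" by (rule continuous_on_eq) (simp add: left)
      then show ?thesis using True by simp
    next
      case False
      then have k: "k \<in> {1..<n}" using Suc.prems by auto
      have "{0..T k} \<union> {T k..T (k + 1)} = {0..T (Suc k)}"
        using T01[of k] T_Suc[OF k] k by auto
      moreover have "continuous_on ({0..T k} \<union> {T k..T (k + 1)}) F"
      proof (rule continuous_on_closed_Un[OF closed_atLeastAtMost closed_atLeastAtMost])
        show "continuous_on {0..T k} F" using Suc.IH Suc.prems False by simp
        show "continuous_on {T k..T (k + 1)} F" by (rule smooth_map_on_imp_continuous_on[OF sm[OF k]])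
      qed
      ultimately show ?thesis by simp
    qed
  qed simp
  then have "continuous_on {0..T n} F" using n1 by blast
  moreover have "continuous_on {T n..1} F"
  proof -
    have "continuous_on {T n..1} (\<lambda>s. f n)" by (rule continuous_on_const)
    then show ?thesis by (rule continuous_on_eq) (simp add: right)
  qed
  moreover have "{0..T n} \<union> {T n..1} = {0..1}" using Tb by auto
  ultimately have cont: "continuous_on {0..1} F"
    by (metis closed_atLeastAtMost continuous_on_closed_Un)
  \<comment> \<open>The open pieces are disjoint, so at most one summand is nonzero; the finitely
    many nodes receive the value 0.\<close>
  define G where "G s = (\<Sum>i=1..<n. if s \<in> {T i<..<T (i + 1)} then v i s else 0)" for s
  have Gin: "G s = v i s" if i: "i \<in> {1..<n}" and s: "s \<in> {T i<..<T (i + 1)}" for i s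
  proof -
    have "(if s \<in> {T j<..<T (j + 1)} then v j s else 0) = (if j = i then v i s else 0)" if j: "j \<in> {1..<n}" for j
    proof (cases "j = i")
      case False
      have "s \<notin> {T j<..<T (j + 1)}"
      proof
        assume sj: "s \<in> {T j<..<T (j + 1)}"
        have "i = j" by (rule T_piece_unique[OF i j, of s]) (use s sj in simp_all)
        then show False using False by simp
      qed
      then show ?thesis using False by (simp only: if_False)
    qed (use s in simp)
    then have "G s = (\<Sum>j=1..<n. if j = i then v i s else 0)" unfolding G_def by (intro sum.cong refl) simp_all
    also have "\<dots> = v i s" using i by (simp add: sum.delta)
    finally show ?thesis .
  qed
  have Gout: "G s = 0" if "s < T 1 \<or> T n < s" for s
    unfolding G_def
  proof (rule sum.neutral, rule ballI)
    fix i assume i: "i \<in> {1..<n}"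
    have "T 1 \<le> T i" "T (i + 1) \<le> T n" using i by (auto intro: T_le)
    then show "(if s \<in> {T i<..<T (i + 1)} then v i s else 0) = 0" using that by auto
  qed
  \<comment> \<open>A crude common bound: the sum of the speeds of all pieces.\<close>
  define B where "B = (\<Sum>i=1..<n. c i)"
  have bG: "norm (G s) \<le> B" for s
    unfolding G_def B_def using speed c0 by (intro sum_norm_le) auto
  have mG: "G \<in> borel_measurable (lebesgue_on {0..1})"
    unfolding G_def[abs_def]
  proof (intro borel_measurable_sum measurable_restrict_space1)
    fix i assume i: "i \<in> {1..<n}"
    have "continuous_on {T i<..<T (i + 1)} (v i)"
      unfolding v_def
      by (rule continuous_on_subset[OF smooth_map_on_imp_continuous_on[OF smooth_map_on_velocity[OF sm[OF i] T_Suc[OF i]]]]) auto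
    then show "(\<lambda>s. if s \<in> {T i<..<T (i + 1)} then v i s else 0) \<in> borel_measurable lebesgue"
      by (intro borel_measurable_if_I continuous_imp_measurable_on_sets_lebesgue) auto
  qed
  have D: "(F has_vector_derivative G s) (at s)" if s: "s \<in> {0<..<1} - T ` {1..n}" for s
  proof -
    have ne: "s \<noteq> T i" if "i \<in> {1..n}" for i using s that by blast
    consider "s < T 1" | "T n < s" | "T 1 \<le> s" "s < T n" using ne[of n] n1 by fastforce
    then show ?thesis
    proof cases
      case 1
      have "((\<lambda>u. f 1) has_vector_derivative G s) (at s)" using Gout 1 by simp
      then show ?thesis
        by (rule has_vector_derivative_transform_within_open[where S = "{0<..<T 1}"]) (use 1 s left in auto)
    next
      case 2
      have "((\<lambda>u. f n) has_vector_derivative G s) (at s)" using Gout 2 by simp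
      then show ?thesis
        by (rule has_vector_derivative_transform_within_open[where S = "{T n<..<1}"]) (use 2 s right in auto)
    next
      case 3
      then obtain i where i: "i \<in> {1..<n}" "T i \<le> s" "s < T (i + 1)" using T_piece_exists by blast
      then have s': "s \<in> {T i<..<T (i + 1)}" using ne[of i] by auto
      have "(F has_vector_derivative v i s) (at s within {T i..T (i + 1)})"
        unfolding v_def by (rule smooth_curve_velocity[OF sm[OF i(1)] T_Suc[OF i(1)]]) (use i in auto)
      then show ?thesis using Gin[OF i(1) s'] s' by (simp add: at_within_Icc_at)
    qed
  qed
  have "finite (T ` {1..n})" by simp
  note wd = piecewise_weak_deriv[OF cont this D mG bG]
  show "F \<in> H1_maps M" using wd(3) FM by (simp add: H1_maps_def)
  have iG: "integrable (lebesgue_on {0..1}) (\<lambda>s. (norm (G s))\<^sup>2)" using wd(1) by (simp add: L2_unit_def)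
  have "J1 F = integral {0..1} (\<lambda>s. (norm (G s))\<^sup>2)"
    using J1_eq[OF wd(3,1,2)] lebesgue_integral_eq_integral[OF iG] by simp
  also have "\<dots> = integral {0..T 1} (\<lambda>s. (norm (G s))\<^sup>2)
      + (\<Sum>i=1..<n. integral {T i..T (i + 1)} (\<lambda>s. (norm (G s))\<^sup>2)) + integral {T n..1} (\<lambda>s. (norm (G s))\<^sup>2)"
    by (rule integral_pieces, rule integrable_on_lebesgue_on[OF iG]) simp
  also have "integral {0..T 1} (\<lambda>s. (norm (G s))\<^sup>2) = 0"
    by (rule integral_unique, rule has_integral_spike_finite[OF _ _ has_integral_0, of "{T 1}"]) (use Gout in auto)
  also have "integral {T n..1} (\<lambda>s. (norm (G s))\<^sup>2) = 0"
    by (rule integral_unique, rule has_integral_spike_finite[OF _ _ has_integral_0, of "{T n}"]) (use Gout in auto)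
  also have "(\<Sum>i=1..<n. integral {T i..T (i + 1)} (\<lambda>s. (norm (G s))\<^sup>2)) = roughness f"
    unfolding roughness_def
  proof (rule sum.cong[OF refl])
    fix i assume i: "i \<in> {1..<n}"
    have "((\<lambda>s. (c i)\<^sup>2) has_integral (T (i + 1) - T i) * (c i)\<^sup>2) {T i..T (i + 1)}"
      using has_integral_const_real[of "(c i)\<^sup>2" "T i" "T (i + 1)"] T_Suc[OF i] by simp
    then have "((\<lambda>s. (norm (G s))\<^sup>2) has_integral (T (i + 1) - T i) * (c i)\<^sup>2) {T i..T (i + 1)}"
      by (rule has_integral_spike_finite[rotated 2, of _ _ _ "{T i, T (i + 1)}"]) (use Gin[OF i] speed[OF i] in auto)
    then have "integral {T i..T (i + 1)} (\<lambda>s. (norm (G s))\<^sup>2) = (T (i + 1) - T i) * (c i)\<^sup>2" by (rule integral_unique)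
    also have "\<dots> = (d (f i) (f (i + 1)))\<^sup>2 / (T (i + 1) - T i)"
      using T_Suc[OF i] by (simp add: c_def power2_eq_square)
    finally show "integral {T i..T (i + 1)} (\<lambda>s. (norm (G s))\<^sup>2) = (d (f i) (f (i + 1)))\<^sup>2 / (T (i + 1) - T i)" .
  qed
  finally have "J1 F = roughness f" by simp
  then show "Risk F = Phi f" unfolding Risk_eq Phi_eq by (simp add: node)
qed

text \<open>The direct method: a minimising sequence in the compact product has a convergent
  subsequence, and \<open>Phi\<close> is continuous along it because \<open>d\<close> is.\<close>

lemma Phi_attains_minimum: "\<exists>f. is_arg_min Phi (\<lambda>f. f \<in> {1..n} \<rightarrow> M) f"
proof -
  let ?X = "Phi ` ({1..n} \<rightarrow> M)"
  have "Y 1 \<in> M" using YM n1 by simp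
  then have ne: "?X \<noteq> {}" by (auto intro: exI[of _ "\<lambda>_. Y 1"])
  have "0 \<le> Phi f" for f
    unfolding Phi_eq roughness_def using lam T_Suc
    by (intro add_nonneg_nonneg mult_nonneg_nonneg divide_nonneg_nonneg sum_nonneg) (auto simp: less_imp_le)
  then have bdd: "bdd_below ?X" by (intro bdd_belowI[of _ 0]) auto
  have "\<exists>f\<in>{1..n} \<rightarrow> M. Phi f < Inf ?X + inverse (real (Suc k))" for k
    using cInf_lessD[OF ne, of "Inf ?X + inverse (real (Suc k))"] by auto
  then obtain f where f: "\<And>k. f k \<in> {1..n} \<rightarrow> M" "\<And>k. Phi (f k) < Inf ?X + inverse (real (Suc k))" by metis
  have fM: "f k i \<in> M" if "i \<in> {1..n}" for k i using f(1) that by blast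
  have "\<exists>r l. strict_mono (r :: nat \<Rightarrow> nat) \<and> (\<forall>i\<in>{1..n}. l i \<in> M \<and> (\<lambda>k. f (r k) i) \<longlonglongrightarrow> l i)"
    by (rule compact_finite_product_subsequence[OF compact]) (use fM in auto)
  then obtain r l where rl: "strict_mono (r :: nat \<Rightarrow> nat)" "\<forall>i\<in>{1..n}. l i \<in> M \<and> (\<lambda>k. f (r k) i) \<longlonglongrightarrow> l i"
    by (elim exE conjE)
  have lM: "l \<in> {1..n} \<rightarrow> M" using rl(2) by blast
  have "(\<lambda>k. Phi (f (r k))) \<longlonglongrightarrow> Phi l"
    unfolding Phi_eq roughness_def
  proof (intro tendsto_add tendsto_mult tendsto_divide tendsto_sum tendsto_power tendsto_const)
    show "(\<lambda>k. d (response i) (f (r k) i)) \<longlonglongrightarrow> d (response i) (l i)" if "i \<in> {1..n}" for i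
      by (rule tendsto_d[OF tendsto_const]) (use rl(2) fM response_in that in auto)
    show "(\<lambda>k. d (f (r k) i) (f (r k) (i + 1))) \<longlonglongrightarrow> d (l i) (l (i + 1))" if "i \<in> {1..<n}" for i
      by (rule tendsto_d) (use rl(2) fM that in auto)
    show "T (i + 1) - T i \<noteq> 0" if "i \<in> {1..<n}" for i using T_Suc[OF that] by simp
  qed (use n1 in auto)
  moreover have "(\<lambda>k. Inf ?X + inverse (real (Suc (r k)))) \<longlonglongrightarrow> Inf ?X + 0"
    using LIMSEQ_subseq_LIMSEQ[OF LIMSEQ_inverse_real_of_nat rl(1)] by (intro tendsto_add tendsto_const) (simp add: o_def)
  ultimately have "Phi l \<le> Inf ?X + 0"
    by (rule LIMSEQ_le) (use f(2) in \<open>auto intro: less_imp_le\<close>)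
  then have "\<not> Phi g < Phi l" if "g \<in> {1..n} \<rightarrow> M" for g
    using cInf_lower[OF imageI[OF that] bdd] by simp
  then show ?thesis using lM unfolding is_arg_min_def by blast
qed

section \<open>Comparison of the continuous and the discrete problem\<close>

lemma Risk_lower_bound: "F \<in> H1_maps M \<Longrightarrow> Phi (\<lambda>i. F (T i)) \<le> Risk F"
  using H1_maps_lower_bound(1)[of F] lam unfolding Risk_eq Phi_eq by simp

lemma nodal_values_in: "F \<in> H1_maps M \<Longrightarrow> (\<lambda>i. F (T i)) \<in> {1..n} \<rightarrow> M"
  using T01 by (auto simp: H1_maps_def)

text \<open>The infimum is a minimum: a geodesic interpolant is feasible and attains the lower
  bound.\<close>

lemma constrained_infimum:
  assumes f: "f \<in> {1..n} \<rightarrow> M"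
  shows "(INF F \<in> {F \<in> H1_maps M. \<forall>i\<in>{1..n}. F (T i) = f i}. Risk F) = Phi f"
proof (rule cInf_eq_minimum)
  obtain F where F: "geodesic_interpolant M n t f F" using geodesic_interpolant_exists[OF f] by blast
  then have "\<forall>i\<in>{1..n}. F (T i) = f i" by (simp add: geodesic_interpolant_def)
  then show "Phi f \<in> Risk ` {F \<in> H1_maps M. \<forall>i\<in>{1..n}. F (T i) = f i}"
    using geodesic_interpolant_H1[OF f F] by (intro image_eqI[of _ _ F]) auto
next
  fix x assume "x \<in> Risk ` {F \<in> H1_maps M. \<forall>i\<in>{1..n}. F (T i) = f i}"
  then obtain F where F: "F \<in> H1_maps M" "\<forall>i\<in>{1..n}. F (T i) = f i" "x = Risk F" by blast
  have "Phi (\<lambda>i. F (T i)) = Phi f" by (rule Phi_cong) (use F in auto)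
  then show "Phi f \<le> x" using Risk_lower_bound[OF F(1)] F(3) by simp
qed

lemma geodesic_interpolant_unique:
  assumes inj: "\<forall>i\<in>{1..<n}. ereal (d (f i) (f (i + 1))) < inj_radius M"
    and F: "geodesic_interpolant M n t f F" and G: "geodesic_interpolant M n t f G" and s: "s \<in> {0..1}"
  shows "F s = G s"
proof -
  have node: "F (T i) = f i" "G (T i) = f i" if "i \<in> {1..n}" for i
    using F G that unfolding geodesic_interpolant_def by blast+
  have const: "H u = H w" if "\<forall>s\<in>{a..b}. (H has_vector_derivative 0) (at s within {a..b})" "u \<in> {a..b}" "w \<in> {a..b}"
    for H :: "real \<Rightarrow> 'a" and a b u w :: real
  proof -
    have "\<exists>k. \<forall>u\<in>{a..b}. H u = k"
    proof (rule has_vector_derivative_zero_constant[of "{a..b}" H])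
      show "\<exists>k. \<forall>u\<in>{a..b}. H u = k" if "\<And>u. u \<in> {a..b} \<Longrightarrow> H u = k" for k
        using that by blast
    qed (use that(1) in auto)
    then show ?thesis using that(2,3) by auto
  qed
  have one: "1 \<in> {1..n}" and last: "n \<in> {1..n}" using n1 by auto
  consider "s \<le> T 1" | "T n \<le> s" | "T 1 \<le> s" "s < T n" by linarith
  then show ?thesis
  proof cases
    case 1
    then have "s \<in> {0..T 1}" "T 1 \<in> {0..T 1}" using s by auto
    then have "F s = F (T 1)" "G s = G (T 1)"
      using F G const[of 0 "T 1" _ s "T 1"] unfolding geodesic_interpolant_def by blast+
    then show ?thesis using node[OF one] by argo
  next
    case 2
    then have "s \<in> {T n..1}" "T n \<in> {T n..1}" using s by auto
    then have "F s = F (T n)" "G s = G (T n)"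
      using F G const[of "T n" 1 _ s "T n"] unfolding geodesic_interpolant_def by blast+
    then show ?thesis using node[OF last] by argo
  next
    case 3
    then obtain i where i: "i \<in> {1..<n}" "T i \<le> s" "s < T (i + 1)" using T_piece_exists by blast
    then have i': "i \<in> {1..n}" "i + 1 \<in> {1..n}" by auto
    have "minimizing_geodesic_on M (T i) (T (i + 1)) F" "minimizing_geodesic_on M (T i) (T (i + 1)) G"
      using F G i(1) unfolding geodesic_interpolant_def by blast+
    then show ?thesis
      by (rule minimizing_geodesic_unique[OF _ _ T_Suc[OF i(1)]])
         (use i inj in \<open>simp_all only: node[OF i'(1)] node[OF i'(2)], simp_all\<close>)
  qed
qed

text \<open>Comparison with interpolants bounds \<open>Risk F\<close> by \<open>Phi\<close> of every
  nodal vector. For the nodal values of F itself the data terms cancel, and lam > 0 leaves J1 F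
  \<le> roughness, the equality case; any other vector gives minimality.\<close>

lemma penalized_minimizer:
  assumes F: "is_arg_min Risk (\<lambda>F. F \<in> H1_maps M) F"
  shows "geodesic_interpolant M n t (\<lambda>i. F (T i)) F"
    and "is_arg_min Phi (\<lambda>f. f \<in> {1..n} \<rightarrow> M) (\<lambda>i. F (T i))"
proof -
  have FM: "F \<in> H1_maps M" and min: "\<And>G. G \<in> H1_maps M \<Longrightarrow> Risk F \<le> Risk G"
    using F by (auto simp: is_arg_min_linorder)
  have le: "Risk F \<le> Phi g" if g: "g \<in> {1..n} \<rightarrow> M" for g
  proof -
    obtain G where "geodesic_interpolant M n t g G" using geodesic_interpolant_exists[OF g] by blast
    from geodesic_interpolant_H1[OF g this] min show ?thesis by metis
  qed
  have "Risk F \<le> Phi (\<lambda>i. F (T i))" by (rule le[OF nodal_values_in[OF FM]])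
  then have "J1 F \<le> roughness (\<lambda>i. F (T i))" using lam unfolding Risk_eq Phi_eq by simp
  then show "geodesic_interpolant M n t (\<lambda>i. F (T i)) F" by (rule H1_maps_lower_bound(2)[OF FM])
  have "Phi (\<lambda>i. F (T i)) \<le> Phi g" if "g \<in> {1..n} \<rightarrow> M" for g
    using Risk_lower_bound[OF FM] le[OF that] by linarith
  then show "is_arg_min Phi (\<lambda>f. f \<in> {1..n} \<rightarrow> M) (\<lambda>i. F (T i))"
    using nodal_values_in[OF FM] by (simp add: is_arg_min_linorder)
qed

text \<open>The continuous minimum is produced from the discrete one: the interpolant of an optimal
  nodal vector is optimal.\<close>

lemma common_minimum:
  "\<exists>F f. is_arg_min Risk (\<lambda>F. F \<in> H1_maps M) F \<and> is_arg_min Phi (\<lambda>f. f \<in> {1..n} \<rightarrow> M) f \<and> Risk F = Phi f"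
proof -
  obtain f where f: "is_arg_min Phi (\<lambda>f. f \<in> {1..n} \<rightarrow> M) f" using Phi_attains_minimum by blast
  then have fM: "f \<in> {1..n} \<rightarrow> M" and min: "\<And>g. g \<in> {1..n} \<rightarrow> M \<Longrightarrow> Phi f \<le> Phi g"
    by (auto simp: is_arg_min_linorder)
  obtain F where "geodesic_interpolant M n t f F" using geodesic_interpolant_exists[OF fM] by blast
  note F = geodesic_interpolant_H1[OF fM this]
  have "Risk F \<le> Risk G" if "G \<in> H1_maps M" for G
    using Risk_lower_bound[OF that] min[OF nodal_values_in[OF that]] F(2) by linarith
  then have "is_arg_min Risk (\<lambda>F. F \<in> H1_maps M) F" using F(1) by (simp add: is_arg_min_linorder)
  then show ?thesis using f F(2) by blast
qed

end

text \<open>The infimum in (a) is taken in the reals, where it is meaningful since interpolants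
  exist and attain it. Uniqueness compares maps on [0, 1] only, since functions are total.\<close>

theorem proposition5p6:
  fixes M :: "'a::euclidean_space set" and m n :: nat
    and t :: "nat \<Rightarrow> real" and Y :: "nat \<Rightarrow> 'a" and lam :: real
  assumes "smooth_submanifold m M" and "compact M" and "connected M"
    and "n \<ge> 1"
    and "\<And>i. i \<in> {1..n} \<Longrightarrow> t i \<in> {0..1}"
    and "inj_on t {1..n}"
    and "\<And>i. i \<in> {1..n} \<Longrightarrow> Y i \<in> M"
    and "lam > 0"
  shows "(\<forall>f \<in> {1..n} \<rightarrow> M.
        (INF F \<in> {F \<in> H1_maps M. \<forall>i\<in>{1..n}. F (ord_stat n t i) = f i}.
            penalized_risk M n t Y lam F) = phi_disc M n t Y lam f
      \<and> (\<exists>F. geodesic_interpolant M n t f F)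
      \<and> (\<forall>F. geodesic_interpolant M n t f F \<longrightarrow>
            F \<in> H1_maps M \<and> penalized_risk M n t Y lam F = phi_disc M n t Y lam f)
      \<and> ((\<forall>i\<in>{1..<n}. ereal (geodesic_dist M (f i) (f (i + 1))) < inj_radius M) \<longrightarrow>
            (\<forall>F G. geodesic_interpolant M n t f F \<and> geodesic_interpolant M n t f G \<longrightarrow>
               (\<forall>s\<in>{0..1}. F s = G s))))
    \<and> (\<forall>F. is_arg_min (penalized_risk M n t Y lam) (\<lambda>F. F \<in> H1_maps M) F \<longrightarrow>
        geodesic_interpolant M n t (\<lambda>i. F (ord_stat n t i)) F
      \<and> is_arg_min (phi_disc M n t Y lam) (\<lambda>f. f \<in> {1..n} \<rightarrow> M) (\<lambda>i. F (ord_stat n t i)))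
    \<and> (\<exists>F f. is_arg_min (penalized_risk M n t Y lam) (\<lambda>F. F \<in> H1_maps M) F
      \<and> is_arg_min (phi_disc M n t Y lam) (\<lambda>f. f \<in> {1..n} \<rightarrow> M) f
      \<and> penalized_risk M n t Y lam F = phi_disc M n t Y lam f)"
proof -
  interpret regression_design M m n t Y lam
  proof (rule regression_design.intro)
    show "closed_submanifold M m" by (rule closed_submanifold.intro) (use assms in simp_all)
    show "regression_design_axioms M n t Y lam" by (rule regression_design_axioms.intro) (use assms in simp_all)
  qed
  show ?thesis
  proof (intro conjI ballI allI impI)
    fix f assume f: "f \<in> {1..n} \<rightarrow> M"
    show "(INF F \<in> {F \<in> H1_maps M. \<forall>i\<in>{1..n}. F (T i) = f i}. Risk F) = Phi f"
      by (rule constrained_infimum[OF f])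
    show "\<exists>F. geodesic_interpolant M n t f F"
      by (rule geodesic_interpolant_exists[OF f])
    show "F \<in> H1_maps M" "Risk F = Phi f" if "geodesic_interpolant M n t f F" for F
      using geodesic_interpolant_H1[OF f that] by simp_all
    show "F s = G s"
      if "\<forall>i\<in>{1..<n}. ereal (d (f i) (f (i + 1))) < inj_radius M"
        and "geodesic_interpolant M n t f F \<and> geodesic_interpolant M n t f G" and "s \<in> {0..1}" for F G s
      using geodesic_interpolant_unique that by blast
  next
    fix F assume F: "is_arg_min Risk (\<lambda>F. F \<in> H1_maps M) F"
    show "geodesic_interpolant M n t (\<lambda>i. F (T i)) F"
      and "is_arg_min Phi (\<lambda>f. f \<in> {1..n} \<rightarrow> M) (\<lambda>i. F (T i))"
      by (rule penalized_minimizer[OF F])+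
  qed (rule common_minimum)
qed

end
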